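(* Let $H\in\mathbb{C}[x,y]$ be a polynomial of degree $n+1$ that is regular at infinity, and let $\widehat H$ be its principal homogeneous part. If $H$ has only one critical value (necessarily of multiplicity $\mu=n^2$), then there exist $\alpha,\beta,\gamma\in\mathbb{C}$ such that $$H(x,y)=\widehat H(x+\alpha,y+\beta)+\gamma .$$
   Context: The principal homogeneous part $\widehat H$ of a polynomial $H$ of degree $n+1$ is the sum of its terms of degree $n+1$. $H$ is regular at infinity if $\widehat H$ is a product of $n+1$ pairwise non-proportional linear forms (equivalently, $\widehat H$ has an isolated critical point at the origin). A critical value is a value $H(x_*,y_* )$ at a point $(x_*,y_* )\in\mathbb{C}^2$ with $dH(x_*,y_* )=0$; there are exactly $n^2$ critical points counted with multiplicity. *)

theory Defs
  imports Complex_Main "HOL-Computational_Algebra.Polynomial"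
begin

text \<open>
  A polynomial in \<open>\<complex>[x,y]\<close> is an element of \<open>\<complex>[x][y]\<close>: the outer variable is \<open>y\<close>, and
  the coefficient of \<open>x\<^sup>i y\<^sup>j\<close> in \<open>H\<close> is \<open>coeff (coeff H j) i\<close>.
\<close>

type_synonym bipoly = "complex poly poly"

definition eval2 :: "bipoly \<Rightarrow> complex \<Rightarrow> complex \<Rightarrow> complex" where
  "eval2 H x y = poly (poly H [:y:]) x"

definition total_degree :: "bipoly \<Rightarrow> nat" where
  "total_degree H = Max (insert 0 {i + j | i j. coeff (coeff H j) i \<noteq> 0})"

lemma finite_support: "finite {i + j | i j. coeff (coeff (H :: bipoly) j) i \<noteq> 0}"
proof (rule finite_subset)
  show "{i + j | i j. coeff (coeff H j) i \<noteq> 0}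
          \<subseteq> (\<lambda>(i, j). i + j) ` (SIGMA i:(\<Union>j\<le>degree H. {..degree (coeff H j)}). {..degree H})"
  proof
    fix k assume "k \<in> {i + j | i j. coeff (coeff H j) i \<noteq> 0}"
    then obtain i j where k: "k = i + j" and nz: "coeff (coeff H j) i \<noteq> 0" by blast
    from nz have "coeff H j \<noteq> 0" by auto
    then have "j \<le> degree H" by (rule le_degree)
    moreover from nz have "i \<le> degree (coeff H j)" by (rule le_degree)
    ultimately show "k \<in> (\<lambda>(i, j). i + j) `
        (SIGMA i:(\<Union>j\<le>degree H. {..degree (coeff H j)}). {..degree H})"
      using k by force
  qed
qed auto

definition principal_part :: "bipoly \<Rightarrow> bipoly" where
  "principal_part H =
     (let d = total_degree H
      in \<Sum>j\<le>d. monom (monom (coeff (coeff H j) (d - j)) (d - j)) j)"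

text \<open>The linear form \<open>a x + b y\<close>.\<close>

definition linear_form :: "complex \<Rightarrow> complex \<Rightarrow> bipoly" where
  "linear_form a b = [:[:0, a:], [:b:]:]"

lemma eval2_linear_form: "eval2 (linear_form a b) x y = a * x + b * y"
  by (simp add: eval2_def linear_form_def mult.commute)

text \<open>Proportionality is symmetric, and the zero form is proportional to every form.\<close>

definition proportional :: "bipoly \<Rightarrow> bipoly \<Rightarrow> bool" where
  "proportional l m \<longleftrightarrow> (\<exists>c :: complex. l = smult [:c:] m \<or> m = smult [:c:] l)"

definition regular_at_infinity :: "bipoly \<Rightarrow> bool" where
  "regular_at_infinity H \<longleftrightarrow>
     (\<exists>a b :: nat \<Rightarrow> complex.
        principal_part H = (\<Prod>i<total_degree H. linear_form (a i) (b i)) \<and>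
        (\<forall>i<total_degree H. \<forall>j<total_degree H. i \<noteq> j \<longrightarrow>
           \<not> proportional (linear_form (a i) (b i)) (linear_form (a j) (b j))))"

definition partial_x :: "bipoly \<Rightarrow> bipoly" where
  "partial_x H = map_poly pderiv H"

definition partial_y :: "bipoly \<Rightarrow> bipoly" where
  "partial_y H = pderiv H"

definition critical_point :: "bipoly \<Rightarrow> complex \<Rightarrow> complex \<Rightarrow> bool" where
  "critical_point H x y \<longleftrightarrow> eval2 (partial_x H) x y = 0 \<and> eval2 (partial_y H) x y = 0"

definition critical_values :: "bipoly \<Rightarrow> complex set" where
  "critical_values H = {eval2 H x y | x y. critical_point H x y}"

end

theory Submission
  imports Defs "HOL-Complex_Analysis.Complex_Analysis"
    "HOL-Computational_Algebra.Computational_Algebra" "HOL-Computational_Algebra.Field_as_Ring"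
begin

text \<open>
  Let \<open>c\<close> be the only critical value. For each linear factor \<open>\<ell>\<close> of the principal part, choose affine
  coordinates in which \<open>f = (H - c) / \<kappa>\<close> has the form \<open>x y\<^sup>n + \<dots>\<close>, with \<open>x = \<ell> - \<sigma>\<close>. The claim is that
  \<open>f\<close> vanishes on the line \<open>x = 0\<close> and has no critical point off it. Then all lines \<open>\<ell> = \<sigma>\<close> pass through
  any critical point of \<open>H\<close>; with that point as origin, \<open>H - c\<close> vanishes on \<open>n + 1\<close> lines through
  the origin, so that its homogeneous parts of degree at most \<open>n\<close> are zero.

  For the claim, consider the polar curve \<open>f\<^sub>y = 0\<close>, on which \<open>f' = f\<^sub>x\<close>, and compare over each \<open>x\<close> the
  products of \<open>f\<close> and of \<open>f\<^sub>x\<close> over the \<open>n - 1\<close> points of the polar. Their quotient is a rational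
  function of \<open>x\<close> that grows at most like \<open>x\<^sup>n\<^sup>-\<^sup>1\<close>, while each point where \<open>f\<close> vanishes on the polar
  contributes a zero. This bounds by \<open>n - 1\<close> the number of mergers between the roots of \<open>f(x, \<cdot>)\<close>.
  If \<open>f\<close> did not vanish identically on \<open>x = 0\<close>, one merger would be taken by the root that escapes
  to infinity there, and too few would remain to connect the branches of \<open>f = 0\<close>: they would split
  into two classes that never meet, which Liouville's theorem excludes, because distinct branches
  have distinct asymptotic directions.
\<close>

subsection \<open>Branches of a plane algebraic curve\<close>

text \<open>Euler's relation gives the growth bound: where \<open>f_y = 0\<close>,
  \<open>x f_x\<close> equals \<open>(n + 1) f\<close> up to lower terms, so each of the
  \<open>n - 1\<close> quotients \<open>f / f_x\<close> is \<open>O(x)\<close>. The single critical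
  value excludes poles: where \<open>f_y = 0\<close> and \<open>f\<close> is nonzero, so is
  \<open>f_x\<close>. The roots of \<open>f_y(s, .)\<close> at which \<open>f\<close> is nonzero are
  one fewer than the \<open>r(s)\<close> distinct roots of \<open>f(s, .)\<close>, so the bound says
  that the numbers \<open>n - r(s)\<close> add up to at most \<open>n - 1\<close>. Linking
  \<open>n\<close> sheets takes at least \<open>n - 1\<close> mergers, so all hinges on saving one:
  over \<open>x = 0\<close> some sheet tends to infinity, a limit that \<open>r(0)\<close> does not
  count. The obstacle is that branches are multivalued around branch points. In place of Puiseux
  series, sheets are lifted through a covering over simply connected domains: a half-plane under
  \<open>exp\<close>, which unwinds a punctured disc, for the local orders of vanishing, and a slit
  plane for the global splitting. The polar curve may have multiple components, so the count is done
  for prime factors and added up.\<close>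

definition slice :: "bipoly \<Rightarrow> complex \<Rightarrow> complex poly" where
  "slice p x = map_poly (\<lambda>c. poly c x) p"

lemma coeff_slice: "coeff (slice p x) j = poly (coeff p j) x"
  by (simp add: slice_def coeff_map_poly)

lemma slice_0 [simp]: "slice 0 x = 0"
  by (simp add: slice_def)

lemma slice_pCons: "slice (pCons a p) x = pCons (poly a x) (slice p x)"
  by (simp add: poly_eq_iff coeff_slice coeff_pCons split: nat.splits)

lemma eval2_0 [simp]: "eval2 0 x y = 0"
  by (simp add: eval2_def)

lemma eval2_pCons: "eval2 (pCons a p) x y = poly a x + y * eval2 p x y"
  by (simp add: eval2_def)

lemma poly_slice: "poly (slice p x) y = eval2 p x y"
  by (induction p) (simp_all add: slice_pCons eval2_pCons)

lemma eval2_add: "eval2 (p + q) x y = eval2 p x y + eval2 q x y"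
  by (simp add: eval2_def)

lemma eval2_diff: "eval2 (p - q) x y = eval2 p x y - eval2 q x y"
  by (simp add: eval2_def)

lemma eval2_mult: "eval2 (p * q) x y = eval2 p x y * eval2 q x y"
  by (simp add: eval2_def)

lemma eval2_power: "eval2 (p ^ k) x y = eval2 p x y ^ k"
  by (induction k) (simp_all add: eval2_mult, simp add: eval2_def)

lemma eval2_prod: "eval2 (prod g A) x y = (\<Prod>i\<in>A. eval2 (g i) x y)"
  by (induction A rule: infinite_finite_induct) (simp_all add: eval2_mult, simp_all add: eval2_def)

lemma eval2_sum: "eval2 (sum g A) x y = (\<Sum>i\<in>A. eval2 (g i) x y)"
  by (induction A rule: infinite_finite_induct) (simp_all add: eval2_add)

lemma eval2_smult: "eval2 (smult c p) x y = poly c x * eval2 p x y"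
  by (simp add: eval2_def)

lemma eval2_const: "eval2 [:c:] x y = poly c x"
  by (simp add: eval2_def)

lemma eval2_altdef: "eval2 p x y = (\<Sum>j\<le>degree p. poly (coeff p j) x * y ^ j)"
proof -
  have "poly p [:y:] = (\<Sum>j\<le>degree p. coeff p j * [:y:] ^ j)"
    by (rule poly_altdef)
  then show ?thesis by (simp add: eval2_def poly_sum)
qed

lemma slice_mult: "slice (p * q) x = slice p x * slice q x"
  by (simp add: poly_eq_poly_eq_iff[symmetric] fun_eq_iff poly_slice eval2_mult)

lemma pderiv_slice: "slice (pderiv p) x = pderiv (slice p x)"
  by (simp add: poly_eq_iff coeff_slice coeff_pderiv algebra_simps)

lemma degree_slice_le: "degree (slice p x) \<le> degree p"
  by (rule degree_le) (auto simp: coeff_slice coeff_eq_0)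

lemma degree_slice: "poly (lead_coeff p) x \<noteq> 0 \<Longrightarrow> degree (slice p x) = degree p"
  by (metis antisym coeff_slice degree_slice_le le_degree)

lemma eval2_has_derivative:
  assumes "(\<xi> has_field_derivative \<xi>') (at w within U)" "(Y has_field_derivative Y') (at w within U)"
  shows "((\<lambda>w. eval2 p (\<xi> w) (Y w)) has_field_derivative
      eval2 (partial_x p) (\<xi> w) (Y w) * \<xi>' + eval2 (partial_y p) (\<xi> w) (Y w) * Y') (at w within U)"
proof (induction p)
  case 0
  show ?case by (simp add: partial_x_def partial_y_def)
next
  case (pCons a p)
  have "partial_x (pCons a p) = pCons (pderiv a) (partial_x p)"
    by (simp add: partial_x_def poly_eq_iff coeff_map_poly coeff_pCons split: nat.splits)
  moreover have "((\<lambda>w. poly a (\<xi> w)) has_field_derivative poly (pderiv a) (\<xi> w) * \<xi>') (at w within U)"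
    using DERIV_chain[OF poly_DERIV assms(1)] by (simp add: o_def)
  moreover note DERIV_mult[OF assms(2) pCons.IH]
  ultimately show ?case
    unfolding eval2_pCons
    by (elim DERIV_cong[OF DERIV_add])
      (simp_all add: eval2_pCons partial_y_def pderiv_pCons eval2_add algebra_simps)
qed

lemma eval2_holomorphic:
  assumes "\<xi> holomorphic_on U" "Y holomorphic_on U"
  shows "(\<lambda>w. eval2 p (\<xi> w) (Y w)) holomorphic_on U"
  unfolding holomorphic_on_def field_differentiable_def
proof
  fix w assume "w \<in> U"
  with assms obtain \<xi>' Y' where "(\<xi> has_field_derivative \<xi>') (at w within U)"
      "(Y has_field_derivative Y') (at w within U)"
    unfolding holomorphic_on_def field_differentiable_def by meson
  from eval2_has_derivative[OF this]
  show "\<exists>D. ((\<lambda>w. eval2 p (\<xi> w) (Y w)) has_field_derivative D) (at w within U)" by blast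
qed

lemma eval2_tendsto:
  assumes "(f \<longlongrightarrow> a) F" "(g \<longlongrightarrow> b) F"
  shows "((\<lambda>w. eval2 p (f w) (g w)) \<longlongrightarrow> eval2 p a b) F"
  unfolding eval2_altdef by (intro tendsto_intros assms)

text \<open>Bezout over the field C(x) with denominators cleared: a nonzero element of least
  y-degree in the ideal of \<open>p\<close> and \<open>q\<close> divides, up to a factor from C[x],
  every element of the ideal, because the remainder of a pseudo-division stays in the ideal.\<close>

lemma bezout_gcd:
  fixes p q :: bipoly
  assumes "p \<noteq> 0"
  obtains g a b c h c' k where "g \<noteq> 0" "g = a * p + b * q" "c \<noteq> 0" "smult c p = g * h"
    "c' \<noteq> 0" "smult c' q = g * k"
proof -
  define I where "I = {g. \<exists>a b. g = a * p + b * q}"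
  have "p \<in> I" "q \<in> I"
  proof -
    have "p = 1 * p + 0 * q" "q = 0 * p + 1 * q" by simp_all
    then show "p \<in> I" "q \<in> I" unfolding I_def by blast+
  qed
  define g where "g = (ARG_MIN degree g. g \<in> I \<and> g \<noteq> 0)"
  have "g \<in> I \<and> g \<noteq> 0" and min: "\<And>r. r \<in> I \<Longrightarrow> r \<noteq> 0 \<Longrightarrow> degree g \<le> degree r"
    using arg_min_nat_lemma[of "\<lambda>g. g \<in> I \<and> g \<noteq> 0" p degree] assms \<open>p \<in> I\<close>
    by (auto simp: g_def)
  then obtain a b where g: "g = a * p + b * q" "g \<noteq> 0" by (auto simp: I_def)
  have div: "\<exists>c h. c \<noteq> 0 \<and> smult c r = g * h" if rI: "r \<in> I" for r
  proof -
    obtain c h where ch: "c \<noteq> 0" "smult c r = g * h + pseudo_mod r g"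
      using pseudo_mod(1)[OF g(2)] by blast
    obtain a' b' where r: "r = a' * p + b' * q" using rI unfolding I_def by blast
    have "pseudo_mod r g = [:c:] * r - g * h" using ch by simp
    also have "\<dots> = ([:c:] * a' - h * a) * p + ([:c:] * b' - h * b) * q"
      unfolding r g(1) by (simp only: algebra_simps)
    finally have "pseudo_mod r g \<in> I" by (auto simp: I_def)
    then have "pseudo_mod r g = 0"
      using pseudo_mod(2)[OF g(2), of r] min by (metis not_less)
    with ch show ?thesis by auto
  qed
  from div[OF \<open>p \<in> I\<close>] div[OF \<open>q \<in> I\<close>] g show ?thesis
    using that by metis
qed

text \<open>The prime \<open>p\<close> divides \<open>g\<close> or \<open>h\<close>. It cannot
  divide \<open>g\<close>, which up to a factor from C[x] divides the derivative and so has smaller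
  degree; and if it divides \<open>h\<close>, no degree is left for \<open>g\<close>.\<close>

lemma prime_bezout_pderiv:
  fixes p :: bipoly
  assumes "prime p" "degree p > 0"
  obtains a b c where "c \<noteq> 0" "a * p + b * pderiv p = [:c:]"
proof -
  have p0: "p \<noteq> 0" using assms by auto
  have p'0: "pderiv p \<noteq> 0" using assms(2) by (simp add: pderiv_eq_0_iff)
  obtain g a b c h c' k where g: "g \<noteq> 0" "g = a * p + b * pderiv p" "c \<noteq> 0" "smult c p = g * h"
    "c' \<noteq> 0" "smult c' (pderiv p) = g * k"
    using bezout_gcd[OF p0, of "pderiv p"] by metis
  have h0: "h \<noteq> 0" and k0: "k \<noteq> 0" using g p0 p'0 by auto
  have "p dvd g * h" using g(4) by (metis dvd_refl dvd_smult)
  then consider "p dvd g" | "p dvd h" using assms(1) by (meson prime_dvd_multD)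
  then have "degree g = 0"
  proof cases
    case 1
    have "degree g + degree k = degree (pderiv p)"
      using g(1,5,6) k0 by (metis degree_mult_eq degree_smult_eq)
    moreover have "degree p \<le> degree g" using 1 g(1) dvd_imp_degree_le by blast
    ultimately show ?thesis using assms(2) by (simp add: degree_pderiv)
  next
    case 2
    have "degree g + degree h = degree p"
      using g(1,3,4) h0 by (metis degree_mult_eq degree_smult_eq)
    moreover have "degree p \<le> degree h" using 2 h0 dvd_imp_degree_le by blast
    ultimately show ?thesis by simp
  qed
  then obtain d where "g = [:d:]" by (metis degree_eq_zeroE)
  with g have "d \<noteq> 0" "a * p + b * pderiv p = [:d:]" by auto
  then show ?thesis by (rule that)
qed

text \<open>\<open>S\<close> is any finite set containing the zeros of the leading coefficient and
  of the discriminant, so it may be enlarged at will and no discriminant has to be computed. Off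
  \<open>S\<close> every fibre has exactly \<open>degree p\<close> points.\<close>

definition unramified_off :: "bipoly \<Rightarrow> complex set \<Rightarrow> bool" where
  "unramified_off p S \<longleftrightarrow> finite S \<and> degree p > 0 \<and> (\<forall>x. x \<notin> S \<longrightarrow> poly (lead_coeff p) x \<noteq> 0 \<and>
     (\<forall>y. eval2 p x y = 0 \<longrightarrow> eval2 (pderiv p) x y \<noteq> 0))"

text \<open>The polynomial \<open>c\<close> stands in for the discriminant: off its zeros,
  \<open>p\<close> and its y-derivative have no common root.\<close>

lemma unramified_off_bezout:
  assumes "c \<noteq> 0" "a * p + b * pderiv p = [:c:]" "degree p > 0"
  shows "\<exists>S. unramified_off p S"
proof -
  define S where "S = {x. poly (lead_coeff p * c) x = 0}"
  have "finite S" unfolding S_def using assms by (intro poly_roots_finite) auto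
  moreover have "eval2 (pderiv p) x y \<noteq> 0" if "x \<notin> S" "eval2 p x y = 0" for x y
  proof
    assume "eval2 (pderiv p) x y = 0"
    then have "eval2 (a * p + b * pderiv p) x y = 0" using that by (simp add: eval2_add eval2_mult)
    then show False using that by (simp add: assms(2) eval2_const S_def)
  qed
  ultimately have "unramified_off p S" using assms(3) by (auto simp: unramified_off_def S_def)
  then show ?thesis ..
qed

lemma unramified_off_insert: "unramified_off p S \<Longrightarrow> finite T \<Longrightarrow> unramified_off p (S \<union> T)"
  by (auto simp: unramified_off_def)

text \<open>If all roots over \<open>x\<close> kept distance \<open>\<epsilon>\<close> from
  \<open>y1\<close>, the factorisation into linear factors would keep \<open>eval2 p x y1\<close>
  away from 0; but it tends to \<open>eval2 p x1 y1 = 0\<close>.\<close>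

lemma root_near:
  assumes "poly (lead_coeff p) x1 \<noteq> 0" "eval2 p x1 y1 = 0" "\<epsilon> > 0"
  shows "\<forall>\<^sub>F x in nhds x1. \<exists>y. eval2 p x y = 0 \<and> dist y y1 < \<epsilon>"
proof -
  let ?a = "\<lambda>x. poly (lead_coeff p) x"
  have lim: "((\<lambda>x. norm (?a x) * \<epsilon> ^ degree p - norm (eval2 p x y1)) \<longlongrightarrow>
      norm (?a x1) * \<epsilon> ^ degree p - norm (eval2 p x1 y1)) (nhds x1)"
    by (intro tendsto_intros eval2_tendsto filterlim_ident)
  then have "\<forall>\<^sub>F x in nhds x1. norm (?a x) * \<epsilon> ^ degree p - norm (eval2 p x y1) > 0"
    using assms by (intro order_tendstoD(1)[OF lim]) auto
  moreover have "((\<lambda>x. norm (?a x)) \<longlongrightarrow> norm (?a x1)) (nhds x1)"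
    by (intro tendsto_intros filterlim_ident)
  then have "\<forall>\<^sub>F x in nhds x1. norm (?a x) > 0"
    by (rule order_tendstoD(1)) (use assms in auto)
  ultimately show ?thesis
  proof eventually_elim
    case (elim x)
    let ?q = "slice p x"
    have deg: "degree ?q = degree p" using elim by (intro degree_slice) auto
    have "eval2 p x y1 = poly (smult (lead_coeff ?q) (\<Prod>x\<in>#proots ?q. [:-x, 1:])) y1"
      by (simp add: complex_poly_decompose_multiset poly_slice)
    also have "\<dots> = ?a x * (\<Prod>r\<in>#proots ?q. y1 - r)"
      by (simp add: deg coeff_slice poly_prod_mset image_mset.compositionality o_def)
    finally have eq: "norm (eval2 p x y1) = norm (?a x) * norm (\<Prod>r\<in>#proots ?q. y1 - r)"
      by (simp add: norm_mult)
    show ?case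
    proof (rule ccontr)
      assume "\<not> ?case"
      then have ge: "norm (y1 - r) \<ge> \<epsilon>" if "r \<in># proots ?q" for r
        using that elim deg by (cases "?q = 0") (auto simp: poly_slice dist_norm norm_minus_commute not_less)
      have "norm (\<Prod>r\<in>#M. y1 - r) \<ge> \<epsilon> ^ size M" if "M \<subseteq># proots ?q" for M
        using that
      proof (induction M)
        case (add r M)
        then have "\<epsilon> ^ size M \<le> norm (\<Prod>r\<in>#M. y1 - r)" "norm (y1 - r) \<ge> \<epsilon>"
          using ge[of r] mset_subset_eq_insertD[OF add.prems] by (auto dest: subset_mset.less_imp_le)
        then show ?case using assms(3) by (simp add: norm_mult mult_mono)
      qed auto
      from this[of "proots ?q"] have "norm (\<Prod>r\<in>#proots ?q. y1 - r) \<ge> \<epsilon> ^ degree p"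
        by (simp add: size_proots_complex deg)
      then have "norm (eval2 p x y1) \<ge> norm (?a x) * \<epsilon> ^ degree p"
        unfolding eq by (intro mult_left_mono) auto
      then show False using elim by simp
    qed
  qed
qed

lemma finite_separated:
  fixes R :: "'a::metric_space set"
  assumes "finite R"
  obtains \<epsilon> where "\<epsilon> > 0" "\<And>y y'. y \<in> R \<Longrightarrow> y' \<in> R \<Longrightarrow> y \<noteq> y' \<Longrightarrow> dist y y' \<ge> 2 * \<epsilon>"
proof -
  define D where "D = insert 1 ((\<lambda>(y, y'). dist y y') ` {z \<in> R \<times> R. fst z \<noteq> snd z})"
  have D: "finite D" "D \<noteq> {}" "\<And>d. d \<in> D \<Longrightarrow> d > 0"
    using assms unfolding D_def by (auto intro!: finite_imageI finite_subset[of _ "R \<times> R"])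
  have "Min D > 0" using D by simp
  moreover have "dist y y' \<ge> Min D" if "y \<in> R" "y' \<in> R" "y \<noteq> y'" for y y'
    using that D by (intro Min_le) (auto simp: D_def image_iff)
  ultimately show ?thesis using that[of "Min D / 2"] by auto
qed

lemma card_roots_unramified:
  assumes "unramified_off p S" "x \<notin> S"
  shows "finite {y. eval2 p x y = 0}" "card {y. eval2 p x y = 0} = degree p"
proof -
  have deg: "degree (slice p x) = degree p"
    using assms by (intro degree_slice) (auto simp: unramified_off_def)
  moreover have "degree p > 0" using assms by (auto simp: unramified_off_def)
  ultimately have n0: "slice p x \<noteq> 0" by auto
  then show "finite {y. eval2 p x y = 0}"
    using poly_roots_finite by (fastforce simp: poly_slice)
  have rs: "rsquarefree (slice p x)"
    using assms by (auto simp: rsquarefree_roots unramified_off_def poly_slice pderiv_slice[symmetric])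
  have "degree (slice p x) = (\<Sum>y | poly (slice p x) y = 0. order y (slice p x))"
    using n0 size_proots_complex[of "slice p x"] by (simp add: size_multiset_overloaded_eq)
  also have "\<dots> = card {y. poly (slice p x) y = 0}"
    using rs n0 by (simp add: rsquarefree_root_order)
  finally show "card {y. eval2 p x y = 0} = degree p" by (simp add: deg poly_slice)
qed

text \<open>Pigeonhole: over nearby \<open>x\<close> each of the \<open>degree p\<close> disjoint
  discs around the roots over \<open>x1\<close> contains a root by \<open>root_near\<close>, and
  there are only \<open>degree p\<close> roots in all.\<close>

lemma local_sheets:
  assumes un: "unramified_off p S" and x1: "x1 \<notin> S"
  defines "R \<equiv> {y. eval2 p x1 y = 0}"
  obtains \<epsilon> \<delta> where "\<epsilon> > 0" "\<delta> > 0" "ball x1 \<delta> \<subseteq> - S"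
    "\<And>y y'. y \<in> R \<Longrightarrow> y' \<in> R \<Longrightarrow> y \<noteq> y' \<Longrightarrow> ball y \<epsilon> \<inter> ball y' \<epsilon> = {}"
    "\<And>x y1. x \<in> ball x1 \<delta> \<Longrightarrow> y1 \<in> R \<Longrightarrow> \<exists>!y. eval2 p x y = 0 \<and> y \<in> ball y1 \<epsilon>"
    "\<And>x y. x \<in> ball x1 \<delta> \<Longrightarrow> eval2 p x y = 0 \<Longrightarrow> \<exists>y1\<in>R. y \<in> ball y1 \<epsilon>"
proof -
  have R: "finite R" "card R = degree p"
    using card_roots_unramified[OF un x1] by (auto simp: R_def)
  obtain \<epsilon> where \<epsilon>: "\<epsilon> > 0" "\<And>y y'. y \<in> R \<Longrightarrow> y' \<in> R \<Longrightarrow> y \<noteq> y' \<Longrightarrow> dist y y' \<ge> 2 * \<epsilon>"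
    using finite_separated[OF R(1)] by blast
  have disj: "ball y \<epsilon> \<inter> ball y' \<epsilon> = {}" if "y \<in> R" "y' \<in> R" "y \<noteq> y'" for y y'
  proof -
    have "False" if "dist y z < \<epsilon>" "dist y' z < \<epsilon>" for z
      using \<epsilon>(2)[OF \<open>y \<in> R\<close> \<open>y' \<in> R\<close> \<open>y \<noteq> y'\<close>] that dist_triangle2[of y y' z] by linarith
    then show ?thesis by auto
  qed
  have lc: "poly (lead_coeff p) x1 \<noteq> 0" using un x1 by (auto simp: unramified_off_def)
  have "finite S" using un by (auto simp: unramified_off_def)
  then have "\<forall>\<^sub>F x in nhds x1. x \<in> - S"
    using x1 by (intro eventually_nhds_in_open) (auto intro: finite_imp_closed)
  moreover have "\<forall>\<^sub>F x in nhds x1. \<forall>y1\<in>R. \<exists>y. eval2 p x y = 0 \<and> dist y y1 < \<epsilon>"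
    using R(1) root_near[OF lc _ \<epsilon>(1)] by (intro eventually_ball_finite) (auto simp: R_def)
  ultimately have "\<forall>\<^sub>F x in nhds x1. x \<in> - S \<and> (\<forall>y1\<in>R. \<exists>y. eval2 p x y = 0 \<and> dist y y1 < \<epsilon>)"
    by eventually_elim auto
  then obtain \<delta> where \<delta>: "\<delta> > 0" "\<And>x. x \<in> ball x1 \<delta> \<Longrightarrow> x \<notin> S"
      "\<And>x y1. x \<in> ball x1 \<delta> \<Longrightarrow> y1 \<in> R \<Longrightarrow> \<exists>y. eval2 p x y = 0 \<and> dist y y1 < \<epsilon>"
    by (auto simp: eventually_nhds_metric dist_commute)
  have main: "(\<forall>y1\<in>R. \<exists>!y. eval2 p x y = 0 \<and> y \<in> ball y1 \<epsilon>) \<and>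
      (\<forall>y. eval2 p x y = 0 \<longrightarrow> (\<exists>y1\<in>R. y \<in> ball y1 \<epsilon>))" if x: "x \<in> ball x1 \<delta>" for x
  proof -
    have "\<forall>y1\<in>R. \<exists>y. eval2 p x y = 0 \<and> y \<in> ball y1 \<epsilon>"
      using \<delta>(3)[OF x] by (auto simp: dist_commute)
    then obtain h where h: "\<And>y1. y1 \<in> R \<Longrightarrow> eval2 p x (h y1) = 0 \<and> h y1 \<in> ball y1 \<epsilon>" by metis
    let ?R = "{y. eval2 p x y = 0}"
    have inj: "inj_on h R"
      using h disj by (fastforce intro!: inj_onI)
    have "h ` R = ?R"
    proof (rule card_subset_eq)
      show "finite ?R" "card (h ` R) = card ?R"
        using card_roots_unramified[OF un \<delta>(2)[OF x]] R(2) inj by (auto simp: card_image)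
    qed (use h in auto)
    then have all: "\<And>y. eval2 p x y = 0 \<Longrightarrow> \<exists>y1\<in>R. y = h y1" by auto
    have "y = h y1" if "y1 \<in> R" "eval2 p x y = 0" "y \<in> ball y1 \<epsilon>" for y y1
    proof -
      obtain y2 where y2: "y2 \<in> R" "y = h y2" using all[OF \<open>eval2 p x y = 0\<close>] by blast
      then have "y \<in> ball y2 \<epsilon>" using h by auto
      then have "y1 = y2"
        using that(3) disj[OF \<open>y1 \<in> R\<close> \<open>y2 \<in> R\<close>] by (metis IntI empty_iff)
      then show ?thesis using y2 by simp
    qed
    then show ?thesis using h all by metis
  qed
  show ?thesis
    by (rule that[OF \<epsilon>(1) \<delta>(1)]) (use \<delta>(2) disj main in auto)
qed

section \<open>The curve as a covering of the plane without the branch points\<close>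

definition curve_off :: "bipoly \<Rightarrow> complex set \<Rightarrow> (complex \<times> complex) set" where
  "curve_off p S = {(x, y). x \<notin> S \<and> eval2 p x y = 0}"

text \<open>Gives access to the lifting theorems for covering spaces, which supply the branches over
  any simply connected domain.\<close>

lemma covering_space_curve:
  assumes un: "unramified_off p S"
  shows "covering_space (curve_off p S) fst (- S)"
  unfolding covering_space_def
proof (intro conjI ballI)
  show "continuous_on (curve_off p S) fst" by (intro continuous_intros)
  have "\<exists>y. eval2 p x y = 0" if "x \<notin> S" for x
    using card_roots_unramified[OF un that] un by (auto simp: unramified_off_def intro: ccontr)
  then show "fst ` curve_off p S = - S"
    by (force simp: curve_off_def image_iff)
next
  fix x1 assume "x1 \<in> - S"
  define R where "R = {y. eval2 p x1 y = 0}"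
  obtain \<epsilon> \<delta> where \<epsilon>: "\<epsilon> > 0" and \<delta>: "\<delta> > 0" "ball x1 \<delta> \<subseteq> - S"
    and disj: "\<And>y y'. y \<in> R \<Longrightarrow> y' \<in> R \<Longrightarrow> y \<noteq> y' \<Longrightarrow> ball y \<epsilon> \<inter> ball y' \<epsilon> = {}"
    and ex1: "\<And>x y1. x \<in> ball x1 \<delta> \<Longrightarrow> y1 \<in> R \<Longrightarrow> \<exists>!y. eval2 p x y = 0 \<and> y \<in> ball y1 \<epsilon>"
    and all: "\<And>x y. x \<in> ball x1 \<delta> \<Longrightarrow> eval2 p x y = 0 \<Longrightarrow> \<exists>y1\<in>R. y \<in> ball y1 \<epsilon>"
    using local_sheets[OF un, of x1] \<open>x1 \<in> - S\<close> unfolding R_def by blast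
  let ?T = "ball x1 \<delta>" and ?c = "curve_off p S"
  define v where "v = (\<lambda>y1. ?c \<inter> (?T \<times> ball y1 \<epsilon>)) ` R"
  show "\<exists>T. x1 \<in> T \<and> openin (top_of_set (- S)) T \<and>
      (\<exists>v. \<Union> v = ?c \<inter> fst -` T \<and> (\<forall>u\<in>v. openin (top_of_set ?c) u) \<and>
        pairwise disjnt v \<and> (\<forall>u\<in>v. \<exists>q. homeomorphism u T fst q))"
  proof (intro exI[of _ ?T] exI[of _ v] conjI ballI)
    show "x1 \<in> ?T" using \<delta> by simp
    show "openin (top_of_set (- S)) ?T" using \<delta> by (simp add: open_subset)
    show "\<Union> v = ?c \<inter> fst -` ?T"
      using all by (fastforce simp: v_def curve_off_def)
    show "openin (top_of_set ?c) u" if "u \<in> v" for u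
      using that by (auto simp: v_def intro!: openin_open_Int open_Times)
    show "pairwise disjnt v"
      using disj by (fastforce simp: v_def pairwise_def disjnt_def)
    fix u assume "u \<in> v"
    then obtain y1 where y1: "y1 \<in> R" "u = ?c \<inter> (?T \<times> ball y1 \<epsilon>)" by (auto simp: v_def)
    define Y where "Y x = (THE y. eval2 p x y = 0 \<and> y \<in> ball y1 \<epsilon>)" for x
    have Y: "eval2 p x (Y x) = 0 \<and> Y x \<in> ball y1 \<epsilon>" if "x \<in> ?T" for x
      unfolding Y_def by (rule theI'[OF ex1[OF that y1(1)]])
    have Y_eq: "y = Y x" if "x \<in> ?T" "eval2 p x y = 0" "y \<in> ball y1 \<epsilon>" for x y
      using ex1[OF that(1) y1(1)] Y[OF that(1)] that by blast
    have "continuous_on ?T Y"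
    proof (subst continuous_on_eq_continuous_at[OF open_ball], intro ballI)
      fix x2 assume x2: "x2 \<in> ?T"
      have lc: "poly (lead_coeff p) x2 \<noteq> 0" using un x2 \<delta> by (auto simp: unramified_off_def)
      have "(Y \<longlongrightarrow> Y x2) (nhds x2)"
      proof (rule tendstoI)
        fix \<eta> :: real assume "\<eta> > 0"
        \<comment> \<open>The second bound keeps the root near \<open>Y x2\<close> inside the disc
          around \<open>y1\<close>, where it can only be \<open>Y x\<close>.\<close>
        define e where "e = min \<eta> (\<epsilon> - dist y1 (Y x2))"
        have "e > 0" using \<open>\<eta> > 0\<close> Y[OF x2] by (auto simp: e_def)
        then have "\<forall>\<^sub>F x in nhds x2. \<exists>y. eval2 p x y = 0 \<and> dist y (Y x2) < e"
          using root_near[OF lc] Y[OF x2] by blast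
        moreover have "\<forall>\<^sub>F x in nhds x2. x \<in> ?T" using x2 by (intro eventually_nhds_in_open) auto
        ultimately show "\<forall>\<^sub>F x in nhds x2. dist (Y x) (Y x2) < \<eta>"
        proof eventually_elim
          case (elim x)
          then obtain y where y: "eval2 p x y = 0" "dist y (Y x2) < e" by blast
          then have "dist y1 y < \<epsilon>"
            using dist_triangle[of y1 y "Y x2"] by (auto simp: e_def dist_commute)
          then have "y = Y x" using Y_eq elim y by auto
          then show ?case using y by (auto simp: e_def)
        qed
      qed
      then show "isCont Y x2"
        by (simp add: isCont_def tendsto_nhds_iff)
    qed
    moreover have "(x, Y x) \<in> u" if "x \<in> ?T" for x
      using Y[OF that] \<delta> that by (auto simp: y1(2) curve_off_def)
    moreover have "z = (fst z, Y (fst z))" "fst z \<in> ?T" if "z \<in> u" for z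
      using Y_eq that by (auto simp: y1(2) curve_off_def)
    ultimately have "homeomorphism u ?T fst (\<lambda>x. (x, Y x))"
      unfolding homeomorphism_def
      by (auto simp: image_iff intro!: continuous_intros) (metis fst_conv)+
    then show "\<exists>q. homeomorphism u ?T fst q"
      by (intro exI[of _ "\<lambda>x. (x, Y x)"])
  qed
qed

text \<open>The branches are parametrised over \<open>U\<close> through \<open>\<xi>\<close>: the
  identity on discs, cones and the slit plane, and \<open>x0 + exp w\<close> on a half-plane, where
  it unwinds a punctured disc.\<close>

definition sheets :: "bipoly \<Rightarrow> (complex \<Rightarrow> complex) \<Rightarrow> complex set \<Rightarrow> (nat \<Rightarrow> complex \<Rightarrow> complex) \<Rightarrow> bool" where
  "sheets p \<xi> U Y \<longleftrightarrow> (\<forall>i<degree p. Y i holomorphic_on U) \<and>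
     (\<forall>w\<in>U. bij_betw (\<lambda>i. Y i w) {..<degree p} {y. eval2 p (\<xi> w) y = 0})"

lemma sheet_unique:
  assumes "unramified_off p S" "connected U" "continuous_on U \<xi>" "\<xi> \<in> U \<rightarrow> - S"
    "continuous_on U Y" "\<And>w. w \<in> U \<Longrightarrow> eval2 p (\<xi> w) (Y w) = 0"
    "continuous_on U Z" "\<And>w. w \<in> U \<Longrightarrow> eval2 p (\<xi> w) (Z w) = 0"
    "w0 \<in> U" "Y w0 = Z w0" "w \<in> U"
  shows "Y w = Z w"
proof -
  have "(\<xi> w, Y w) = (\<xi> w, Z w)"
    by (rule covering_space_lift_unique[OF covering_space_curve[OF assms(1)], of _ w0 _ U \<xi>])
      (use assms in \<open>auto simp: curve_off_def intro!: continuous_intros\<close>)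
  then show ?thesis by simp
qed

text \<open>Dividing by \<open>y - y0\<close> gives \<open>p = (y - y0) * r + p(x, y0)\<close>,
  where \<open>r\<close> at the given point equals the y-derivative of \<open>p\<close> and is
  nonzero. The difference quotient of \<open>Y\<close> is therefore that of
  \<open>- p(x, y0)\<close> divided by a convergent factor.\<close>

lemma sheet_holomorphic:
  assumes un: "unramified_off p S" and U: "open U" and \<xi>: "\<xi> holomorphic_on U" "\<xi> \<in> U \<rightarrow> - S"
    and Y: "continuous_on U Y" "\<And>w. w \<in> U \<Longrightarrow> eval2 p (\<xi> w) (Y w) = 0"
  shows "Y holomorphic_on U"
  unfolding holomorphic_on_open[OF U]
proof
  fix w0 assume w0: "w0 \<in> U"
  define y0 where "y0 = Y w0"
  define r where "r = synthetic_div p [:y0:]"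
  have p_eq: "p = [:-[:y0:], 1:] * r + [:poly p [:y0:]:]"
    unfolding r_def by (rule synthetic_div_correct'[symmetric])
  have eq: "eval2 p x y = (y - y0) * eval2 r x y + eval2 p x y0" for x y
    by (subst p_eq) (simp add: eval2_def algebra_simps)
  have "pderiv p = [:-[:y0:], 1:] * pderiv r + r"
    by (subst p_eq) (simp add: pderiv_add pderiv_mult pderiv_pCons pderiv_smult)
  then have "eval2 (pderiv p) (\<xi> w0) y0 = eval2 r (\<xi> w0) y0"
    by (simp add: eval2_def)
  moreover have "eval2 (pderiv p) (\<xi> w0) y0 \<noteq> 0"
    using un \<xi>(2) Y(2)[OF w0] w0 by (auto simp: unramified_off_def y0_def Pi_iff)
  ultimately have r0: "eval2 r (\<xi> w0) y0 \<noteq> 0" by simp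
  have contY: "(Y \<longlongrightarrow> y0) (at w0)"
    using Y(1) U w0 by (simp add: continuous_on_eq_continuous_at isCont_def y0_def)
  have cont\<xi>: "(\<xi> \<longlongrightarrow> \<xi> w0) (at w0)"
    using \<xi>(1) U w0 by (metis continuous_on_eq_continuous_at holomorphic_on_imp_continuous_on isCont_def)
  have lim_r: "((\<lambda>w. eval2 r (\<xi> w) (Y w)) \<longlongrightarrow> eval2 r (\<xi> w0) y0) (at w0)"
    by (intro eval2_tendsto contY cont\<xi>)
  have "(\<lambda>w. eval2 p (\<xi> w) y0) holomorphic_on U"
    by (intro eval2_holomorphic \<xi>(1)) auto
  then obtain D where D: "((\<lambda>w. eval2 p (\<xi> w) y0) has_field_derivative D) (at w0)"
    using U w0 by (auto simp: holomorphic_on_open)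
  have "((\<lambda>w. - ((eval2 p (\<xi> w) y0 - eval2 p (\<xi> w0) y0) / (w - w0)) / eval2 r (\<xi> w) (Y w)) \<longlongrightarrow>
      - D / eval2 r (\<xi> w0) y0) (at w0)"
    using D by (intro tendsto_intros lim_r r0) (simp add: has_field_derivative_iff)
  moreover have "\<forall>\<^sub>F w in at w0. - ((eval2 p (\<xi> w) y0 - eval2 p (\<xi> w0) y0) / (w - w0)) / eval2 r (\<xi> w) (Y w)
       = (Y w - Y w0) / (w - w0)"
  proof -
    have "\<forall>\<^sub>F w in at w0. eval2 r (\<xi> w) (Y w) \<noteq> 0"
      using lim_r r0 tendsto_imp_eventually_ne by blast
    moreover have "\<forall>\<^sub>F w in at w0. w \<in> U" using U w0 by (simp add: eventually_at_in_open')
    ultimately show ?thesis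
    proof eventually_elim
      case (elim w)
      have "(Y w - y0) * eval2 r (\<xi> w) (Y w) = - eval2 p (\<xi> w) y0"
        using eq[of "\<xi> w" "Y w"] Y(2)[OF elim(2)] by (simp add: add_eq_0_iff)
      then have "Y w - y0 = - eval2 p (\<xi> w) y0 / eval2 r (\<xi> w) (Y w)"
        using elim(1) by (simp add: field_simps)
      then show ?case using Y(2)[OF w0] by (simp add: y0_def)
    qed
  qed
  ultimately have "(Y has_field_derivative (- D / eval2 r (\<xi> w0) y0)) (at w0)"
    unfolding has_field_derivative_iff by (rule Lim_transform_eventually)
  then show "\<exists>f'. (Y has_field_derivative f') (at w0)" ..
qed

lemma sheets_exist:
  assumes un: "unramified_off p S" and U: "open U" "simply_connected U" "U \<noteq> {}"
    and \<xi>: "\<xi> holomorphic_on U" "\<xi> \<in> U \<rightarrow> - S"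
  obtains Y where "sheets p \<xi> U Y"
proof -
  obtain w0 where w0: "w0 \<in> U" using U by auto
  define R where "R = {y. eval2 p (\<xi> w0) y = 0}"
  have R: "finite R" "card R = degree p"
    unfolding R_def using card_roots_unramified[OF un] \<xi>(2) w0 by (auto simp: Pi_iff)
  have conn: "connected U" using U(2) simply_connected_imp_connected by blast
  have cont: "continuous_on U \<xi>" using \<xi>(1) holomorphic_on_imp_continuous_on by blast
  have "\<exists>Z. continuous_on U Z \<and> (\<forall>w\<in>U. eval2 p (\<xi> w) (Z w) = 0) \<and> Z w0 = y" if "y \<in> R" for y
  proof -
    have "(\<xi> w0, y) \<in> curve_off p S" using that w0 \<xi>(2) by (auto simp: curve_off_def R_def)
    from covering_space_lift_strong[OF covering_space_curve[OF un] this w0 U(2)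
        open_imp_locally_path_connected[OF U(1)] cont \<xi>(2)]
    obtain g where g: "continuous_on U g" "g \<in> U \<rightarrow> curve_off p S" "g w0 = (\<xi> w0, y)"
        "\<And>w. w \<in> U \<Longrightarrow> fst (g w) = \<xi> w" by auto
    have "eval2 p (\<xi> w) (snd (g w)) = 0" if "w \<in> U" for w
      using g(2) g(4)[OF that] that by (auto simp: curve_off_def Pi_iff)
    then show ?thesis using g by (intro exI[of _ "snd \<circ> g"]) (auto intro!: continuous_intros)
  qed
  then obtain Z where Z: "\<And>y. y \<in> R \<Longrightarrow> continuous_on U (Z y)"
      "\<And>y w. y \<in> R \<Longrightarrow> w \<in> U \<Longrightarrow> eval2 p (\<xi> w) (Z y w) = 0" "\<And>y. y \<in> R \<Longrightarrow> Z y w0 = y"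
    by metis
  obtain e where e: "bij_betw e {..<degree p} R"
    using ex_bij_betw_nat_finite[OF R(1)] R(2) by (auto simp: atLeast0LessThan)
  define Y where "Y i = Z (e i)" for i
  have eR: "e i \<in> R" if "i < degree p" for i using e that by (auto simp: bij_betw_def)
  have "bij_betw (\<lambda>i. Y i w) {..<degree p} {y. eval2 p (\<xi> w) y = 0}" if w: "w \<in> U" for w
    unfolding bij_betw_def
  proof
    show inj: "inj_on (\<lambda>i. Y i w) {..<degree p}"
    proof (rule inj_onI)
      fix i j assume ij: "i \<in> {..<degree p}" "j \<in> {..<degree p}" "Y i w = Y j w"
      have "Y i w0 = Y j w0"
        by (rule sheet_unique[OF un conn cont \<xi>(2), of "Y i" "Y j" w])
          (use ij w w0 Z eR in \<open>auto simp: Y_def\<close>)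
      then have "e i = e j" using ij Z(3) eR by (simp add: Y_def)
      then show "i = j" using e ij by (auto simp: bij_betw_def inj_on_def)
    qed
    have "\<xi> w \<notin> S" using \<xi>(2) w by auto
    note c = card_roots_unramified[OF un this]
    show "(\<lambda>i. Y i w) ` {..<degree p} = {y. eval2 p (\<xi> w) y = 0}"
      by (rule card_subset_eq[OF c(1)]) (use inj c(2) Z(2) eR w in \<open>auto simp: card_image Y_def\<close>)
  qed
  moreover have "Y i holomorphic_on U" if "i < degree p" for i
    unfolding Y_def by (rule sheet_holomorphic[OF un U(1) \<xi>]) (use Z eR that in auto)
  ultimately have "sheets p \<xi> U Y" by (simp add: sheets_def)
  then show ?thesis by (rule that)
qed

lemma sheets_root: "sheets p \<xi> U Y \<Longrightarrow> i < degree p \<Longrightarrow> w \<in> U \<Longrightarrow> eval2 p (\<xi> w) (Y i w) = 0"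
  by (auto simp: sheets_def bij_betw_def)

lemma sheets_continuous: "sheets p \<xi> U Y \<Longrightarrow> i < degree p \<Longrightarrow> continuous_on U (Y i)"
  by (auto simp: sheets_def holomorphic_on_imp_continuous_on)

lemma sheets_prod:
  assumes "unramified_off p S" "sheets p \<xi> U Y" "w \<in> U" "\<xi> w \<notin> S"
  shows "(\<Prod>y | eval2 p (\<xi> w) y = 0. h y) = (\<Prod>i<degree p. h (Y i w))"
  using assms by (intro prod.reindex_bij_betw[symmetric]) (auto simp: sheets_def)

lemma unramified_eval2_factor:
  assumes "unramified_off p S" "x \<notin> S"
  shows "eval2 p x y = poly (lead_coeff p) x * (\<Prod>z | eval2 p x z = 0. y - z)"
proof -
  have deg: "degree (slice p x) = degree p"
    using assms by (intro degree_slice) (auto simp: unramified_off_def)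
  have "rsquarefree (slice p x)"
    using assms by (auto simp: rsquarefree_roots unramified_off_def poly_slice pderiv_slice[symmetric])
  from complex_poly_decompose_rsquarefree[OF this]
  have "eval2 p x y = poly (smult (lead_coeff (slice p x)) (\<Prod>z | poly (slice p x) z = 0. [:-z, 1:])) y"
    by (simp add: poly_slice)
  then show ?thesis by (simp add: deg coeff_slice poly_prod poly_slice)
qed

lemma sheets_factor:
  assumes "unramified_off p S" "sheets p \<xi> U Y" "w \<in> U" "\<xi> w \<notin> S"
  shows "eval2 p (\<xi> w) y = poly (lead_coeff p) (\<xi> w) * (\<Prod>i<degree p. y - Y i w)"
  unfolding sheets_prod[OF assms, of "\<lambda>z. y - z", symmetric]
  by (rule unramified_eval2_factor[OF assms(1,4)])

text \<open>Compactness: bounded roots over a sequence tending to \<open>x0\<close> accumulate at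
  roots over \<open>x0\<close>. Roots larger than \<open>M\<close> are left aside, since they may
  run off to infinity.\<close>

lemma roots_cluster:
  assumes "\<epsilon> > 0"
  obtains \<delta> where "\<delta> > 0"
    "\<And>x y. dist x x0 < \<delta> \<Longrightarrow> eval2 p x y = 0 \<Longrightarrow> norm y \<le> M \<Longrightarrow> \<exists>l. eval2 p x0 l = 0 \<and> dist y l < \<epsilon>"
proof -
  define K where "K = cball 0 M - (\<Union>l\<in>{l. eval2 p x0 l = 0}. ball l \<epsilon>)"
  have "compact K" unfolding K_def by (intro compact_diff compact_cball) auto
  have "\<exists>\<delta>>0. \<forall>x y. dist x x0 < \<delta> \<longrightarrow> eval2 p x y = 0 \<longrightarrow> y \<notin> K"
  proof (rule ccontr)
    assume neg: "\<not> ?thesis"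
    have "\<exists>x y. dist x x0 < 1 / real (Suc k) \<and> eval2 p x y = 0 \<and> y \<in> K" for k
    proof -
      have "1 / real (Suc k) > 0" by simp
      then show ?thesis using neg by blast
    qed
    then obtain X Y where XY: "\<And>k. dist (X k) x0 < 1 / real (Suc k)" "\<And>k. eval2 p (X k) (Y k) = 0" "\<And>k. Y k \<in> K"
      by metis
    obtain l r where l: "l \<in> K" "strict_mono r" "(Y \<circ> r) \<longlonglongrightarrow> l"
      using \<open>compact K\<close> XY(3) unfolding compact_def by metis
    have "(\<lambda>k. dist (X k) x0) \<longlonglongrightarrow> 0"
      by (rule tendsto_sandwich[OF _ _ tendsto_const LIMSEQ_inverse_real_of_nat])
        (use XY(1) in \<open>auto simp: inverse_eq_divide intro!: always_eventually less_imp_le\<close>)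
    then have "X \<longlonglongrightarrow> x0" using tendsto_dist_iff by blast
    then have "(X \<circ> r) \<longlonglongrightarrow> x0" using l(2) LIMSEQ_subseq_LIMSEQ by blast
    from eval2_tendsto[OF this l(3), of p] have "eval2 p x0 l = 0"
      using XY(2) by (simp add: LIMSEQ_const_iff)
    then show False using l(1) assms by (auto simp: K_def)
  qed
  then obtain \<delta> where "\<delta> > 0" "\<And>x y. dist x x0 < \<delta> \<Longrightarrow> eval2 p x y = 0 \<Longrightarrow> y \<notin> K" by blast
  then have "\<exists>l. eval2 p x0 l = 0 \<and> dist y l < \<epsilon>" if "dist x x0 < \<delta>" "eval2 p x y = 0" "norm y \<le> M" for x y
    using that by (force simp: K_def dist_commute[of y])
  with \<open>\<delta> > 0\<close> show ?thesis by (rule that)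
qed

text \<open>Over a small connected set the values of \<open>Y\<close> form a connected set covered
  by disjoint discs around the roots over \<open>x0\<close> and a neighbourhood of infinity, so they
  stay in one of these. The family \<open>N\<close> serves for half-planes, slit discs and truncated
  cones alike.\<close>

lemma sheet_limit:
  fixes N :: "real \<Rightarrow> 'a::topological_space set" and p :: bipoly
  assumes p0: "slice p x0 \<noteq> 0" and d0: "\<delta>0 > 0"
    and N: "\<And>\<delta>. 0 < \<delta> \<Longrightarrow> \<delta> \<le> \<delta>0 \<Longrightarrow> connected (N \<delta>)" "\<And>\<delta>. 0 < \<delta> \<Longrightarrow> \<delta> \<le> \<delta>0 \<Longrightarrow> N \<delta> \<subseteq> N \<delta>0"
      "\<And>\<delta>. 0 < \<delta> \<Longrightarrow> \<delta> \<le> \<delta>0 \<Longrightarrow> \<forall>\<^sub>F w in F. w \<in> N \<delta>"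
      "\<And>\<delta> w. 0 < \<delta> \<Longrightarrow> \<delta> \<le> \<delta>0 \<Longrightarrow> w \<in> N \<delta> \<Longrightarrow> dist (\<xi> w) x0 < \<delta>"
    and Y: "continuous_on (N \<delta>0) Y" "\<And>w. w \<in> N \<delta>0 \<Longrightarrow> eval2 p (\<xi> w) (Y w) = 0"
  shows "(\<exists>l. eval2 p x0 l = 0 \<and> (Y \<longlongrightarrow> l) F) \<or> filterlim Y at_infinity F"
proof -
  define R where "R = {l. eval2 p x0 l = 0}"
  have R: "finite R" using poly_roots_finite[OF p0] by (simp add: R_def poly_slice)
  obtain \<epsilon> where \<epsilon>: "\<epsilon> > 0" "\<And>y y'. y \<in> R \<Longrightarrow> y' \<in> R \<Longrightarrow> y \<noteq> y' \<Longrightarrow> dist y y' \<ge> 2 * \<epsilon>"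
    using finite_separated[OF R] by blast
  have disj: False if "y \<in> R" "y' \<in> R" "y \<noteq> y'" "dist z y < \<epsilon>" "dist z y' < \<epsilon>" for y y' z
    using \<epsilon>(2)[OF that(1-3)] that(4,5) dist_triangle3[of y y' z] by linarith
  \<comment> \<open>Larger than the norm of every point of the discs, so that the region
    \<open>norm y > M0\<close> is disjoint from them.\<close>
  define M0 where "M0 = (\<Sum>l\<in>R. norm l) + \<epsilon>"
  have M0: "norm z < M0" if "l \<in> R" "dist z l < \<epsilon>" for l z
  proof -
    have "norm l \<le> (\<Sum>l\<in>R. norm l)" using R that by (intro member_le_sum) auto
    then show ?thesis using that(2) norm_triangle_sub[of z l] by (simp add: M0_def dist_norm)
  qed
  have cluster: "\<exists>\<delta>>0. \<delta> \<le> d \<and> (\<forall>w\<in>N \<delta>. norm (Y w) \<le> M \<longrightarrow> (\<exists>l\<in>R. dist (Y w) l < e))"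
    if "e > 0" "0 < d" "d \<le> \<delta>0" for M e d
  proof -
    obtain \<delta> where \<delta>: "\<delta> > 0"
      "\<And>x y. dist x x0 < \<delta> \<Longrightarrow> eval2 p x y = 0 \<Longrightarrow> norm y \<le> M \<Longrightarrow> \<exists>l. eval2 p x0 l = 0 \<and> dist y l < e"
      using roots_cluster[OF \<open>e > 0\<close>, of x0 p M] by blast
    let ?d = "min \<delta> d"
    have "0 < ?d" "?d \<le> \<delta>0" using \<delta>(1) that by auto
    show ?thesis
    proof (intro exI[of _ ?d] conjI ballI impI)
      fix w assume w: "w \<in> N ?d" "norm (Y w) \<le> M"
      have "w \<in> N \<delta>0" using N(2)[OF \<open>0 < ?d\<close> \<open>?d \<le> \<delta>0\<close>] w by blast
      moreover have "dist (\<xi> w) x0 < \<delta>"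
        using N(4)[OF \<open>0 < ?d\<close> \<open>?d \<le> \<delta>0\<close> w(1)] by simp
      ultimately show "\<exists>l\<in>R. dist (Y w) l < e"
        using \<delta>(2)[OF _ Y(2) w(2)] by (auto simp: R_def)
    qed (use \<open>0 < ?d\<close> in auto)
  qed
  obtain \<delta>1 where d1: "\<delta>1 > 0" "\<delta>1 \<le> \<delta>0"
    and c1: "\<And>w. w \<in> N \<delta>1 \<Longrightarrow> norm (Y w) \<le> M0 \<Longrightarrow> \<exists>l\<in>R. dist (Y w) l < \<epsilon>"
    using cluster[OF \<epsilon>(1) d0 order_refl] by blast
  have N1: "N \<delta>1 \<subseteq> N \<delta>0" "connected (N \<delta>1)" using N(1,2) d1 by auto
  show ?thesis
  proof (cases "\<exists>w0\<in>N \<delta>1. norm (Y w0) \<le> M0")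
    case True
    then obtain w0 l where w0: "w0 \<in> N \<delta>1" "l \<in> R" "dist (Y w0) l < \<epsilon>" using c1 by blast
    \<comment> \<open>The other discs and the region around infinity. Together with the disc of
      \<open>l\<close> these are two disjoint open sets covering a connected set of values, so one
      of the two is missed.\<close>
    define B where "B = (\<Union>l'\<in>R - {l}. ball l' \<epsilon>) \<union> {y. norm y > M0}"
    have "open B" unfolding B_def by (intro open_Un open_UN) (auto intro!: open_Collect_less continuous_intros)
    have conn: "connected (Y ` N \<delta>1)"
      using N1 Y(1) by (meson connected_continuous_image continuous_on_subset)
    have "ball l \<epsilon> \<inter> B \<inter> Y ` N \<delta>1 = {}"
    proof -
      have "z \<notin> B" if "dist z l < \<epsilon>" for z
        using disj[OF w0(2), of _ z] M0[OF w0(2) that] that by (auto simp: B_def dist_commute)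
      then show ?thesis by (auto simp: dist_commute)
    qed
    moreover have "Y ` N \<delta>1 \<subseteq> ball l \<epsilon> \<union> B"
    proof
      fix z assume "z \<in> Y ` N \<delta>1"
      then obtain w where w: "w \<in> N \<delta>1" "z = Y w" by blast
      show "z \<in> ball l \<epsilon> \<union> B"
      proof (cases "norm z \<le> M0")
        case True
        then obtain l' where "l' \<in> R" "dist z l' < \<epsilon>" using c1[OF w(1)] w(2) by auto
        then show ?thesis by (cases "l' = l") (auto simp: B_def dist_commute)
      qed (auto simp: B_def)
    qed
    ultimately have "ball l \<epsilon> \<inter> Y ` N \<delta>1 = {} \<or> B \<inter> Y ` N \<delta>1 = {}"
      using conn \<open>open B\<close> by (meson connectedD open_ball)
    moreover have "Y w0 \<in> ball l \<epsilon> \<inter> Y ` N \<delta>1" using w0 by (auto simp: dist_commute)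
    ultimately have BY: "B \<inter> Y ` N \<delta>1 = {}" by blast
    have "(Y \<longlongrightarrow> l) F"
    proof (rule tendstoI)
      fix e :: real assume "e > 0"
      then have "min e \<epsilon> > 0" using \<epsilon> by simp
      from cluster[OF this d1, of M0] obtain \<delta> where \<delta>: "\<delta> > 0" "\<delta> \<le> \<delta>1"
        and c: "\<And>w. w \<in> N \<delta> \<Longrightarrow> norm (Y w) \<le> M0 \<Longrightarrow> \<exists>l\<in>R. dist (Y w) l < min e \<epsilon>" by blast
      have "\<delta> \<le> \<delta>0" using \<delta> d1 by linarith
      then have "\<forall>\<^sub>F w in F. w \<in> N \<delta>" "\<forall>\<^sub>F w in F. w \<in> N \<delta>1" using N(3) \<delta> d1 by auto
      then show "\<forall>\<^sub>F w in F. dist (Y w) l < e"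
      proof eventually_elim
        case (elim w)
        then have "Y w \<notin> B" using BY by auto
        then have "norm (Y w) \<le> M0" "\<And>l'. l' \<in> R \<Longrightarrow> dist (Y w) l' < \<epsilon> \<Longrightarrow> l' = l"
          by (auto simp: B_def dist_commute)
        then show ?case using c[OF elim(1)] by auto
      qed
    qed
    then show ?thesis using w0(2) by (auto simp: R_def)
  next
    case False
    have "filterlim Y at_infinity F"
      unfolding filterlim_at_infinity[OF order_refl]
    proof (intro allI impI)
      fix r :: real assume "r > 0"
      from cluster[OF \<epsilon>(1) d1, of r] obtain \<delta> where \<delta>: "\<delta> > 0" "\<delta> \<le> \<delta>1"
        and c: "\<And>w. w \<in> N \<delta> \<Longrightarrow> norm (Y w) \<le> r \<Longrightarrow> \<exists>l\<in>R. dist (Y w) l < \<epsilon>" by blast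
      have "\<delta> \<le> \<delta>0" using \<delta> d1 by linarith
      then have "\<forall>\<^sub>F w in F. w \<in> N \<delta>" "\<forall>\<^sub>F w in F. w \<in> N \<delta>1" using N(3) \<delta> d1 by auto
      then show "\<forall>\<^sub>F w in F. r \<le> norm (Y w)"
      proof eventually_elim
        case (elim w)
        then have "norm (Y w) > M0" using False by (meson not_le)
        then have "\<not> (\<exists>l\<in>R. dist (Y w) l < \<epsilon>)" using M0 by (meson less_asym)
        then show ?case using c[OF elim(1)] by linarith
      qed
    qed
    then show ?thesis ..
  qed
qed

text \<open>For an escaping root write \<open>y - Y = - Y * (1 - y / Y)\<close>, where the second
  factor tends to 1. The first factors together with \<open>a\<close> must then converge, and the
  sheets in \<open>J\<close> supply all roots of the limit polynomial with multiplicity.\<close>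

lemma slice_limit_factor:
  fixes p :: bipoly
  assumes F: "F \<noteq> bot" and \<xi>: "(\<xi> \<longlongrightarrow> x0) F" and p0: "slice p x0 \<noteq> 0"
    and fac: "\<And>y. \<forall>\<^sub>F w in F. eval2 p (\<xi> w) y = a w * (\<Prod>i\<in>I. y - Y i w)"
    and fin: "finite I" "J \<subseteq> I"
    and limJ: "\<And>i. i \<in> J \<Longrightarrow> (Y i \<longlongrightarrow> l i) F"
    and inf: "\<And>i. i \<in> I - J \<Longrightarrow> filterlim (Y i) at_infinity F"
  obtains c where "c \<noteq> 0" "((\<lambda>w. a w * (\<Prod>i\<in>I - J. - Y i w)) \<longlongrightarrow> c) F"
    "\<And>y. eval2 p x0 y = c * (\<Prod>i\<in>J. y - l i)"
proof -
  define G where "G w = a w * (\<Prod>i\<in>I - J. - Y i w)" for w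
  define A where "A y w = (\<Prod>i\<in>I - J. 1 - y / Y i w) * (\<Prod>i\<in>J. y - Y i w)" for y w
  have A: "(A y \<longlongrightarrow> (\<Prod>i\<in>J. y - l i)) F" for y
  proof -
    have "(A y \<longlongrightarrow> (\<Prod>i\<in>I - J. 1 - 0) * (\<Prod>i\<in>J. y - l i)) F"
      unfolding A_def
      by (intro tendsto_intros tendsto_divide_0[OF tendsto_const] limJ inf) auto
    then show ?thesis by simp
  qed
  have ne: "\<forall>\<^sub>F w in F. \<forall>i\<in>I - J. Y i w \<noteq> 0"
    using fin(1) filterlim_at_infinity_imp_eventually_ne[OF inf]
    by (intro eventually_ball_finite) auto
  have GA: "\<forall>\<^sub>F w in F. eval2 p (\<xi> w) y = G w * A y w" for y
    using fac[of y] ne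
  proof eventually_elim
    case (elim w)
    have "(\<Prod>i\<in>I. y - Y i w) = (\<Prod>i\<in>I - J. y - Y i w) * (\<Prod>i\<in>J. y - Y i w)"
      using fin by (rule prod.subset_diff[rotated])
    also have "(\<Prod>i\<in>I - J. y - Y i w) = (\<Prod>i\<in>I - J. - Y i w * (1 - y / Y i w))"
      using elim by (intro prod.cong) (auto simp: field_simps)
    also have "\<dots> = (\<Prod>i\<in>I - J. - Y i w) * (\<Prod>i\<in>I - J. 1 - y / Y i w)"
      by (rule prod.distrib)
    finally show ?case using elim by (simp add: G_def A_def)
  qed
  have "finite ({y. poly (slice p x0) y = 0} \<union> l ` J)"
    using p0 fin by (auto intro: poly_roots_finite finite_subset)
  \<comment> \<open>Off both sets the numerator and the denominator of \<open>c\<close> are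
    nonzero.\<close>
  then obtain y1 where "y1 \<notin> {y. poly (slice p x0) y = 0} \<union> l ` J"
    using ex_new_if_finite[OF infinite_UNIV_char_0] by blast
  then have y1: "eval2 p x0 y1 \<noteq> 0" "(\<Prod>i\<in>J. y1 - l i) \<noteq> 0"
    using fin by (auto simp: poly_slice finite_subset)
  define c where "c = eval2 p x0 y1 / (\<Prod>i\<in>J. y1 - l i)"
  have "((\<lambda>w. eval2 p (\<xi> w) y1 / A y1 w) \<longlongrightarrow> c) F"
    unfolding c_def by (intro tendsto_divide eval2_tendsto \<xi> tendsto_const A y1)
  moreover have "\<forall>\<^sub>F w in F. eval2 p (\<xi> w) y1 / A y1 w = G w"
    using GA[of y1] tendsto_imp_eventually_ne[OF A y1(2)] by eventually_elim auto
  ultimately have G: "(G \<longlongrightarrow> c) F" by (rule Lim_transform_eventually)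
  have "eval2 p x0 y = c * (\<Prod>i\<in>J. y - l i)" for y
  proof (rule tendsto_unique[OF F])
    show "((\<lambda>w. eval2 p (\<xi> w) y) \<longlongrightarrow> eval2 p x0 y) F"
      by (intro eval2_tendsto \<xi> tendsto_const)
    show "((\<lambda>w. eval2 p (\<xi> w) y) \<longlongrightarrow> c * (\<Prod>i\<in>J. y - l i)) F"
      by (rule Lim_transform_eventually[OF tendsto_mult[OF G A]])
        (use GA[of y] in eventually_elim, auto)
  qed
  moreover have "c \<noteq> 0" using y1 by (simp add: c_def)
  ultimately show ?thesis using G that unfolding G_def by blast
qed

text \<open>The substitute for Puiseux series. In \<open>s = exp (w / M)\<close> the function
  becomes a \<open>g\<close> holomorphic at 0 with \<open>g 0 = 0\<close>, hence constantly zero or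
  \<open>s ^ n * h s\<close> with \<open>h 0\<close> nonzero; so \<open>g\<close> is bounded by a
  multiple of \<open>s * g' s\<close>, which is \<open>M\<close> times the derivative with respect
  to \<open>w\<close>. For \<open>w = Ln (x - x0)\<close> that derivative is
  \<open>(x - x0) d/dx\<close>.\<close>

lemma periodic_log_derivative:
  fixes \<psi> :: "complex \<Rightarrow> complex"
  assumes hol: "\<psi> holomorphic_on {w. Re w < L}" and M: "M > 0"
    and per: "\<And>w. Re w < L \<Longrightarrow> \<psi> (w + of_nat M * (2 * pi * \<i>)) = \<psi> w"
    and lim: "(\<psi> \<longlongrightarrow> 0) (filtercomap Re at_bot)"
  obtains C b where "b \<le> L" "C \<ge> 0" "\<And>w. Re w < b \<Longrightarrow> norm (\<psi> w) \<le> C * norm (deriv \<psi> w)"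
proof -
  let ?M = "of_nat M :: complex"
  have per_nat: "\<psi> (w + of_nat k * (?M * (2 * pi * \<i>))) = \<psi> w" if "Re w < L" for w k
  proof (induction k)
    case (Suc k)
    have "\<psi> ((w + of_nat k * (?M * (2 * pi * \<i>))) + of_nat M * (2 * pi * \<i>)) = \<psi> (w + of_nat k * (?M * (2 * pi * \<i>)))"
      using that by (intro per) auto
    with Suc show ?case by (simp add: algebra_simps)
  qed auto
  have per_int: "\<psi> (w + of_int k * (?M * (2 * pi * \<i>))) = \<psi> w" if "Re w < L" for w k
  proof (cases "k \<ge> 0")
    case True
    then show ?thesis using per_nat[OF that, of "nat k"] by simp
  next
    case False
    let ?w = "w + of_int k * (?M * (2 * pi * \<i>))"
    have "\<psi> (?w + of_nat (nat (-k)) * (?M * (2 * pi * \<i>))) = \<psi> ?w"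
      using that by (intro per_nat) auto
    then show ?thesis using False by (simp add: algebra_simps)
  qed
  define r where "r = exp (L / M)"
  have r: "r > 0" by (simp add: r_def)
  define g where "g s = (if s = 0 then 0 else \<psi> (?M * Ln s))" for s
  have Re_lt: "Re (?M * Ln s) < L" if "s \<noteq> 0" "norm s < r" for s
  proof -
    have "ln (norm s) < L / M" using that by (subst exp_less_cancel_iff[symmetric]) (simp add: r_def)
    then show ?thesis using that M by (simp add: Re_Ln field_simps)
  qed
  have im: "?M * Ln s \<in> {w. Re w < L}" if "s \<noteq> 0" "norm s < r" for s
    using Re_lt[OF that] by (rule CollectI)
  have g_exp: "\<psi> w = g (exp (w / ?M))" if "Re w < L" for w
  proof -
    have "exp (Ln (exp (w / ?M))) = exp (w / ?M)" by simp
    then obtain k :: int where k: "Ln (exp (w / ?M)) = w / ?M + (of_int (2 * k) * pi) * \<i>"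
      unfolding exp_eq by blast
    have "?M * Ln (exp (w / ?M)) = w + of_int k * (?M * (2 * pi * \<i>))"
      unfolding k using M by (simp add: algebra_simps)
    then show ?thesis using per_int[OF that, of k] by (simp add: g_def)
  qed
  \<comment> \<open>The principal logarithm serves off the negative axis,
    \<open>Ln (- s) + \<i> * pi\<close> off the positive axis. The two differ by nothing or by one
    full turn, which the periodicity absorbs.\<close>
  have "g holomorphic_on (ball 0 r - {0})"
  proof -
    have 1: "g holomorphic_on (ball 0 r - \<real>\<^sub>\<le>\<^sub>0)"
    proof (rule holomorphic_transform)
      show "(\<psi> \<circ> (\<lambda>s. ?M * Ln s)) holomorphic_on (ball 0 r - \<real>\<^sub>\<le>\<^sub>0)"
        by (intro holomorphic_on_compose_gen[OF _ hol] holomorphic_intros image_subsetI im) auto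
    qed (auto simp: g_def)
    have 2: "g holomorphic_on (ball 0 r - \<real>\<^sub>\<ge>\<^sub>0)"
    proof (rule holomorphic_transform)
      have neg: "- s \<notin> \<real>\<^sub>\<le>\<^sub>0" if "s \<notin> \<real>\<^sub>\<ge>\<^sub>0" for s :: complex
        using that by (auto simp: complex_nonpos_Reals_iff complex_nonneg_Reals_iff)
      have im2: "?M * (Ln (- s) + \<i> * pi) \<in> {w. Re w < L}" if "s \<noteq> 0" "norm s < r" for s
        using Re_lt[of "- s"] that by simp
      show "(\<psi> \<circ> (\<lambda>s. ?M * (Ln (- s) + \<i> * pi))) holomorphic_on (ball 0 r - \<real>\<^sub>\<ge>\<^sub>0)"
        by (intro holomorphic_on_compose_gen[OF _ hol] holomorphic_intros image_subsetI im2) (use neg in auto)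
      fix s :: complex assume s: "s \<in> ball 0 r - \<real>\<^sub>\<ge>\<^sub>0"
      then have s0: "s \<noteq> 0" by auto
      have "\<psi> (?M * (Ln (- s) + \<i> * pi)) = \<psi> (?M * Ln s)"
      proof (cases "Im s \<le> 0 \<and> \<not> (Re s < 0 \<and> Im s = 0)")
        case True
        have "\<psi> (?M * Ln s + of_nat 1 * (?M * (2 * pi * \<i>))) = \<psi> (?M * Ln s)"
          using Re_lt[OF s0] s by (intro per_nat) auto
        moreover have "?M * (Ln (- s) + \<i> * pi) = ?M * Ln s + of_nat 1 * (?M * (2 * pi * \<i>))"
          using True s0 by (simp add: Ln_minus algebra_simps)
        ultimately show ?thesis by simp
      next
        case False
        then have "Ln (- s) + \<i> * pi = Ln s" using s0 by (auto simp: Ln_minus)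
        then show ?thesis by simp
      qed
      then show "(\<psi> \<circ> (\<lambda>s. ?M * (Ln (- s) + \<i> * pi))) s = g s" using s0 by (simp add: g_def)
    qed
    have "(ball 0 r - \<real>\<^sub>\<le>\<^sub>0) \<union> (ball 0 r - \<real>\<^sub>\<ge>\<^sub>0) = ball 0 r - {0::complex}"
      by (auto simp: complex_nonpos_Reals_iff complex_nonneg_Reals_iff complex_eq_iff)
    then show ?thesis
      using holomorphic_on_Un[OF 1 2] by (simp add: open_Diff closed_nonpos_Reals_complex closed_nonneg_Reals_complex)
  qed
  moreover have "(g \<longlongrightarrow> g 0) (at 0)"
  proof (rule Lim_transform_eventually)
    have "filterlim (\<lambda>s. ?M * Ln s) (filtercomap Re at_bot) (at 0)"
    proof (subst filterlim_filtercomap_iff, rule filterlim_cong[THEN iffD1, OF refl refl])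
      show "\<forall>\<^sub>F s :: complex in at 0. real M * ln (norm s) = (Re \<circ> (\<lambda>s. ?M * Ln s)) s"
        by (auto simp: eventually_at_filter Re_Ln)
      have "filterlim (\<lambda>s. norm (s :: complex)) (at_right 0) (at 0)"
        unfolding filterlim_at by (auto simp: eventually_at_filter intro!: tendsto_norm_zero)
      then have "filterlim (\<lambda>s :: complex. ln (norm s)) at_bot (at 0)"
        using filterlim_compose[OF ln_at_0] by blast
      then show "filterlim (\<lambda>s :: complex. real M * ln (norm s)) at_bot (at 0)"
        using M by (intro filterlim_tendsto_pos_mult_at_bot[OF tendsto_const]) auto
    qed
    then show "((\<lambda>s. \<psi> (?M * Ln s)) \<longlongrightarrow> g 0) (at 0)"
      using filterlim_compose[OF lim] by (simp add: g_def)
    show "\<forall>\<^sub>F s in at 0. \<psi> (?M * Ln s) = g s" by (auto simp: eventually_at_filter g_def)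
  qed
  then have "(g \<longlongrightarrow> g 0) (at 0 within ball 0 r)" using r by (simp add: at_within_open[OF _ open_ball])
  ultimately have g_hol: "g holomorphic_on ball 0 r"
    by (intro no_isolated_singularity'[of "{0}" g "ball 0 r"]) auto
  have ball_exp: "norm (exp (w / ?M)) < exp (b / M)" if "Re w < b" for w b
    using that M by (simp add: divide_strict_right_mono)
  have deriv_\<psi>: "deriv \<psi> w = deriv g (exp (w / ?M)) * (exp (w / ?M) / ?M)" if "Re w < L" for w
  proof (rule DERIV_imp_deriv)
    have "exp (w / ?M) \<in> ball 0 r" using ball_exp[OF that] by (simp add: r_def)
    then have "(g has_field_derivative deriv g (exp (w / ?M))) (at (exp (w / ?M)))"
      using g_hol by (intro holomorphic_derivI[OF g_hol]) auto
    moreover have "((\<lambda>w. exp (w / ?M)) has_field_derivative exp (w / ?M) / ?M) (at w)"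
      using M by (auto intro!: derivative_eq_intros)
    ultimately have "((\<lambda>w. g (exp (w / ?M))) has_field_derivative deriv g (exp (w / ?M)) * (exp (w / ?M) / ?M)) (at w)"
      by (rule DERIV_chain2)
    moreover have "\<forall>\<^sub>F w in nhds w. g (exp (w / ?M)) = \<psi> w"
      using that g_exp eventually_nhds_in_open[OF open_halfspace_Re_lt[of L], of w]
      by (auto elim!: eventually_mono)
    ultimately show "(\<psi> has_field_derivative deriv g (exp (w / ?M)) * (exp (w / ?M) / ?M)) (at w)"
      by (rule DERIV_cong_ev[OF refl _ refl, THEN iffD1, rotated])
  qed
  show ?thesis
  proof (cases "g constant_on ball 0 r")
    case True
    then obtain c where "\<And>s. s \<in> ball 0 r \<Longrightarrow> g s = c" by (auto simp: constant_on_def)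
    moreover have "g 0 = 0" by (simp add: g_def)
    ultimately have "g s = 0" if "s \<in> ball 0 r" for s using that r by force
    then have "\<psi> w = 0" if "Re w < L" for w using ball_exp[OF that] that by (simp add: g_exp r_def)
    then show ?thesis using that[of L 0] by auto
  next
    case False
    have "0 \<in> ball (0::complex) r" "g 0 = 0" using r by (auto simp: g_def)
    then obtain h \<rho> n where h': "0 < n" "0 < \<rho>" "ball 0 \<rho> \<subseteq> ball (0 :: complex) r" "h holomorphic_on ball 0 \<rho>"
        "\<And>w. w \<in> ball 0 \<rho> \<Longrightarrow> g w = (w - 0) ^ n * h w" "\<And>w. w \<in> ball 0 \<rho> \<Longrightarrow> h w \<noteq> 0"
      by (rule holomorphic_factor_zero_nonconstant[OF g_hol open_ball connected_ball _ _ False]) (rule that)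
    note h = h'[unfolded diff_zero]
    have deriv_g: "w * deriv g w = w ^ n * (of_nat n * h w + w * deriv h w)" if w: "w \<in> ball 0 \<rho>" for w
    proof -
      have "(h has_field_derivative deriv h w) (at w)"
        using holomorphic_derivI[OF h(4) open_ball w] .
      then have "((\<lambda>w. w ^ n * h w) has_field_derivative of_nat n * w ^ (n - 1) * h w + deriv h w * w ^ n) (at w)"
        by (auto intro!: derivative_eq_intros)
      moreover have "\<forall>\<^sub>F w in nhds w. w ^ n * h w = g w"
        using w h(5) eventually_nhds_in_open[OF open_ball w] by (auto elim!: eventually_mono)
      ultimately have "(g has_field_derivative of_nat n * w ^ (n - 1) * h w + deriv h w * w ^ n) (at w)"
        by (rule DERIV_cong_ev[OF refl _ refl, THEN iffD1, rotated])
      then have "deriv g w = of_nat n * w ^ (n - 1) * h w + deriv h w * w ^ n" by (rule DERIV_imp_deriv)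
      then show ?thesis using h(1) by (cases n) (auto simp: algebra_simps)
    qed
    have contg: "continuous_on (ball 0 \<rho>) (\<lambda>w. norm (of_nat n * h w + w * deriv h w) - norm (h w) / 2)"
      using h(4) by (intro continuous_intros holomorphic_on_imp_continuous_on holomorphic_deriv) auto
    \<comment> \<open>At 0 the factor \<open>n * h + w * h'\<close> equals \<open>n * h 0\<close>
      with \<open>n \<ge> 1\<close>, so nearby it stays above half of \<open>h\<close>; this is the
      origin of the constant \<open>2 * M\<close>.\<close>
    have "norm (h 0) * (1/2) < norm (h 0) * real n"
      using h(1,2) h(6)[of 0] by (intro mult_strict_left_mono) auto
    then have "0 < norm (of_nat n * h 0 + 0 * deriv h 0) - norm (h 0) / 2"
      by (simp add: norm_mult algebra_simps)
    moreover have "isCont (\<lambda>w. norm (of_nat n * h w + w * deriv h w) - norm (h w) / 2) 0"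
      using contg h(2) by (simp add: continuous_on_eq_continuous_at)
    ultimately have "\<forall>\<^sub>F w in at 0. 0 < norm (of_nat n * h w + w * deriv h w) - norm (h w) / 2"
      unfolding isCont_def by (rule order_tendstoD(1)[rotated])
    then obtain \<rho>1 where \<rho>1_pos: "\<rho>1 > 0"
      and *: "\<And>w. w \<noteq> 0 \<Longrightarrow> dist w 0 < \<rho>1 \<Longrightarrow> 0 < norm (of_nat n * h w + w * deriv h w) - norm (h w) / 2"
      unfolding eventually_at by blast
    have \<rho>1: "norm (h w) \<le> 2 * norm (of_nat n * h w + w * deriv h w)" if "w \<noteq> 0" "norm w < \<rho>1" for w
      using *[of w] that by simp
    define b where "b = min L (M * ln (min \<rho> \<rho>1))"
    show ?thesis
    proof (rule that[of b "2 * M"])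
      fix w assume w: "Re w < b"
      let ?s = "exp (w / ?M)"
      have "norm ?s < exp (M * ln (min \<rho> \<rho>1) / M)" using w by (intro ball_exp) (simp add: b_def)
      then have s: "norm ?s < min \<rho> \<rho>1" using M h(2) \<rho>1_pos by simp
      have wL: "Re w < L" using w by (simp add: b_def)
      have "norm (\<psi> w) = norm ?s ^ n * norm (h ?s)"
        using h(5)[of ?s] s by (simp add: g_exp[OF wL] norm_mult norm_power)
      also have "\<dots> \<le> norm ?s ^ n * (2 * norm (of_nat n * h ?s + ?s * deriv h ?s))"
        using \<rho>1[of ?s] s by (intro mult_left_mono) auto
      also have "\<dots> = 2 * norm (?s * deriv g ?s)"
        using deriv_g[of ?s] s by (simp add: norm_mult norm_power)
      also have "\<dots> = 2 * M * norm (deriv \<psi> w)"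
        using M by (simp add: deriv_\<psi>[OF wL] norm_mult norm_divide)
      finally show "norm (\<psi> w) \<le> 2 * M * norm (deriv \<psi> w)" by simp
    qed (auto simp: b_def)
  qed
qed

subsection \<open>Counting zeros on the polar curve\<close>

definition poly_growth :: "(complex \<times> complex) set \<Rightarrow> (complex \<times> complex \<Rightarrow> real) \<Rightarrow> bool" where
  "poly_growth Z h \<longleftrightarrow> (\<exists>C k. C \<ge> 0 \<and> (\<forall>z\<in>Z. h z \<le> C * (1 + norm (fst z)) ^ k))"

lemma poly_growthI: "C \<ge> 0 \<Longrightarrow> (\<And>z. z \<in> Z \<Longrightarrow> h z \<le> C * (1 + norm (fst z)) ^ k) \<Longrightarrow> poly_growth Z h"
  unfolding poly_growth_def by blast

lemma poly_growth_mono: "poly_growth Z h \<Longrightarrow> (\<And>z. z \<in> Z \<Longrightarrow> h' z \<le> h z) \<Longrightarrow> poly_growth Z h'"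
  unfolding poly_growth_def by (meson order_trans)

lemma poly_growth_const: "poly_growth Z (\<lambda>_. c)"
  by (rule poly_growthI[of "\<bar>c\<bar>" _ _ 0]) auto

lemma poly_growth_add:
  assumes "poly_growth Z g" "poly_growth Z h"
  shows "poly_growth Z (\<lambda>z. g z + h z)"
proof -
  obtain C k where g: "C \<ge> 0" "\<And>z. z \<in> Z \<Longrightarrow> g z \<le> C * (1 + norm (fst z)) ^ k"
    using assms(1) unfolding poly_growth_def by blast
  obtain C' k' where h: "C' \<ge> 0" "\<And>z. z \<in> Z \<Longrightarrow> h z \<le> C' * (1 + norm (fst z)) ^ k'"
    using assms(2) unfolding poly_growth_def by blast
  note * = g h
  have "g z + h z \<le> (C + C') * (1 + norm (fst z)) ^ (k + k')" if "z \<in> Z" for z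
  proof -
    have "C * (1 + norm (fst z)) ^ k \<le> C * (1 + norm (fst z)) ^ (k + k')"
      by (intro mult_left_mono power_increasing) (use * in auto)
    moreover have "C' * (1 + norm (fst z)) ^ k' \<le> C' * (1 + norm (fst z)) ^ (k + k')"
      by (intro mult_left_mono power_increasing) (use * in auto)
    ultimately show ?thesis using *(2,4)[OF that] by (simp add: algebra_simps)
  qed
  then show ?thesis using * by (intro poly_growthI[of "C + C'"]) auto
qed

lemma poly_growth_mult:
  assumes "poly_growth Z g" "poly_growth Z h" "\<And>z. z \<in> Z \<Longrightarrow> g z \<ge> 0" "\<And>z. z \<in> Z \<Longrightarrow> h z \<ge> 0"
  shows "poly_growth Z (\<lambda>z. g z * h z)"
proof -
  obtain C k where g: "C \<ge> 0" "\<And>z. z \<in> Z \<Longrightarrow> g z \<le> C * (1 + norm (fst z)) ^ k"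
    using assms(1) unfolding poly_growth_def by blast
  obtain C' k' where h: "C' \<ge> 0" "\<And>z. z \<in> Z \<Longrightarrow> h z \<le> C' * (1 + norm (fst z)) ^ k'"
    using assms(2) unfolding poly_growth_def by blast
  note * = g h
  have "g z * h z \<le> (C * C') * (1 + norm (fst z)) ^ (k + k')" if "z \<in> Z" for z
    using mult_mono[OF *(2)[OF that] *(4)[OF that]] assms(4)[OF that] *(1) by (simp add: power_add algebra_simps)
  then show ?thesis using * by (intro poly_growthI[of "C * C'"]) auto
qed

lemma poly_growth_power:
  assumes "poly_growth Z g" "\<And>z. z \<in> Z \<Longrightarrow> g z \<ge> 0"
  shows "poly_growth Z (\<lambda>z. g z ^ k)"
  by (induction k) (auto intro!: poly_growth_const poly_growth_mult assms zero_le_power)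

lemma poly_growth_sum:
  assumes "\<And>i. i \<in> I \<Longrightarrow> poly_growth Z (g i)"
  shows "poly_growth Z (\<lambda>z. \<Sum>i\<in>I. g i z)"
  using assms by (induction I rule: infinite_finite_induct) (auto intro!: poly_growth_const poly_growth_add)

lemma poly_growth_poly: "poly_growth Z (\<lambda>z. norm (poly q (fst z)))"
proof (induction q)
  case (pCons a q)
  have "poly_growth Z (\<lambda>z. norm (fst z))" by (rule poly_growthI[of 1 _ _ 1]) auto
  then have "poly_growth Z (\<lambda>z. norm a + norm (fst z) * norm (poly q (fst z)))"
    by (intro poly_growth_add poly_growth_const poly_growth_mult pCons.IH) auto
  then show ?case
    by (rule poly_growth_mono) (auto intro: order_trans[OF norm_triangle_ineq] simp: norm_mult)
qed (auto intro: poly_growth_const)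

text \<open>Where \<open>norm y > 1\<close>, isolate the leading term of the equation and divide by
  a power of \<open>y\<close>: the leading coefficient times \<open>y\<close> is bounded by the sum
  of the other coefficients. The factor compensates for roots that escape where the leading
  coefficient vanishes.\<close>

lemma root_poly_growth:
  assumes "degree p > 0"
  shows "poly_growth {(x, y). eval2 p x y = 0} (\<lambda>(x, y). norm (poly (lead_coeff p) x * y))"
proof (rule poly_growth_mono)
  show "poly_growth {(x, y). eval2 p x y = 0} (\<lambda>z. \<Sum>j\<le>degree p. norm (poly (coeff p j) (fst z)))"
    by (intro poly_growth_sum poly_growth_poly)
  fix z assume "z \<in> {(x, y). eval2 p x y = 0}"
  then obtain x y where z: "z = (x, y)" "eval2 p x y = 0" by auto
  obtain m where m: "degree p = Suc m" using assms by (cases "degree p") auto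
  let ?c = "\<lambda>j. poly (coeff p j) x"
  have "norm (?c (Suc m) * y) \<le> (\<Sum>j\<le>Suc m. norm (?c j))"
  proof (cases "norm y \<le> 1")
    case True
    then have "norm (?c (Suc m)) * norm y \<le> norm (?c (Suc m)) * 1" by (intro mult_left_mono) auto
    also have "\<dots> \<le> (\<Sum>j\<le>Suc m. norm (?c j))" by (simp add: sum_nonneg)
    finally show ?thesis by (simp add: norm_mult)
  next
    case False
    have "?c (Suc m) * y ^ Suc m = - (\<Sum>j\<le>m. ?c j * y ^ j)"
      using z(2) by (simp add: eval2_altdef m add_eq_0_iff2)
    then have "norm (?c (Suc m) * y) * norm y ^ m = norm (\<Sum>j\<le>m. ?c j * y ^ j)"
      by (metis (no_types, lifting) mult.assoc norm_minus_cancel norm_mult norm_power power_Suc)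
    also have "\<dots> \<le> (\<Sum>j\<le>m. norm (?c j) * norm y ^ m)"
      using False by (intro sum_norm_le) (auto simp: norm_mult norm_power intro!: mult_left_mono power_increasing)
    also have "\<dots> = (\<Sum>j\<le>m. norm (?c j)) * norm y ^ m" by (simp add: sum_distrib_right)
    finally have "norm (?c (Suc m) * y) \<le> (\<Sum>j\<le>m. norm (?c j))"
    proof (rule mult_right_le_imp_le)
      have "0 < norm y" using False by linarith
      then show "0 < norm y ^ m" by simp
    qed
    then show ?thesis unfolding sum.atMost_Suc using norm_ge_zero[of "?c (Suc m)"] by linarith
  qed
  then show "(case z of (x, y) \<Rightarrow> norm (poly (lead_coeff p) x * y)) \<le> (\<Sum>j\<le>degree p. norm (poly (coeff p j) (fst z)))"
    by (simp add: z m)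
qed

text \<open>With \<open>N\<close> powers of the leading coefficient, \<open>h\<close> becomes a
  polynomial in \<open>x\<close> and in the product of the leading coefficient with
  \<open>y\<close>, which \<open>root_poly_growth\<close> controls.\<close>

lemma eval2_on_curve_growth:
  assumes "degree p > 0" "degree h \<le> N"
  shows "poly_growth {(x, y). eval2 p x y = 0} (\<lambda>(x, y). norm (poly (lead_coeff p) x ^ N * eval2 h x y))"
proof (rule poly_growth_mono)
  let ?Z = "{(x, y). eval2 p x y = 0}" and ?a = "poly (lead_coeff p)"
  let ?B = "\<lambda>z. \<Sum>j\<le>degree h. norm (poly (coeff h j) (fst z)) * (norm (?a (fst z)) ^ (N - j) *
        (case z of (x, y) \<Rightarrow> norm (?a x * y)) ^ j)"
  show "poly_growth ?Z ?B"
    by (intro poly_growth_sum poly_growth_mult poly_growth_poly poly_growth_power root_poly_growth assms(1))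
      (auto split: prod.splits)
  fix z assume "z \<in> ?Z"
  obtain x y where z: "z = (x, y)" by fastforce
  have "?a x ^ N * eval2 h x y = (\<Sum>j\<le>degree h. poly (coeff h j) x * (?a x ^ (N - j) * (?a x * y) ^ j))"
    unfolding eval2_altdef sum_distrib_left
  proof (intro sum.cong refl)
    fix j assume "j \<in> {..degree h}"
    then have "?a x ^ N = ?a x ^ (N - j) * ?a x ^ j" using assms(2) by (simp flip: power_add)
    then show "?a x ^ N * (poly (coeff h j) x * y ^ j) = poly (coeff h j) x * (?a x ^ (N - j) * (?a x * y) ^ j)"
      by (simp add: power_mult_distrib)
  qed
  also have "norm \<dots> \<le> ?B z"
    unfolding z by (intro sum_norm_le) (auto simp: norm_mult norm_power)
  finally show "(case z of (x, y) \<Rightarrow> norm (?a x ^ N * eval2 h x y)) \<le> ?B z" by (simp add: z)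
qed

text \<open>The singularities in \<open>S\<close> are removable because \<open>G\<close> is bounded
  near them, and Liouville's theorem turns polynomial growth into a polynomial. The factors
  \<open>x - s\<close> give the extension the explicit value 0 on \<open>S\<close>.\<close>

lemma holomorphic_off_finite_polynomial:
  assumes S: "finite S" and hol: "G holomorphic_on - S"
    and bd: "C \<ge> 0" "\<And>x. x \<notin> S \<Longrightarrow> norm (G x) \<le> C * (1 + norm x) ^ k"
  shows "\<exists>P. \<forall>x. x \<notin> S \<longrightarrow> poly P x = (\<Prod>s\<in>S. x - s) * G x"
proof -
  define E where "E x = (if x \<in> S then 0 else (\<Prod>s\<in>S. x - s) * G x)" for x
  have E_bd: "norm (E x) \<le> norm (\<Prod>s\<in>S. x - s) * (C * (1 + norm x) ^ k)" for x
  proof (cases "x \<in> S")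
    case False
    then have "norm (E x) = norm (\<Prod>s\<in>S. x - s) * norm (G x)" by (simp add: E_def norm_mult)
    also have "\<dots> \<le> norm (\<Prod>s\<in>S. x - s) * (C * (1 + norm x) ^ k)"
      by (intro mult_left_mono bd(2) False norm_ge_zero)
    finally show ?thesis .
  next
    case True
    have "0 \<le> C * (1 + norm x) ^ k" using bd(1) by (intro mult_nonneg_nonneg zero_le_power) auto
    then show ?thesis using True by (simp add: E_def)
  qed
  have "E holomorphic_on UNIV"
  proof (rule no_isolated_singularity'[of S])
    fix z assume z: "z \<in> S"
    have "((\<lambda>x. norm (\<Prod>s\<in>S. x - s) * (C * (1 + norm x) ^ k)) \<longlongrightarrow> norm (\<Prod>s\<in>S. z - s) * (C * (1 + norm z) ^ k)) (at z)"
      by (intro tendsto_intros)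
    moreover have "(\<Prod>s\<in>S. z - s) = 0" using z S by (auto simp: prod_zero_iff)
    ultimately have lim0: "((\<lambda>x. norm (\<Prod>s\<in>S. x - s) * (C * (1 + norm x) ^ k)) \<longlongrightarrow> 0) (at z)" by simp
    have "(E \<longlongrightarrow> 0) (at z)"
      by (rule Lim_null_comparison[OF _ lim0]) (intro always_eventually allI E_bd)
    then show "(E \<longlongrightarrow> E z) (at z within UNIV)" using z by (simp add: E_def)
  next
    have "(\<lambda>x. (\<Prod>s\<in>S. x - s) * G x) holomorphic_on - S"
      by (intro holomorphic_intros hol)
    then show "E holomorphic_on UNIV - S"
      unfolding Compl_eq_Diff_UNIV by (rule holomorphic_transform) (simp add: E_def)
  qed (use S in auto)
  obtain C' k' where C': "C' \<ge> 0" "\<And>x. norm (\<Prod>s\<in>S. x - s) * (C * (1 + norm x) ^ k) \<le> C' * (1 + norm x) ^ k'"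
  proof -
    have "poly_growth UNIV (\<lambda>z. norm (poly (\<Prod>s\<in>S. [:-s, 1:]) (fst z)) * (C * (1 + norm (fst z)) ^ k))"
      by (intro poly_growth_mult poly_growth_poly poly_growthI[OF bd(1)]) (use bd in auto)
    then obtain C' k' where "C' \<ge> 0" "\<And>z :: complex \<times> complex. norm (poly (\<Prod>s\<in>S. [:-s, 1:]) (fst z)) * (C * (1 + norm (fst z)) ^ k)
        \<le> C' * (1 + norm (fst z)) ^ k'"
      unfolding poly_growth_def by blast
    from this(1) this(2)[of "(x, 0)" for x] show ?thesis
      by (intro that[of C' k']) (simp_all add: poly_prod)
  qed
  have "norm (E z) \<le> (C' * 2 ^ k') * norm z ^ k'" if "1 \<le> norm z" for z
  proof -
    have "norm (E z) \<le> C' * (1 + norm z) ^ k'" using E_bd C'(2) order_trans by blast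
    also have "\<dots> \<le> C' * (2 * norm z) ^ k'"
      using that C'(1) by (intro mult_left_mono power_mono) auto
    finally show ?thesis by (simp add: power_mult_distrib)
  qed
  then have "E z = (\<Sum>j\<le>k'. (deriv ^^ j) E 0 / fact j * z ^ j)" for z
    by (rule Liouville_polynomial[OF \<open>E holomorphic_on UNIV\<close>])
  moreover have "poly (\<Sum>j\<le>k'. monom ((deriv ^^ j) E 0 / fact j) j) z = (\<Sum>j\<le>k'. (deriv ^^ j) E 0 / fact j * z ^ j)" for z
    by (simp add: poly_sum poly_monom)
  ultimately have "poly (\<Sum>j\<le>k'. monom ((deriv ^^ j) E 0 / fact j) j) z = E z" for z
    by metis
  moreover have "E z = (\<Prod>s\<in>S. z - s) * G z" if "z \<notin> S" for z
    using that by (simp add: E_def)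
  ultimately show ?thesis by metis
qed

text \<open>Over a fibre without multiple roots this is the resultant of \<open>p\<close> and
  \<open>h\<close> up to a power of the leading coefficient of \<open>p\<close>. Being symmetric in
  the sheets, it is single-valued.\<close>

definition fibre_prod :: "bipoly \<Rightarrow> bipoly \<Rightarrow> complex \<Rightarrow> complex" where
  "fibre_prod p h x = (\<Prod>y | eval2 p x y = 0. eval2 h x y)"

lemma fibre_prod_holomorphic:
  assumes un: "unramified_off p S"
  shows "fibre_prod p h holomorphic_on - S"
proof -
  have "finite S" using un by (simp add: unramified_off_def)
  then have op: "open (- S)" by (simp add: finite_imp_closed open_Compl)
  have "\<exists>D. (fibre_prod p h has_field_derivative D) (at x)" if x: "x \<in> - S" for x
  proof -
    obtain e where e: "e > 0" "ball x e \<subseteq> - S" using op x by (meson open_contains_ball)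
    have "simply_connected (ball x e)" "ball x e \<noteq> {}" "(\<lambda>x. x) holomorphic_on ball x e"
        "(\<lambda>x. x) \<in> ball x e \<rightarrow> - S"
      using e by (auto simp: convex_imp_simply_connected)
    from sheets_exist[OF un open_ball this] obtain Y where Y: "sheets p (\<lambda>x. x) (ball x e) Y" .
    have "(\<lambda>w. \<Prod>i<degree p. eval2 h w (Y i w)) holomorphic_on ball x e"
      using Y by (intro holomorphic_intros eval2_holomorphic) (auto simp: sheets_def)
    then have "fibre_prod p h holomorphic_on ball x e"
    proof (rule holomorphic_transform)
      fix w assume w: "w \<in> ball x e"
      then have "w \<notin> S" using e by auto
      from sheets_prod[OF un Y w this] show "(\<Prod>i<degree p. eval2 h w (Y i w)) = fibre_prod p h w"
        unfolding fibre_prod_def by (rule sym)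
    qed
    then show ?thesis using e by (simp add: holomorphic_on_open)
  qed
  then show ?thesis using op by (simp add: holomorphic_on_open)
qed

lemma fibre_prod_polynomial:
  assumes un: "unramified_off p S" and N: "degree h \<le> N"
  shows "\<exists>P. \<forall>x. x \<notin> S \<longrightarrow>
    poly P x = (\<Prod>s\<in>S. x - s) * (poly (lead_coeff p) x ^ (N * degree p) * fibre_prod p h x)"
proof -
  let ?a = "poly (lead_coeff p)" and ?m = "degree p"
  have m: "?m > 0" and S: "finite S" using un by (auto simp: unramified_off_def)
  obtain C k where C: "C \<ge> 0" "\<And>x y. eval2 p x y = 0 \<Longrightarrow> norm (?a x ^ N * eval2 h x y) \<le> C * (1 + norm x) ^ k"
    using eval2_on_curve_growth[OF m N] by (auto simp: poly_growth_def)
  show ?thesis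
  proof (rule holomorphic_off_finite_polynomial[OF S])
    show "(\<lambda>x. ?a x ^ (N * ?m) * fibre_prod p h x) holomorphic_on - S"
      by (intro holomorphic_intros fibre_prod_holomorphic[OF un])
    show "C ^ ?m \<ge> 0" using C by simp
    fix x assume x: "x \<notin> S"
    note c = card_roots_unramified[OF un x]
    have "?a x ^ (N * ?m) * fibre_prod p h x = (\<Prod>y | eval2 p x y = 0. ?a x ^ N * eval2 h x y)"
      by (simp add: fibre_prod_def prod.distrib c power_mult)
    also have "norm \<dots> \<le> (\<Prod>y | eval2 p x y = 0. C * (1 + norm x) ^ k)"
      unfolding prod_norm[symmetric] by (intro prod_mono) (use C in auto)
    also have "\<dots> = C ^ ?m * (1 + norm x) ^ (k * ?m)"
      by (simp add: c power_mult_distrib power_mult)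
    finally show "norm (?a x ^ (N * ?m) * fibre_prod p h x) \<le> C ^ ?m * (1 + norm x) ^ (k * ?m)" .
  qed
qed

section \<open>Comparing orders and degrees of two polynomials\<close>

lemma order_le_of_bound:
  assumes "P1 \<noteq> 0" "P2 \<noteq> (0 :: complex poly)" "\<delta> > 0"
    and bd: "\<And>x. x \<noteq> x0 \<Longrightarrow> dist x x0 < \<delta> \<Longrightarrow> norm (poly P1 x) \<le> C * norm (x - x0) ^ k * norm (poly P2 x)"
  shows "order x0 P2 + k \<le> order x0 P1"
proof (rule ccontr)
  let ?a = "order x0 P1" and ?b = "order x0 P2"
  assume neg: "\<not> ?thesis"
  obtain Q1 where Q1: "P1 = [:-x0, 1:] ^ ?a * Q1" "\<not> [:-x0, 1:] dvd Q1"
    using order_decomp[OF assms(1)] by metis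
  obtain Q2 where Q2: "P2 = [:-x0, 1:] ^ ?b * Q2"
    using order_decomp[OF assms(2)] by metis
  have Q1x0: "poly Q1 x0 \<noteq> 0" using Q1(2) by (simp add: poly_eq_0_iff_dvd)
  have "norm (poly Q1 x) \<le> C * norm (x - x0) ^ (?b + k - ?a) * norm (poly Q2 x)"
    if x: "x \<noteq> x0" "dist x x0 < \<delta>" for x
  proof -
    have "poly P1 x = (x - x0) ^ ?a * poly Q1 x" "poly P2 x = (x - x0) ^ ?b * poly Q2 x"
      by (subst Q1(1) Q2(1), simp add: poly_mult poly_power)+
    then have "norm (x - x0) ^ ?a * norm (poly Q1 x) \<le> C * norm (x - x0) ^ (?b + k) * norm (poly Q2 x)"
      using bd[OF x] by (simp add: norm_mult norm_power power_add mult_ac)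
    also have "?b + k = ?a + (?b + k - ?a)" using neg by simp
    finally have "norm (x - x0) ^ ?a * norm (poly Q1 x) \<le>
        norm (x - x0) ^ ?a * (C * norm (x - x0) ^ (?b + k - ?a) * norm (poly Q2 x))"
      by (simp add: power_add mult_ac)
    then show ?thesis using x(1) by (simp add: mult_le_cancel_left_pos)
  qed
  then have "\<forall>\<^sub>F x in at x0. norm (poly Q1 x) \<le> C * norm (x - x0) ^ (?b + k - ?a) * norm (poly Q2 x)"
    using assms(3) unfolding eventually_at by blast
  moreover have "((\<lambda>x. C * norm (x - x0) ^ (?b + k - ?a) * norm (poly Q2 x)) \<longlongrightarrow>
      C * norm (x0 - x0) ^ (?b + k - ?a) * norm (poly Q2 x0)) (at x0)"
    by (intro tendsto_intros)
  moreover have "((\<lambda>x. norm (poly Q1 x)) \<longlongrightarrow> norm (poly Q1 x0)) (at x0)"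
    by (intro tendsto_intros)
  ultimately have "norm (poly Q1 x0) \<le> C * norm (x0 - x0) ^ (?b + k - ?a) * norm (poly Q2 x0)"
    by (intro tendsto_le[of "at x0"]) auto
  then show False using Q1x0 neg by (simp add: power_0_left)
qed

lemma poly_div_power_tendsto:
  assumes "degree P \<le> d"
  shows "((\<lambda>x :: complex. poly P x / x ^ d) \<longlongrightarrow> coeff P d) at_infinity"
proof (rule Lim_transform_eventually)
  have "((\<lambda>x. \<Sum>j\<le>d. coeff P j * inverse x ^ (d - j)) \<longlongrightarrow> (\<Sum>j\<le>d. coeff P j * 0 ^ (d - j))) at_infinity"
    by (intro tendsto_intros tendsto_inverse_0)
  also have "(\<Sum>j\<le>d. coeff P j * 0 ^ (d - j)) = (\<Sum>j\<le>d. if j = d then coeff P d else 0)"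
    by (intro sum.cong) (auto simp: power_0_left)
  finally show "((\<lambda>x. \<Sum>j\<le>d. coeff P j * inverse x ^ (d - j)) \<longlongrightarrow> coeff P d) at_infinity" by simp
  have eq: "(\<Sum>j\<le>d. coeff P j * inverse x ^ (d - j)) = poly P x / x ^ d" if "x \<noteq> 0" for x
  proof -
    have "poly P x = (\<Sum>j\<le>d. coeff P j * x ^ j)"
      unfolding poly_altdef using assms by (intro sum.mono_neutral_left) (auto simp: coeff_eq_0)
    moreover have "x ^ j / x ^ d = inverse x ^ (d - j)" if "j \<le> d" for j
      using that \<open>x \<noteq> 0\<close> by (simp add: power_diff field_simps power_inverse)
    moreover have "(\<Sum>j\<le>d. coeff P j * x ^ j) / x ^ d = (\<Sum>j\<le>d. coeff P j * (x ^ j / x ^ d))"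
      by (simp add: sum_divide_distrib)
    ultimately show ?thesis by (auto intro!: sum.cong)
  qed
  from eventually_not_equal_at_infinity[of 0]
  show "\<forall>\<^sub>F x in at_infinity. (\<Sum>j\<le>d. coeff P j * inverse x ^ (d - j)) = poly P x / x ^ d"
    by eventually_elim (rule eq)
qed

lemma degree_le_of_bound:
  assumes "P1 \<noteq> (0 :: complex poly)"
    and bd: "\<And>x. norm x > \<rho> \<Longrightarrow> norm (poly P1 x) \<le> C * norm x ^ m * norm (poly P2 x)"
  shows "degree P1 \<le> degree P2 + m"
proof (rule ccontr)
  let ?a = "degree P1" and ?b = "degree P2"
  assume neg: "\<not> ?thesis"
  have "\<forall>\<^sub>F x in at_infinity. norm x > \<rho>"
    using filterlim_at_top_dense[THEN iffD1, OF filterlim_norm_at_top] by blast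
  then have "\<forall>\<^sub>F x in at_infinity. norm (poly P1 x / x ^ ?a) \<le> C * norm (inverse x) ^ (?a - (m + ?b)) * norm (poly P2 x / x ^ ?b)"
    using eventually_not_equal_at_infinity[of 0]
  proof eventually_elim
    case (elim x)
    have "norm x ^ ?a = norm x ^ (?a - (m + ?b)) * norm x ^ m * norm x ^ ?b"
      using neg by (simp flip: power_add)
    then show ?case using bd[OF elim(1)] elim(2)
      by (simp add: norm_divide norm_power norm_inverse field_simps)
  qed
  moreover have "((\<lambda>x. C * norm (inverse x) ^ (?a - (m + ?b)) * norm (poly P2 x / x ^ ?b)) \<longlongrightarrow>
      C * norm (0 :: complex) ^ (?a - (m + ?b)) * norm (coeff P2 ?b)) at_infinity"
    by (intro tendsto_intros tendsto_inverse_0 poly_div_power_tendsto) auto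
  moreover have "((\<lambda>x. norm (poly P1 x / x ^ ?a)) \<longlongrightarrow> norm (coeff P1 ?a)) at_infinity"
    by (intro tendsto_intros poly_div_power_tendsto) auto
  ultimately have "norm (coeff P1 ?a) \<le> C * norm (0 :: complex) ^ (?a - (m + ?b)) * norm (coeff P2 ?b)"
    by (intro tendsto_le[OF trivial_limit_at_infinity]) auto
  then show False using neg assms(1) by (simp add: power_0_left)
qed

lemma degree_eq_sum_order:
  assumes "P \<noteq> (0 :: complex poly)" "finite T" "{x. poly P x = 0} \<subseteq> T"
  shows "degree P = (\<Sum>x\<in>T. order x P)"
proof -
  have "degree P = (\<Sum>x | poly P x = 0. order x P)"
    using assms size_proots_complex[of P] by (simp add: size_multiset_overloaded_eq)
  also have "\<dots> = (\<Sum>x\<in>T. order x P)"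
    using assms by (intro sum.mono_neutral_left) (auto simp: order_root)
  finally show ?thesis .
qed

text \<open>The rational function \<open>P1 / P2\<close> has order at least \<open>k x0\<close> at
  every point, hence no poles, and grows at most like \<open>x ^ m\<close>; the orders of a
  polynomial add up to its degree.\<close>

lemma sum_order_count:
  assumes P: "P1 \<noteq> 0" "P2 \<noteq> (0 :: complex poly)" and "finite A"
    and loc: "\<And>x0. \<exists>C \<delta>. \<delta> > 0 \<and> (\<forall>x. x \<noteq> x0 \<longrightarrow> dist x x0 < \<delta> \<longrightarrow>
        norm (poly P1 x) \<le> C * norm (x - x0) ^ k x0 * norm (poly P2 x))"
    and inf: "\<And>x. norm x > \<rho> \<Longrightarrow> norm (poly P1 x) \<le> C * norm x ^ m * norm (poly P2 x)"
  shows "(\<Sum>x0\<in>A. k x0) \<le> m"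
proof -
  define T where "T = A \<union> {x. poly P1 x = 0} \<union> {x. poly P2 x = 0}"
  have T: "finite T" using assms by (auto simp: T_def poly_roots_finite)
  have ord: "order x0 P2 + k x0 \<le> order x0 P1" for x0
    using loc[of x0] order_le_of_bound[OF P] by blast
  have "degree P2 + (\<Sum>x0\<in>A. k x0) \<le> (\<Sum>x0\<in>T. order x0 P2) + (\<Sum>x0\<in>T. k x0)"
    using degree_eq_sum_order[OF P(2) T] T by (intro add_mono sum_mono2) (auto simp: T_def)
  also have "\<dots> \<le> (\<Sum>x0\<in>T. order x0 P1)"
    unfolding sum.distrib[symmetric] by (intro sum_mono ord)
  also have "\<dots> = degree P1" by (rule degree_eq_sum_order[OF P(1) T, symmetric]) (auto simp: T_def)
  also have "\<dots> \<le> degree P2 + m" by (rule degree_le_of_bound[OF P(1) inf])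
  finally show ?thesis by simp
qed

text \<open>Every shift of a sheet by a multiple of \<open>2 * pi * \<i>\<close> is again a
  continuous root. The fibre over \<open>w0\<close> is finite, so two shifts agree there and
  therefore everywhere.\<close>

lemma sheet_periodic:
  assumes un: "unramified_off p S" and Y: "sheets p (\<lambda>w. x0 + exp w) {w. Re w < L} Y" "i < degree p"
    and im: "\<And>w. Re w < L \<Longrightarrow> x0 + exp w \<notin> S"
  obtains M where "M > 0" "\<And>w. Re w < L \<Longrightarrow> Y i (w + of_nat M * (2 * pi * \<i>)) = Y i w"
proof -
  let ?H = "{w. Re w < L}" and ?\<xi> = "\<lambda>w :: complex. x0 + exp w"
  define Z where "Z k w = Y i (w + of_nat k * (2 * pi * \<i>))" for k w
  have \<xi>_per: "?\<xi> (w + of_nat k * (2 * pi * \<i>)) = ?\<xi> w" for w k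
  proof -
    have "exp (of_nat k * (2 * pi * \<i>)) = 1"
      using exp_integer_2pi[of "of_nat k"] by (simp add: mult_ac)
    then show ?thesis by (simp add: exp_add)
  qed
  have Z_root: "eval2 p (?\<xi> w) (Z k w) = 0" if "w \<in> ?H" for w k
  proof -
    have "w + of_nat k * (2 * pi * \<i>) \<in> ?H" using that by simp
    from sheets_root[OF Y this] show ?thesis unfolding Z_def \<xi>_per .
  qed
  have Z_cont: "continuous_on ?H (Z k)" for k
    unfolding Z_def by (rule continuous_on_compose2[OF sheets_continuous[OF Y]]) (auto intro!: continuous_intros)
  define w0 :: complex where "w0 = of_real (L - 1)"
  have w0: "w0 \<in> ?H" by (simp add: w0_def)
  have "(\<lambda>k. Z k w0) ` UNIV \<subseteq> {y. eval2 p (?\<xi> w0) y = 0}" using Z_root w0 by auto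
  then have "finite (range (\<lambda>k. Z k w0))"
    using card_roots_unramified(1)[OF un im] w0 finite_subset by blast
  then have "\<not> inj (\<lambda>k. Z k w0)" using finite_imageD infinite_UNIV_nat by blast
  then obtain j k where "Z j w0 = Z k w0" "j \<noteq> k" by (auto simp: inj_def)
  then obtain j k where jk: "Z j w0 = Z k w0" "j < k" by (metis linorder_neqE_nat)
  have eq: "Z j w = Z k w" if "w \<in> ?H" for w
  proof (rule sheet_unique[OF un _ _ _ Z_cont Z_root Z_cont Z_root w0 jk(1) that])
    show "connected ?H" by (intro convex_connected convex_halfspace_Re_lt)
    show "?\<xi> \<in> ?H \<rightarrow> - S" using im by auto
  qed (auto intro!: continuous_intros)
  show ?thesis
  proof (rule that[of "k - j"])
    fix w :: complex assume "Re w < L"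
    then have "Z j (w - of_nat j * (2 * pi * \<i>)) = Z k (w - of_nat j * (2 * pi * \<i>))"
      by (intro eq) auto
    then show "Y i (w + of_nat (k - j) * (2 * pi * \<i>)) = Y i w"
      using jk(2) by (simp add: Z_def of_nat_diff algebra_simps)
  qed (use jk in auto)
qed

lemma finite_punctured_nbhd:
  assumes "finite (S :: complex set)"
  obtains \<delta> where "\<delta> > 0" "\<And>x. x \<noteq> x0 \<Longrightarrow> dist x x0 < \<delta> \<Longrightarrow> x \<notin> S"
proof -
  obtain \<delta> where "\<delta> > 0" "\<forall>x\<in>S. x \<noteq> x0 \<longrightarrow> \<delta> \<le> dist x0 x"
    using finite_set_avoid[OF assms] by metis
  then show ?thesis using that[of \<delta>] by (force simp: dist_commute)
qed

text \<open>On the curve \<^term>\<open>p = 0\<close>, where the \<open>y\<close>-derivative of \<open>f\<close> vanishes, each branch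
  \<open>y = Y x\<close> over a punctured disc satisfies \<open>(f(x, Y x))' = f\<^sub>x(x, Y x)\<close>; if \<open>f\<close> vanishes at the
  centre of the branch, then passing from \<open>f\<close> to \<open>f\<^sub>x\<close> costs exactly one factor \<open>x - x0\<close>.\<close>

lemma polar_local_estimate:
  assumes un: "unramified_off p S" and p0: "slice p x0 \<noteq> 0"
    and polar: "\<And>x y. eval2 p x y = 0 \<Longrightarrow> eval2 (partial_y f) x y = 0"
    and crit: "\<And>y. eval2 (partial_x f) x0 y = 0 \<Longrightarrow> eval2 (partial_y f) x0 y = 0 \<Longrightarrow> eval2 f x0 y = 0"
    and inf: "\<delta>' > 0" "\<And>x y. x \<noteq> x0 \<Longrightarrow> dist x x0 < \<delta>' \<Longrightarrow> norm y > M \<Longrightarrow> eval2 p x y = 0 \<Longrightarrow>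
        norm (eval2 f x y) \<le> C' * norm (x - x0) * norm (eval2 (partial_x f) x y)"
  shows "\<exists>C \<delta>. \<delta> > 0 \<and> (\<forall>x. x \<noteq> x0 \<longrightarrow> dist x x0 < \<delta> \<longrightarrow> x \<notin> S \<and>
      norm (fibre_prod p f x) \<le> C *
        norm (x - x0) ^ (degree p - size (filter_mset (\<lambda>y. eval2 f x0 y \<noteq> 0) (proots (slice p x0)))) *
        norm (fibre_prod p (partial_x f) x))"
proof -
  let ?m = "degree p" and ?fx = "partial_x f"
  have "finite S" using un by (simp add: unramified_off_def)
  obtain \<delta>0 where \<delta>0: "\<delta>0 > 0" "\<And>x. x \<noteq> x0 \<Longrightarrow> dist x x0 < \<delta>0 \<Longrightarrow> x \<notin> S"
    using finite_punctured_nbhd[OF \<open>finite S\<close>, of x0] by metis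
  \<comment> \<open>The map \<open>x0 + exp w\<close> takes the half-plane \<open>Re w < L\<close>
    onto the punctured disc of radius \<open>\<delta>0\<close>.\<close>
  define L where "L = ln \<delta>0"
  define H where "H = {w. Re w < L}"
  define \<xi> where "\<xi> w = x0 + exp w" for w
  define F where "F = filtercomap Re at_bot"
  have dist_\<xi>: "dist (\<xi> w) x0 < \<delta>" if "Re w < ln \<delta>" "\<delta> > 0" for w \<delta>
  proof -
    have "exp (Re w) < \<delta>" using that by (metis exp_less_mono exp_ln)
    then show ?thesis using that by (simp add: \<xi>_def dist_norm)
  qed
  have \<xi>_ne: "\<xi> w \<noteq> x0" for w by (simp add: \<xi>_def)
  have im: "\<xi> w \<notin> S" if "Re w < L" for w
    using \<delta>0 dist_\<xi> \<xi>_ne that by (auto simp: L_def)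
  have \<xi>_hol: "\<xi> holomorphic_on H" unfolding \<xi>_def by (intro holomorphic_intros)
  have "simply_connected H" unfolding H_def by (intro convex_imp_simply_connected convex_halfspace_Re_lt)
  moreover have "open H" by (simp add: H_def open_halfspace_Re_lt)
  moreover have "of_real (L - 1) \<in> H" by (simp add: H_def)
  then have "H \<noteq> {}" by blast
  moreover have "\<xi> \<in> H \<rightarrow> - S" using im by (auto simp: H_def)
  ultimately obtain Y where Y: "sheets p \<xi> H Y" using sheets_exist[OF un _ _ _ \<xi>_hol] by blast
  have ev: "eventually P F \<longleftrightarrow> (\<exists>b. \<forall>w. Re w < b \<longrightarrow> P w)" for P
    by (simp add: F_def eventually_filtercomap_at_bot_dense)
  have "F \<noteq> bot"
  proof -
    have "\<not> eventually (\<lambda>_. False) F"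
      unfolding ev by (metis Re_complex_of_real gt_ex lt_ex)
    then show ?thesis by (auto simp: eventually_bot)
  qed
  have \<xi>_lim: "(\<xi> \<longlongrightarrow> x0) F"
    by (rule tendstoI) (use dist_\<xi> in \<open>auto simp: ev\<close>)
  have ev_H: "\<forall>\<^sub>F w in F. w \<in> H" by (auto simp: ev H_def)
  have lim: "(\<exists>l. eval2 p x0 l = 0 \<and> (Y i \<longlongrightarrow> l) F) \<or> filterlim (Y i) at_infinity F" if "i < ?m" for i
  proof (rule sheet_limit[OF p0 \<delta>0(1), where N = "\<lambda>\<delta>. {w. Re w < ln \<delta>}" and \<xi> = \<xi>])
    fix \<delta> assume \<delta>: "0 < \<delta>" "\<delta> \<le> \<delta>0"
    show "connected {w. Re w < ln \<delta>}" by (intro convex_connected convex_halfspace_Re_lt)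
    have "ln \<delta> \<le> ln \<delta>0" using \<delta> by simp
    then show "{w. Re w < ln \<delta>} \<subseteq> {w. Re w < ln \<delta>0}" by auto
    show "\<forall>\<^sub>F w in F. w \<in> {w. Re w < ln \<delta>}" by (auto simp: ev)
    show "dist (\<xi> w) x0 < \<delta>" if "w \<in> {w. Re w < ln \<delta>}" for w using that dist_\<xi> \<delta> by simp
  qed (use sheets_continuous[OF Y that] sheets_root[OF Y that] in \<open>auto simp: H_def L_def\<close>)
  define J where "J = {i. i < ?m \<and> (\<exists>l. eval2 p x0 l = 0 \<and> (Y i \<longlongrightarrow> l) F)}"
  have "\<forall>i\<in>J. \<exists>l. eval2 p x0 l = 0 \<and> (Y i \<longlongrightarrow> l) F" by (simp add: J_def)
  then obtain l where l: "\<And>i. i \<in> J \<Longrightarrow> eval2 p x0 (l i) = 0" "\<And>i. i \<in> J \<Longrightarrow> (Y i \<longlongrightarrow> l i) F"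
    by metis
  have J: "finite J" "J \<subseteq> {..<?m}" by (auto simp: J_def)
  have infJ: "filterlim (Y i) at_infinity F" if "i \<in> {..<?m} - J" for i
    using lim[of i] that by (auto simp: J_def)
  obtain c where c: "c \<noteq> 0" "\<And>y. eval2 p x0 y = c * (\<Prod>i\<in>J. y - l i)"
  proof (rule slice_limit_factor[OF \<open>F \<noteq> bot\<close> \<xi>_lim p0 _ _ J(2) l(2) infJ])
    show "\<forall>\<^sub>F w in F. eval2 p (\<xi> w) y = poly (lead_coeff p) (\<xi> w) * (\<Prod>i\<in>{..<?m}. y - Y i w)" for y
      using ev_H by eventually_elim (rule sheets_factor[OF un Y], auto simp: H_def im)
  qed (use that in auto)
  have "poly (slice p x0) y = poly (smult c (\<Prod>i\<in>J. [:- l i, 1:])) y" for y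
    by (simp add: poly_slice c(2) poly_prod)
  then have slice_eq: "slice p x0 = smult c (\<Prod>i\<in>J. [:- l i, 1:])" by (simp add: poly_eq_poly_eq_iff[symmetric] fun_eq_iff)
  \<comment> \<open>The finite limits of the sheets are the roots over \<open>x0\<close> with
    multiplicity, so that a multiset of roots counts sheets.\<close>
  have proots_eq: "proots (slice p x0) = image_mset l (mset_set J)"
    unfolding slice_eq using c(1) by (simp add: proots_prod sum_unfold_sum_mset)
  define Bad where "Bad = {i\<in>J. eval2 f x0 (l i) \<noteq> 0}"
  let ?b = "size (filter_mset (\<lambda>y. eval2 f x0 y \<noteq> 0) (proots (slice p x0)))"
  have b: "?b = card Bad"
    unfolding proots_eq filter_mset_image_mset Bad_def using J(1)
    by (simp add: filter_mset_mset_set)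
  \<comment> \<open>A sheet gains a factor \<open>x - x0\<close> unless it ends at a point where
    \<open>f\<close> is nonzero; a sheet that escapes to infinity gains it by assumption.\<close>
  define e where "e i = (if i \<in> Bad then 0 else 1 :: nat)" for i
  have sum_e: "(\<Sum>i<?m. e i) = ?m - ?b"
  proof -
    have "Bad \<subseteq> {..<?m}" using J(2) by (auto simp: Bad_def)
    have "(\<Sum>i<?m. e i) = (\<Sum>i\<in>{..<?m} - Bad. 1)"
      by (intro sum.mono_neutral_cong_right) (auto simp: e_def)
    then show ?thesis using \<open>Bad \<subseteq> {..<?m}\<close> by (simp add: b card_Diff_subset finite_subset)
  qed
  have "\<exists>C\<ge>0. \<forall>\<^sub>F w in F. norm (eval2 f (\<xi> w) (Y i w)) \<le>
      C * norm (exp w) ^ e i * norm (eval2 ?fx (\<xi> w) (Y i w))" if i: "i < ?m" for i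
  proof -
    consider "i \<in> {..<?m} - J" | "i \<in> J" "i \<notin> Bad" | "i \<in> Bad" using i by (auto simp: Bad_def)
    then show ?thesis
    proof cases
      case 1
      have "i \<notin> Bad" using 1 by (auto simp: Bad_def)
      have "\<forall>\<^sub>F w in F. norm (Y i w) > M"
        using filterlim_at_infinity_imp_norm_at_top[OF infJ[OF 1]] by (simp add: filterlim_at_top_dense)
      moreover have "\<forall>\<^sub>F w in F. dist (\<xi> w) x0 < \<delta>'" using \<xi>_lim inf(1) tendstoD by blast
      ultimately have "\<forall>\<^sub>F w in F. norm (eval2 f (\<xi> w) (Y i w)) \<le>
          max 0 C' * norm (exp w) ^ e i * norm (eval2 ?fx (\<xi> w) (Y i w))"
        using ev_H
      proof eventually_elim
        case (elim w)
        have "norm (eval2 f (\<xi> w) (Y i w)) \<le> C' * norm (\<xi> w - x0) * norm (eval2 ?fx (\<xi> w) (Y i w))"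
          using inf(2)[OF \<xi>_ne elim(2,1) sheets_root[OF Y i elim(3)]] .
        also have "\<dots> \<le> max 0 C' * norm (exp w) * norm (eval2 ?fx (\<xi> w) (Y i w))"
          by (intro mult_right_mono) (auto simp: \<xi>_def)
        finally show ?case using \<open>i \<notin> Bad\<close> by (simp add: e_def)
      qed
      then show ?thesis by (intro exI[of _ "max 0 C'"]) auto
    next
      case 2
      define \<psi> where "\<psi> w = eval2 f (\<xi> w) (Y i w)" for w
      have Yi_hol: "Y i holomorphic_on H" using Y i by (auto simp: sheets_def)
      have \<psi>_hol: "\<psi> holomorphic_on {w. Re w < L}"
        using \<xi>_hol Yi_hol unfolding \<psi>_def H_def by (rule eval2_holomorphic)
      \<comment> \<open>On the polar curve the term with \<open>partial_y f\<close> drops out. The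
        factor \<open>exp w\<close>, which is \<open>x - x0\<close>, is the one that is
        gained.\<close>
      have deriv_\<psi>: "deriv \<psi> w = eval2 ?fx (\<xi> w) (Y i w) * exp w" if w: "w \<in> H" for w
      proof (rule DERIV_imp_deriv)
        have "(\<xi> has_field_derivative exp w) (at w)"
          unfolding \<xi>_def by (auto intro!: derivative_eq_intros)
        moreover have "(Y i has_field_derivative deriv (Y i) w) (at w)"
          by (rule holomorphic_derivI[OF Yi_hol \<open>open H\<close> w])
        ultimately have "(\<psi> has_field_derivative eval2 ?fx (\<xi> w) (Y i w) * exp w +
            eval2 (partial_y f) (\<xi> w) (Y i w) * deriv (Y i) w) (at w)"
          unfolding \<psi>_def by (rule eval2_has_derivative)
        then show "(\<psi> has_field_derivative eval2 ?fx (\<xi> w) (Y i w) * exp w) (at w)"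
          using polar[OF sheets_root[OF Y i w]] by simp
      qed
      obtain k where k: "k > 0" "\<And>w. Re w < L \<Longrightarrow> Y i (w + of_nat k * (2 * pi * \<i>)) = Y i w"
        using sheet_periodic[OF un Y[unfolded \<xi>_def H_def] i im[unfolded \<xi>_def]] by blast
      have "exp (w + of_nat k * (2 * pi * \<i>)) = exp w" for w
        using exp_integer_2pi[of "of_nat k"] by (simp add: exp_add mult_ac)
      then have per: "\<psi> (w + of_nat k * (2 * pi * \<i>)) = \<psi> w" if "Re w < L" for w
        using k(2)[OF that] by (simp add: \<psi>_def \<xi>_def)
      have "(\<psi> \<longlongrightarrow> eval2 f x0 (l i)) F"
        unfolding \<psi>_def by (intro eval2_tendsto \<xi>_lim l(2) 2)
      then have lim0: "(\<psi> \<longlongrightarrow> 0) (filtercomap Re at_bot)" using 2 by (simp add: Bad_def F_def)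
      have "\<exists>b C. b \<le> L \<and> C \<ge> 0 \<and> (\<forall>w. Re w < b \<longrightarrow> norm (\<psi> w) \<le> C * norm (deriv \<psi> w))"
        by (rule periodic_log_derivative[OF \<psi>_hol k(1) per lim0]; blast)
      then obtain b C where Cb: "b \<le> L" "C \<ge> 0" "\<And>w. Re w < b \<Longrightarrow> norm (\<psi> w) \<le> C * norm (deriv \<psi> w)"
        by blast
      have "norm (eval2 f (\<xi> w) (Y i w)) \<le> C * norm (exp w) ^ e i * norm (eval2 ?fx (\<xi> w) (Y i w))"
        if "Re w < b" for w
        using Cb(3)[OF that] deriv_\<psi>[of w] that Cb(1) 2(2) by (simp add: \<psi>_def H_def e_def norm_mult mult_ac)
      then have "\<forall>\<^sub>F w in F. norm (eval2 f (\<xi> w) (Y i w)) \<le> C * norm (exp w) ^ e i * norm (eval2 ?fx (\<xi> w) (Y i w))"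
        unfolding ev by blast
      with Cb(2) show ?thesis by blast
    next
      case 3
      \<comment> \<open>By \<open>crit\<close>, a point of the polar curve where \<open>f\<close> is
        nonzero is not critical, so \<open>partial_x f\<close> has a nonzero limit and the quotient
        stays bounded.\<close>
      then have "i \<in> J" "eval2 f x0 (l i) \<noteq> 0" by (auto simp: Bad_def)
      then have fx0: "eval2 ?fx x0 (l i) \<noteq> 0" using crit polar[OF l(1)] by blast
      define C where "C = (norm (eval2 f x0 (l i)) + 1) / (norm (eval2 ?fx x0 (l i)) / 2)"
      have "((\<lambda>w. norm (eval2 f (\<xi> w) (Y i w))) \<longlongrightarrow> norm (eval2 f x0 (l i))) F"
        by (intro tendsto_norm eval2_tendsto \<xi>_lim l(2) \<open>i \<in> J\<close>)
      then have "\<forall>\<^sub>F w in F. norm (eval2 f (\<xi> w) (Y i w)) < norm (eval2 f x0 (l i)) + 1"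
        by (rule order_tendstoD) simp
      moreover have "((\<lambda>w. norm (eval2 ?fx (\<xi> w) (Y i w))) \<longlongrightarrow> norm (eval2 ?fx x0 (l i))) F"
        by (intro tendsto_norm eval2_tendsto \<xi>_lim l(2) \<open>i \<in> J\<close>)
      then have "\<forall>\<^sub>F w in F. norm (eval2 ?fx (\<xi> w) (Y i w)) > norm (eval2 ?fx x0 (l i)) / 2"
        by (rule order_tendstoD) (use fx0 in simp)
      ultimately have "\<forall>\<^sub>F w in F. norm (eval2 f (\<xi> w) (Y i w)) \<le>
          C * norm (exp w) ^ e i * norm (eval2 ?fx (\<xi> w) (Y i w))"
      proof eventually_elim
        case (elim w)
        have "norm (eval2 f (\<xi> w) (Y i w)) \<le> C * (norm (eval2 ?fx x0 (l i)) / 2)"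
          using elim(1) fx0 by (simp add: C_def)
        also have "\<dots> \<le> C * norm (eval2 ?fx (\<xi> w) (Y i w))"
          using elim(2) by (intro mult_left_mono) (auto simp: C_def)
        finally show ?case using 3 by (simp add: e_def)
      qed
      then show ?thesis by (intro exI[of _ C]) (auto simp: C_def)
    qed
  qed
  then have "\<forall>i\<in>{..<?m}. \<exists>C. C \<ge> 0 \<and> (\<forall>\<^sub>F w in F. norm (eval2 f (\<xi> w) (Y i w)) \<le>
      C * norm (exp w) ^ e i * norm (eval2 ?fx (\<xi> w) (Y i w)))" by simp
  from bchoice[OF this] obtain C where C: "\<forall>i\<in>{..<?m}. C i \<ge> 0 \<and> (\<forall>\<^sub>F w in F. norm (eval2 f (\<xi> w) (Y i w)) \<le>
      C i * norm (exp w) ^ e i * norm (eval2 ?fx (\<xi> w) (Y i w)))" ..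
  have "\<forall>\<^sub>F w in F. \<forall>i\<in>{..<?m}. norm (eval2 f (\<xi> w) (Y i w)) \<le>
      C i * norm (exp w) ^ e i * norm (eval2 ?fx (\<xi> w) (Y i w))"
    using C by (intro eventually_ball_finite) auto
  then have "\<forall>\<^sub>F w in F. norm (fibre_prod p f (\<xi> w)) \<le>
      (\<Prod>i<?m. C i) * norm (exp w) ^ (?m - ?b) * norm (fibre_prod p ?fx (\<xi> w))"
    using ev_H
  proof eventually_elim
    case (elim w)
    have "\<xi> w \<notin> S" using elim(2) im by (simp add: H_def)
    note fp = sheets_prod[OF un Y elim(2) this]
    have "norm (fibre_prod p f (\<xi> w)) = (\<Prod>i<?m. norm (eval2 f (\<xi> w) (Y i w)))"
      unfolding fibre_prod_def fp by (simp add: prod_norm)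
    also have "\<dots> \<le> (\<Prod>i<?m. C i * norm (exp w) ^ e i * norm (eval2 ?fx (\<xi> w) (Y i w)))"
      using elim(1) by (intro prod_mono) auto
    also have "\<dots> = (\<Prod>i<?m. C i) * norm (exp w) ^ (\<Sum>i<?m. e i) * norm (fibre_prod p ?fx (\<xi> w))"
      unfolding fibre_prod_def fp by (simp add: prod.distrib prod_norm power_sum)
    finally show ?case by (simp add: sum_e)
  qed
  then obtain b where b: "\<And>w. Re w < b \<Longrightarrow> norm (fibre_prod p f (\<xi> w)) \<le>
      (\<Prod>i<?m. C i) * norm (exp w) ^ (?m - ?b) * norm (fibre_prod p ?fx (\<xi> w))"
    unfolding ev by blast
  show ?thesis
  proof (rule exI[of _ "\<Prod>i<?m. C i"], rule exI[of _ "min \<delta>0 (exp b)"], intro conjI[OF _ allI] impI)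
    fix x assume x: "x \<noteq> x0" "dist x x0 < min \<delta>0 (exp b)"
    let ?w = "Ln (x - x0)"
    have exp: "exp ?w = x - x0" using x(1) by simp
    have "exp (Re ?w) < exp b" using x(2) exp by (metis dist_norm min_less_iff_conj norm_exp_eq_Re)
    then have "Re ?w < b" by simp
    from b[OF this] show "x \<notin> S \<and> norm (fibre_prod p f x) \<le>
       (\<Prod>i<?m. C i) * norm (x - x0) ^ (?m - ?b) * norm (fibre_prod p ?fx x)"
      using \<delta>0(2)[OF x(1)] x(2) by (simp add: \<xi>_def exp)
  qed (use \<delta>0 in auto)
qed

text \<open>The local condition concerns only the branches of \<open>p = 0\<close> that run off to infinity; the
  other branches are dealt with by \<open>polar_local_estimate\<close>.\<close>

definition polar_control :: "bipoly \<Rightarrow> bipoly \<Rightarrow> bool" where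
  "polar_control f p \<longleftrightarrow> (\<forall>x0. slice p x0 \<noteq> 0) \<and>
     (\<forall>x y. eval2 p x y = 0 \<longrightarrow> eval2 (partial_y f) x y = 0) \<and>
     (\<exists>\<rho> C. \<forall>x y. norm x > \<rho> \<longrightarrow> eval2 p x y = 0 \<longrightarrow>
        eval2 f x y \<noteq> 0 \<and> norm (eval2 f x y) \<le> C * norm x * norm (eval2 (partial_x f) x y)) \<and>
     (\<forall>x0. \<exists>\<delta> M C. \<delta> > 0 \<and> (\<forall>x y. x \<noteq> x0 \<longrightarrow> dist x x0 < \<delta> \<longrightarrow> norm y > M \<longrightarrow> eval2 p x y = 0 \<longrightarrow>
        norm (eval2 f x y) \<le> C * norm (x - x0) * norm (eval2 (partial_x f) x y)))"

text \<open>These roots contribute no zero to the quotient of the two products. Roots lost to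
  infinity over \<open>x0\<close> are absent from the multiset: by the last condition of
  \<open>polar_control\<close> they gain a factor \<open>x - x0\<close> too, so
  \<open>degree p - bad_count f p x0\<close> includes them.\<close>

definition bad_count :: "bipoly \<Rightarrow> bipoly \<Rightarrow> complex \<Rightarrow> nat" where
  "bad_count f p x0 = size (filter_mset (\<lambda>y. eval2 f x0 y \<noteq> 0) (proots (slice p x0)))"

lemma bad_count_le: "bad_count f p x0 \<le> degree p"
  unfolding bad_count_def
  using size_filter_mset_lesseq[of "\<lambda>y. eval2 f x0 y \<noteq> 0" "proots (slice p x0)"]
    size_proots_le[of "slice p x0"] degree_slice_le[of p x0] by linarith

text \<open>The products of \<open>f\<close> and of \<open>partial_x f\<close> over the fibres of
  \<open>p\<close> are compared: at finite points by \<open>polar_local_estimate\<close>, and at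
  infinity by the \<open>degree p\<close> quotients, each of which is \<open>O(x)\<close>.\<close>

lemma polar_count_unramified:
  assumes un: "unramified_off p S" and pc: "polar_control f p" and "finite A"
    and crit: "\<And>x y. critical_point f x y \<Longrightarrow> eval2 f x y = 0"
  shows "(\<Sum>x0\<in>A. degree p - bad_count f p x0) \<le> degree p"
proof -
  let ?m = "degree p" and ?fx = "partial_x f" and ?a = "poly (lead_coeff p)"
  have S: "finite S" using un by (simp add: unramified_off_def)
  \<comment> \<open>One exponent for both \<open>f\<close> and \<open>partial_x f\<close>, so that
    the two products become polynomials with the same factor \<open>E\<close>, which cancels in
    every comparison.\<close>
  define N where "N = max (degree f) (degree ?fx)"
  define E where "E x = (\<Prod>s\<in>S. x - s) * ?a x ^ (N * ?m)" for x
  have E_ne: "E x \<noteq> 0" if "x \<notin> S" for x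
    using un that S by (auto simp: E_def unramified_off_def)
  obtain P1 where P1: "\<And>x. x \<notin> S \<Longrightarrow> poly P1 x = E x * fibre_prod p f x"
    using fibre_prod_polynomial[OF un, of f N] by (auto simp: N_def E_def mult.assoc)
  obtain P2 where P2: "\<And>x. x \<notin> S \<Longrightarrow> poly P2 x = E x * fibre_prod p ?fx x"
    using fibre_prod_polynomial[OF un, of ?fx N] by (auto simp: N_def E_def mult.assoc)
  obtain \<rho>' C where inf': "\<And>x y. norm x > \<rho>' \<Longrightarrow> eval2 p x y = 0 \<Longrightarrow> eval2 f x y \<noteq> 0"
      "\<And>x y. norm x > \<rho>' \<Longrightarrow> eval2 p x y = 0 \<Longrightarrow> norm (eval2 f x y) \<le> C * norm x * norm (eval2 ?fx x y)"
    using pc unfolding polar_control_def by blast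
  define \<rho> where "\<rho> = max \<rho>' (\<Sum>s\<in>S. norm s)"
  have \<rho>: "norm x > \<rho>'" "x \<notin> S" if "norm x > \<rho>" for x
  proof -
    show "norm x > \<rho>'" using that by (simp add: \<rho>_def)
    show "x \<notin> S"
      using that member_le_sum[of x S norm] S by (auto simp: \<rho>_def)
  qed
  define x1 :: complex where "x1 = of_real (\<bar>\<rho>\<bar> + 1)"
  have x1: "norm x1 > \<rho>" unfolding x1_def norm_of_real by linarith
  have fin: "finite {y. eval2 p x1 y = 0}" using card_roots_unramified[OF un \<rho>(2)[OF x1]] by blast
  have "fibre_prod p f x1 \<noteq> 0"
    using fin inf'(1)[OF \<rho>(1)[OF x1]] by (simp add: fibre_prod_def)
  then have "poly P1 x1 \<noteq> 0" using P1 E_ne \<rho>(2)[OF x1] by simp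
  then have P1_ne: "P1 \<noteq> 0" by auto
  have "eval2 ?fx x1 y \<noteq> 0" if "eval2 p x1 y = 0" for y
    using inf'[OF \<rho>(1)[OF x1] that] by auto
  then have "fibre_prod p ?fx x1 \<noteq> 0"
    using fin by (simp add: fibre_prod_def)
  then have "poly P2 x1 \<noteq> 0" using P2 E_ne \<rho>(2)[OF x1] by simp
  then have P2_ne: "P2 \<noteq> 0" by auto
  show ?thesis
  proof (rule sum_order_count[OF P1_ne P2_ne \<open>finite A\<close>])
    fix x0
    obtain \<delta>' M C' where inf: "\<delta>' > 0" "\<And>x y. x \<noteq> x0 \<Longrightarrow> dist x x0 < \<delta>' \<Longrightarrow> norm y > M \<Longrightarrow> eval2 p x y = 0 \<Longrightarrow>
        norm (eval2 f x y) \<le> C' * norm (x - x0) * norm (eval2 ?fx x y)"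
      using pc unfolding polar_control_def by meson
    have p0: "slice p x0 \<noteq> 0" and polar: "\<And>x y. eval2 p x y = 0 \<Longrightarrow> eval2 (partial_y f) x y = 0"
      using pc unfolding polar_control_def by blast+
    have crit0: "eval2 f x0 y = 0" if "eval2 ?fx x0 y = 0" "eval2 (partial_y f) x0 y = 0" for y
      using crit[of x0 y] that by (simp add: critical_point_def)
    have "\<exists>C \<delta>. \<delta> > 0 \<and> (\<forall>x. x \<noteq> x0 \<longrightarrow> dist x x0 < \<delta> \<longrightarrow> x \<notin> S \<and>
        norm (fibre_prod p f x) \<le> C * norm (x - x0) ^ (?m - bad_count f p x0) * norm (fibre_prod p ?fx x))"
      unfolding bad_count_def by (rule polar_local_estimate[OF un p0 polar crit0 inf])
    then obtain C \<delta> where "\<delta> > 0" and C: "\<And>x. x \<noteq> x0 \<Longrightarrow> dist x x0 < \<delta> \<Longrightarrow> x \<notin> S \<and>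
        norm (fibre_prod p f x) \<le> C * norm (x - x0) ^ (?m - bad_count f p x0) * norm (fibre_prod p ?fx x)"
      by blast
    have "norm (poly P1 x) \<le> C * norm (x - x0) ^ (?m - bad_count f p x0) * norm (poly P2 x)"
      if x: "x \<noteq> x0" "dist x x0 < \<delta>" for x
    proof -
      have "norm (E x) * norm (fibre_prod p f x) \<le>
          norm (E x) * (C * norm (x - x0) ^ (?m - bad_count f p x0) * norm (fibre_prod p ?fx x))"
        using C[OF x] by (intro mult_left_mono) auto
      then show ?thesis using C[OF x] by (simp add: P1 P2 norm_mult mult_ac)
    qed
    with \<open>\<delta> > 0\<close> show "\<exists>C \<delta>. \<delta> > 0 \<and> (\<forall>x. x \<noteq> x0 \<longrightarrow> dist x x0 < \<delta> \<longrightarrow>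
        norm (poly P1 x) \<le> C * norm (x - x0) ^ (?m - bad_count f p x0) * norm (poly P2 x))"
      by blast
  next
    fix x :: complex assume x: "norm x > \<rho>"
    note c = card_roots_unramified[OF un \<rho>(2)[OF x]]
    have "norm (fibre_prod p f x) = (\<Prod>y | eval2 p x y = 0. norm (eval2 f x y))"
      by (simp add: fibre_prod_def prod_norm)
    also have "\<dots> \<le> (\<Prod>y | eval2 p x y = 0. C * norm x * norm (eval2 ?fx x y))"
      using inf'(2)[OF \<rho>(1)[OF x]] by (intro prod_mono) auto
    also have "\<dots> = C ^ ?m * norm x ^ ?m * norm (fibre_prod p ?fx x)"
      using c by (simp add: prod.distrib fibre_prod_def prod_norm power_mult_distrib)
    finally have "norm (E x) * norm (fibre_prod p f x) \<le> norm (E x) * (C ^ ?m * norm x ^ ?m * norm (fibre_prod p ?fx x))"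
      by (intro mult_left_mono) auto
    then show "norm (poly P1 x) \<le> C ^ ?m * norm x ^ ?m * norm (poly P2 x)"
      using \<rho>(2)[OF x] by (simp add: P1 P2 norm_mult mult_ac)
  qed
qed

lemma polar_control_subset:
  assumes pc: "polar_control f p" and sub: "\<And>x y. eval2 q x y = 0 \<Longrightarrow> eval2 p x y = 0"
    and q0: "\<And>x0. slice q x0 \<noteq> 0"
  shows "polar_control f q"
  unfolding polar_control_def
proof (intro conjI allI impI)
  show "eval2 (partial_y f) x y = 0" if "eval2 q x y = 0" for x y
    using pc sub[OF that] by (simp add: polar_control_def)
next
  obtain \<rho> C where *: "\<forall>x y. norm x > \<rho> \<longrightarrow> eval2 p x y = 0 \<longrightarrow>
        eval2 f x y \<noteq> 0 \<and> norm (eval2 f x y) \<le> C * norm x * norm (eval2 (partial_x f) x y)"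
    using pc unfolding polar_control_def by blast
  show "\<exists>\<rho> C. \<forall>x y. norm x > \<rho> \<longrightarrow> eval2 q x y = 0 \<longrightarrow>
        eval2 f x y \<noteq> 0 \<and> norm (eval2 f x y) \<le> C * norm x * norm (eval2 (partial_x f) x y)"
    by (rule exI[of _ \<rho>], rule exI[of _ C]) (use * sub in blast)
next
  fix x0
  obtain \<delta> M C where *: "\<delta> > 0" "\<forall>x y. x \<noteq> x0 \<longrightarrow> dist x x0 < \<delta> \<longrightarrow> norm y > M \<longrightarrow> eval2 p x y = 0 \<longrightarrow>
        norm (eval2 f x y) \<le> C * norm (x - x0) * norm (eval2 (partial_x f) x y)"
    using pc unfolding polar_control_def by blast
  show "\<exists>\<delta> M C. \<delta> > 0 \<and> (\<forall>x y. x \<noteq> x0 \<longrightarrow> dist x x0 < \<delta> \<longrightarrow> norm y > M \<longrightarrow> eval2 q x y = 0 \<longrightarrow>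
        norm (eval2 f x y) \<le> C * norm (x - x0) * norm (eval2 (partial_x f) x y))"
    by (rule exI[of _ \<delta>], rule exI[of _ M], rule exI[of _ C]) (use * sub in blast)
qed (use q0 in auto)

text \<open>A polar curve with multiple components has no fibres of simple roots. Since
  \<open>degree\<close> and \<open>bad_count\<close> are additive over factors, the bound is summed
  over the prime factors of \<open>p\<close>.\<close>

theorem polar_count:
  assumes "polar_control f p" "finite A"
    and crit: "\<And>x y. critical_point f x y \<Longrightarrow> eval2 f x y = 0"
  shows "(\<Sum>x0\<in>A. degree p - bad_count f p x0) \<le> degree p"
  using assms(1)
proof (induction p rule: prime_divisors_induct)
  case zero
  then show ?case by (simp add: polar_control_def)
next
  case (unit p)
  then obtain c where "p = [:c:]" using is_unit_poly_iff[of p] by blast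
  then show ?case by simp
next
  case (factor q r)
  have qr: "slice (q * r) x0 \<noteq> 0" for x0 using factor.prems by (simp add: polar_control_def)
  then have q0: "slice q x0 \<noteq> 0" and r0: "slice r x0 \<noteq> 0" for x0 by (auto simp: slice_mult)
  have "q \<noteq> 0" "r \<noteq> 0" using q0[of 0] r0[of 0] by auto
  have pcq: "polar_control f q"
    by (rule polar_control_subset[OF factor.prems _ q0]) (simp add: eval2_mult)
  have pcr: "polar_control f r"
    by (rule polar_control_subset[OF factor.prems _ r0]) (simp add: eval2_mult)
  \<comment> \<open>A prime factor free of \<open>y\<close> would vanish on a vertical line, against
    \<open>q0\<close>.\<close>
  have "degree q > 0"
  proof (rule ccontr)
    assume "\<not> ?thesis"
    then obtain c where c: "q = [:c:]" by (auto elim: degree_eq_zeroE)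
    have "poly c x \<noteq> 0" for x using q0[of x] by (auto simp: c slice_pCons)
    then have "degree c = 0"
      using fundamental_theorem_of_algebra[of c] constant_degree[of c] by blast
    then obtain k where "c = [:k:]" by (auto elim: degree_eq_zeroE)
    then have "is_unit q" using \<open>q \<noteq> 0\<close> by (simp add: c is_unit_const_poly_iff dvd_field_iff)
    then show False using factor.hyps by auto
  qed
  obtain a b c where "c \<noteq> 0" "a * q + b * pderiv q = [:c:]"
    by (rule prime_bezout_pderiv[OF factor.hyps \<open>degree q > 0\<close>]) (rule that)
  then obtain S where un: "unramified_off q S"
    using unramified_off_bezout \<open>degree q > 0\<close> by blast
  have deg: "degree (q * r) = degree q + degree r"
    using \<open>q \<noteq> 0\<close> \<open>r \<noteq> 0\<close> by (rule degree_mult_eq)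
  have "bad_count f (q * r) x0 = bad_count f q x0 + bad_count f r x0" for x0
    using qr[of x0] by (simp add: bad_count_def slice_mult proots_mult)
  then have "degree (q * r) - bad_count f (q * r) x0 =
      (degree q - bad_count f q x0) + (degree r - bad_count f r x0)" for x0
    using bad_count_le[of f q x0] bad_count_le[of f r x0] by (simp add: deg)
  then have "(\<Sum>x0\<in>A. degree (q * r) - bad_count f (q * r) x0) =
      (\<Sum>x0\<in>A. degree q - bad_count f q x0) + (\<Sum>x0\<in>A. degree r - bad_count f r x0)"
    by (simp add: sum.distrib)
  also have "\<dots> \<le> degree (q * r)"
    using polar_count_unramified[OF un pcq assms(2) crit] factor.IH[OF pcr] by (simp add: deg)
  finally show ?case .
qed

subsection \<open>Separating the branches in a slit plane\<close>

text \<open>Adding an edge identifies at most two classes, so a graph with \<open>card E\<close>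
  edges keeps at least \<open>card I - card E\<close> of them; \<open>c\<close> labels the
  classes.\<close>

lemma merge_edges:
  assumes "finite I" "finite E" "E \<subseteq> I \<times> I"
  shows "\<exists>c :: 'a \<Rightarrow> 'a. (\<forall>(u, v)\<in>E. c u = c v) \<and> card I \<le> card (c ` I) + card E"
  using assms(2,3)
proof (induction E rule: finite_induct)
  case empty
  show ?case by (intro exI[of _ id]) simp
next
  case (insert e E)
  then obtain c :: "'a \<Rightarrow> 'a" where c: "\<forall>(u, v)\<in>E. c u = c v" "card I \<le> card (c ` I) + card E"
    by auto
  obtain u v where e: "e = (u, v)" by fastforce
  define c' where "c' z = (if c z = c u then c v else c z)" for z
  have "c ` I \<subseteq> insert (c u) (c' ` I)" by (auto simp: c'_def)
  then have "card (c ` I) \<le> card (insert (c u) (c' ` I))"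
    using assms(1) by (intro card_mono) auto
  also have "\<dots> \<le> Suc (card (c' ` I))" by (rule card_insert_le_m1) simp_all
  finally have "card I \<le> card (c' ` I) + card (insert e E)" using c(2) insert.hyps by simp
  moreover have "\<forall>(u, v)\<in>insert e E. c' u = c' v" using c(1) by (auto simp: c'_def e)
  ultimately show ?case by (intro exI[of _ c'] conjI)
qed

text \<open>At each \<open>b\<close> the members of a block with equal value are tied to one
  representative, which takes \<open>card I\<close> minus the number of blocks edges. At most
  \<open>card I - 2\<close> edges in all leave two classes, and \<open>K\<close> is one of
  them.\<close>

lemma disconnected_of_few_merges:
  fixes \<Lambda> :: "'b \<Rightarrow> 'a \<Rightarrow> 'c"
  assumes I: "finite I" and B: "finite B" and few: "(\<Sum>b\<in>B. card I - card (\<Lambda> b ` I)) + 2 \<le> card I"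
  obtains K where "K \<subseteq> I" "K \<noteq> {}" "K \<noteq> I" "\<And>b i k. b \<in> B \<Longrightarrow> i \<in> K \<Longrightarrow> k \<in> I - K \<Longrightarrow> \<Lambda> b i \<noteq> \<Lambda> b k"
proof -
  define r where "r b i = (SOME j. j \<in> I \<and> \<Lambda> b j = \<Lambda> b i)" for b i
  have r: "r b i \<in> I" "\<Lambda> b (r b i) = \<Lambda> b i" if "i \<in> I" for b i
    using someI[of "\<lambda>j. j \<in> I \<and> \<Lambda> b j = \<Lambda> b i" i] that by (auto simp: r_def)
  have r_cong: "r b i = r b j" if "\<Lambda> b i = \<Lambda> b j" for b i j using that by (simp add: r_def)
  define E where "E b = (\<lambda>i. (i, r b i)) ` (I - r b ` I)" for b
  have "card (r b ` I) = card (\<Lambda> b ` I)" for b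
  proof -
    have im: "\<Lambda> b ` r b ` I = \<Lambda> b ` I" using r(2) by (simp add: image_image)
    have "inj_on (\<Lambda> b) (r b ` I)"
    proof (rule inj_onI)
      fix x y assume xy: "x \<in> r b ` I" "y \<in> r b ` I" "\<Lambda> b x = \<Lambda> b y"
      then obtain i j where "i \<in> I" "x = r b i" "j \<in> I" "y = r b j" by blast
      then have "\<Lambda> b i = \<Lambda> b j" using xy(3) r(2) by simp
      then show "x = y" using \<open>x = r b i\<close> \<open>y = r b j\<close> r_cong[of b i j] by simp
    qed
    from card_image[OF this] show ?thesis by (simp only: im)
  qed
  note cr = this
  have rI: "r b ` I \<subseteq> I" for b using r(1) by auto
  have cE: "card (E b) \<le> card I - card (\<Lambda> b ` I)" for b
  proof -
    have "card (E b) \<le> card (I - r b ` I)" unfolding E_def by (rule card_image_le) (use I in simp)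
    also have "\<dots> = card I - card (r b ` I)" by (rule card_Diff_subset) (use I rI in auto)
    finally show ?thesis by (simp only: cr)
  qed
  have "card (\<Union>b\<in>B. E b) \<le> (\<Sum>b\<in>B. card (E b))" using B by (rule card_UN_le)
  also have "\<dots> \<le> (\<Sum>b\<in>B. card I - card (\<Lambda> b ` I))" by (intro sum_mono cE)
  finally have few': "card (\<Union>b\<in>B. E b) + 2 \<le> card I" using few by linarith
  have "(\<Union>b\<in>B. E b) \<subseteq> I \<times> I" using r(1) by (auto simp: E_def)
  moreover have "finite (\<Union>b\<in>B. E b)" using I B by (auto simp: E_def)
  ultimately have "\<exists>c :: 'a \<Rightarrow> 'a. (\<forall>(u, v)\<in>(\<Union>b\<in>B. E b). c u = c v) \<and> card I \<le> card (c ` I) + card (\<Union>b\<in>B. E b)"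
    by (intro merge_edges I)
  then obtain c :: "'a \<Rightarrow> 'a" where c: "\<forall>(u, v)\<in>(\<Union>b\<in>B. E b). c u = c v" "card I \<le> card (c ` I) + card (\<Union>b\<in>B. E b)"
    by (elim exE conjE)
  have c2: "card (c ` I) \<ge> 2" using few' c(2) by linarith
  then have "c ` I \<noteq> {}" by auto
  then obtain i0 where i0: "i0 \<in> I" by blast
  define K where "K = {i\<in>I. c i = c i0}"
  have c_r: "c i = c (r b i)" if "b \<in> B" "i \<in> I" for b i
  proof (cases "i \<in> r b ` I")
    case True
    then obtain j where "j \<in> I" "i = r b j" by blast
    then have "\<Lambda> b i = \<Lambda> b j" using r(2) by simp
    then have "r b i = i" using r_cong[of b i j] \<open>i = r b j\<close> by simp
    then show ?thesis by simp
  next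
    case False
    then have "(i, r b i) \<in> (\<Union>b\<in>B. E b)" using that by (auto simp: E_def)
    from bspec[OF c(1) this] show ?thesis by simp
  qed
  have "K \<noteq> I"
  proof
    assume "K = I"
    then have "c ` I \<subseteq> {c i0}" by (auto simp: K_def)
    then have "card (c ` I) \<le> card {c i0}" by (rule card_mono[rotated]) simp
    then show False using c2 by simp
  qed
  moreover have "\<Lambda> b i \<noteq> \<Lambda> b k" if "b \<in> B" "i \<in> K" "k \<in> I - K" for b i k
  proof
    assume "\<Lambda> b i = \<Lambda> b k"
    then have "r b i = r b k" by (rule r_cong)
    then have "c i = c k" using c_r[of b i] c_r[of b k] that by (auto simp: K_def)
    then show False using that by (auto simp: K_def)
  qed
  moreover have "K \<subseteq> I" "K \<noteq> {}" using i0 by (auto simp: K_def)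
  ultimately show ?thesis by (intro that[of K])
qed

text \<open>Liouville's theorem with removable singularities: after multiplication by the factors
  \<open>x - s\<close>, the decay makes \<open>E\<close> a polynomial of degree below
  \<open>card B\<close>, yet it vanishes on all of \<open>B\<close>.\<close>

lemma holomorphic_off_finite_decay:
  assumes B: "finite B" "B \<noteq> {}" and hol: "G holomorphic_on - B"
    and near: "\<And>s. s \<in> B \<Longrightarrow> \<exists>C \<delta>. \<delta> > 0 \<and> (\<forall>x. x \<notin> B \<longrightarrow> dist x s < \<delta> \<longrightarrow> norm (G x) \<le> C)"
    and inf: "\<And>x. x \<notin> B \<Longrightarrow> norm x > \<rho> \<Longrightarrow> norm (G x) \<le> C0 / norm x"
    and x: "x \<notin> B"
  shows "G x = 0"
proof -
  define E where "E x = (if x \<in> B then 0 else (\<Prod>s\<in>B. x - s) * G x)" for x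
  obtain m where m: "card B = Suc m" using B by (cases "card B") auto
  have "E holomorphic_on UNIV"
  proof (rule no_isolated_singularity'[of B])
    fix z assume z: "z \<in> B"
    obtain C \<delta> where C: "\<delta> > 0" "\<And>x. x \<notin> B \<Longrightarrow> dist x z < \<delta> \<Longrightarrow> norm (G x) \<le> C"
      using near[OF z] by blast
    have "((\<lambda>x. norm (\<Prod>s\<in>B. x - s) * max 0 C) \<longlongrightarrow> norm (\<Prod>s\<in>B. z - s) * max 0 C) (at z)"
      by (intro tendsto_intros)
    moreover have "(\<Prod>s\<in>B. z - s) = 0" using z B by (auto simp: prod_zero_iff)
    ultimately have lim0: "((\<lambda>x. norm (\<Prod>s\<in>B. x - s) * max 0 C) \<longlongrightarrow> 0) (at z)" by simp
    have bd: "norm (E x) \<le> norm (\<Prod>s\<in>B. x - s) * max 0 C" if "dist x z < \<delta>" for x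
    proof (cases "x \<in> B")
      case False
      have "norm (G x) \<le> max 0 C" using C(2)[OF False that] by simp
      then show ?thesis using False by (simp add: E_def norm_mult mult_left_mono)
    qed (simp add: E_def)
    have "\<forall>\<^sub>F x in at z. dist x z < \<delta>" using C(1) by (auto simp: eventually_at)
    then have "\<forall>\<^sub>F x in at z. norm (E x) \<le> norm (\<Prod>s\<in>B. x - s) * max 0 C"
      by eventually_elim (rule bd)
    then have "(E \<longlongrightarrow> 0) (at z)" by (rule Lim_null_comparison[OF _ lim0])
    then show "(E \<longlongrightarrow> E z) (at z within UNIV)" using z by (simp add: E_def)
  next
    have "(\<lambda>x. (\<Prod>s\<in>B. x - s) * G x) holomorphic_on - B"
      by (intro holomorphic_intros hol)
    then show "E holomorphic_on UNIV - B"
      unfolding Compl_eq_Diff_UNIV by (rule holomorphic_transform) (simp add: E_def)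
  qed (use B in auto)
  define A where "A = max 1 (max (\<rho> + 1) (\<Sum>s\<in>B. norm s + 1))"
  define D where "D = (\<Prod>s\<in>B. 1 + norm s) * C0"
  have "norm (E z) \<le> D * norm z ^ m" if z: "A \<le> norm z" for z
  proof -
    have z1: "norm z \<ge> 1" "norm z > \<rho>" using z by (auto simp: A_def)
    have "z \<notin> B"
    proof
      assume "z \<in> B"
      then have "norm z + 1 \<le> (\<Sum>s\<in>B. norm s + 1)" using B by (intro member_le_sum) auto
      then show False using z by (simp add: A_def)
    qed
    have "norm (\<Prod>s\<in>B. z - s) = (\<Prod>s\<in>B. norm (z - s))" by (simp add: prod_norm)
    also have "\<dots> \<le> (\<Prod>s\<in>B. (1 + norm s) * norm z)"
    proof (intro prod_mono conjI norm_ge_zero)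
      fix s :: complex
      have "norm s \<le> norm s * norm z" using z1 by (simp add: mult_le_cancel_left1)
      then show "norm (z - s) \<le> (1 + norm s) * norm z"
        using norm_triangle_ineq4[of z s] by (simp add: algebra_simps)
    qed
    finally have "norm (\<Prod>s\<in>B. z - s) \<le> (\<Prod>s\<in>B. 1 + norm s) * norm z ^ Suc m"
      by (simp only: prod.distrib prod_constant m)
    then have "norm (\<Prod>s\<in>B. z - s) * norm (G z) \<le> (\<Prod>s\<in>B. 1 + norm s) * norm z ^ Suc m * (C0 / norm z)"
      using inf[OF \<open>z \<notin> B\<close> z1(2)] by (intro mult_mono mult_nonneg_nonneg prod_nonneg) auto
    also have "\<dots> = D * norm z ^ m" using z1 by (auto simp: D_def)
    finally show ?thesis using \<open>z \<notin> B\<close> by (simp add: E_def norm_mult)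
  qed
  then have E_eq: "E z = (\<Sum>j\<le>m. (deriv ^^ j) E 0 / fact j * z ^ j)" for z
    by (rule Liouville_polynomial[OF \<open>E holomorphic_on UNIV\<close>])
  define P where "P = (\<Sum>j\<le>m. monom ((deriv ^^ j) E 0 / fact j) j)"
  have P: "poly P z = E z" for z
    unfolding P_def E_eq[of z] by (simp add: poly_sum poly_monom)
  have "degree P \<le> m"
    unfolding P_def by (intro degree_sum_le) (auto intro: order_trans[OF degree_monom_le])
  have "P = 0"
  proof (rule ccontr)
    assume "P \<noteq> 0"
    have "B \<subseteq> {z. poly P z = 0}" using P by (auto simp: E_def)
    then have "card B \<le> card {z. poly P z = 0}" using \<open>P \<noteq> 0\<close> by (intro card_mono poly_roots_finite)
    also have "\<dots> \<le> degree P" using \<open>P \<noteq> 0\<close> by (rule card_poly_roots_bound)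
    finally show False using \<open>degree P \<le> m\<close> m by simp
  qed
  then have "E x = 0" using P by (metis poly_0)
  moreover have "(\<Prod>s\<in>B. x - s) \<noteq> 0" using x B by auto
  ultimately show ?thesis using x by (simp add: E_def)
qed

text \<open>Every point of \<open>D\<close> is a limit point of \<open>\<Omega>\<close>, so the
  limit along \<open>\<Omega>\<close> is a definition free of choices. Each local extension equals
  it, and hence they agree with one another.\<close>

lemma holomorphic_glue:
  assumes dense: "\<And>x. x \<in> D \<Longrightarrow> at x within \<Omega> \<noteq> bot"
    and loc: "\<And>x. x \<in> D \<Longrightarrow> \<exists>V h. open V \<and> x \<in> V \<and> V \<subseteq> D \<and> h holomorphic_on V \<and> (\<forall>z\<in>V \<inter> \<Omega>. h z = G z)"
    and sub: "\<Omega> \<subseteq> D"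
  obtains \<Phi> where "\<Phi> holomorphic_on D" "\<And>x. x \<in> \<Omega> \<Longrightarrow> \<Phi> x = G x"
proof -
  define \<Phi> where "\<Phi> x = Lim (at x within \<Omega>) G" for x
  have \<Phi>_eq: "\<Phi> x = h x" if V: "open V" "x \<in> V" "V \<subseteq> D" "h holomorphic_on V" "\<forall>z\<in>V \<inter> \<Omega>. h z = G z" for x V h
    unfolding \<Phi>_def
  proof (rule tendsto_Lim)
    show "at x within \<Omega> \<noteq> bot" using V(2,3) by (intro dense) auto
    have "isCont h x"
      using V(1,2) holomorphic_on_imp_continuous_on[OF V(4)] by (simp add: continuous_on_eq_continuous_at)
    then have "(h \<longlongrightarrow> h x) (at x within \<Omega>)" unfolding isCont_def by (rule tendsto_within_subset) simp
    moreover have "\<forall>\<^sub>F z in at x within \<Omega>. h z = G z"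
      unfolding eventually_at_topological by (rule exI[of _ V]) (use V(1,2,5) in simp)
    ultimately show "(G \<longlongrightarrow> h x) (at x within \<Omega>)" by (rule Lim_transform_eventually)
  qed
  have "\<exists>V. open V \<and> x \<in> V \<and> \<Phi> holomorphic_on V" if x: "x \<in> D" for x
  proof -
    obtain V h where V: "open V" "x \<in> V" "V \<subseteq> D" "h holomorphic_on V" "\<forall>z\<in>V \<inter> \<Omega>. h z = G z"
      using loc[OF x] by (elim exE conjE)
    have "\<Phi> holomorphic_on V"
      by (rule holomorphic_transform[OF V(4)]) (use \<Phi>_eq[OF V(1) _ V(3,4,5)] in auto)
    then show ?thesis using V(1,2) by blast
  qed
  then have "\<Phi> field_differentiable (at x within D)" if "x \<in> D" for x
    using that by (meson holomorphic_on_imp_differentiable_at field_differentiable_at_within)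
  then have "\<Phi> holomorphic_on D" by (simp add: holomorphic_on_def)
  moreover have "\<Phi> x = G x" if x: "x \<in> \<Omega>" for x
  proof -
    have "x \<in> D" using sub x by blast
    from loc[OF this] obtain V h where V: "open V" "x \<in> V" "V \<subseteq> D" "h holomorphic_on V" "\<forall>z\<in>V \<inter> \<Omega>. h z = G z"
      by (elim exE conjE)
    then show ?thesis using \<Phi>_eq[OF V] x by simp
  qed
  ultimately show ?thesis by (rule that)
qed

text \<open>Convergence in the Riemann sphere: \<^term>\<open>None\<close> stands for the point at infinity.\<close>

definition tends :: "('a \<Rightarrow> complex) \<Rightarrow> 'a filter \<Rightarrow> complex option \<Rightarrow> bool" where
  "tends Y F l \<longleftrightarrow> (case l of Some a \<Rightarrow> (Y \<longlongrightarrow> a) F | None \<Rightarrow> filterlim Y at_infinity F)"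

lemma tends_unique:
  assumes "F \<noteq> bot" "tends Y F l" "tends Y F l'"
  shows "l = l'"
proof (cases l; cases l')
  fix a b assume "l = Some a" "l' = Some b"
  then show ?thesis using assms tendsto_unique[OF assms(1)] by (simp add: tends_def)
next
  fix a assume "l = Some a" "l' = None"
  then show ?thesis
    using assms not_tendsto_and_filterlim_at_infinity[OF assms(1), of Y a] by (simp add: tends_def)
next
  fix a assume "l = None" "l' = Some a"
  then show ?thesis
    using assms not_tendsto_and_filterlim_at_infinity[OF assms(1), of Y a] by (simp add: tends_def)
qed simp

lemma tends_mono:
  assumes "tends Y F l" "F' \<le> F"
  shows "tends Y F' l"
proof (cases l)
  case None
  then show ?thesis using assms filterlim_mono[OF _ order_refl assms(2)] by (simp add: tends_def)
next
  case (Some a)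
  then show ?thesis using assms tendsto_mono[OF assms(2)] by (simp add: tends_def)
qed

lemma tends_cong:
  assumes "\<forall>\<^sub>F x in F. Y x = Z x"
  shows "tends Y F l \<longleftrightarrow> tends Z F l"
  by (cases l) (simp_all add: tends_def filterlim_cong[OF refl refl assms])

lemma convex_affine_less:
  fixes g :: "'a::real_vector \<Rightarrow> real"
  assumes "\<And>x y u v. u + v = 1 \<Longrightarrow> g (u *\<^sub>R x + v *\<^sub>R y) = u * g x + v * g y"
  shows "convex {z. g z < 0}"
  unfolding convex_def using assms convex_bound_lt[of _ 0] by auto

text \<open>The lines through two points of \<open>B\<close> have measure zero. Seen from a point
  off all of them, distinct points of \<open>B\<close> lie in different directions, so the slits
  along these directions are disjoint.\<close>

lemma exists_non_collinear_point:
  assumes "finite (B :: complex set)"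
  obtains b0 where "b0 \<notin> B"
    "\<And>s s'. s \<in> B \<Longrightarrow> s' \<in> B \<Longrightarrow> s \<noteq> s' \<Longrightarrow> Im ((s' - b0) / (s - b0)) \<noteq> 0"
proof -
  define N where "N = B \<union> (\<Union>(s, s')\<in>{(s, s') \<in> B \<times> B. s \<noteq> s'}. {b. inner (\<i> * (s' - s)) b = - Im (s' * cnj s)})"
  have "finite {(s, s') \<in> B \<times> B. s \<noteq> s'}"
    by (rule finite_subset[of _ "B \<times> B"]) (use assms in auto)
  then have *: "negligible (\<Union>(s, s')\<in>{(s, s') \<in> B \<times> B. s \<noteq> s'}. {b. inner (\<i> * (s' - s)) b = - Im (s' * cnj s)})"
  proof (intro negligible_Union finite_imageI)
    fix T assume "T \<in> (\<lambda>(s, s'). {b. inner (\<i> * (s' - s)) b = - Im (s' * cnj s)}) ` {(s, s') \<in> B \<times> B. s \<noteq> s'}"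
    then obtain s s' where "s \<noteq> s'" "T = {b. inner (\<i> * (s' - s)) b = - Im (s' * cnj s)}" by blast
    then show "negligible T" by (simp add: negligible_hyperplane)
  qed
  have "negligible N"
    unfolding N_def by (rule negligible_Un[OF negligible_finite[OF assms] *])
  then have "N \<noteq> UNIV" using non_negligible_UNIV by auto
  then obtain b0 where b0: "b0 \<notin> N" by blast
  have "Im ((s' - b0) / (s - b0)) \<noteq> 0" if s: "s \<in> B" "s' \<in> B" "s \<noteq> s'" for s s'
  proof
    assume "Im ((s' - b0) / (s - b0)) = 0"
    moreover have "s - b0 \<noteq> 0" using b0 s by (auto simp: N_def)
    ultimately have "Im (s' - b0) * Re (s - b0) - Re (s' - b0) * Im (s - b0) = 0"
      by (auto simp: Im_divide complex_eq_iff power2_eq_square sum_power2_eq_zero_iff)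
    then have "inner (\<i> * (s' - s)) b0 = - Im (s' * cnj s)"
      by (simp add: inner_complex_def algebra_simps)
    then show False using b0 s by (auto simp: N_def)
  qed
  then show ?thesis using that b0 by (auto simp: N_def)
qed

section \<open>The plane slit outwards from each branch point\<close>

locale slit_plane =
  fixes B :: "complex set" and b0 :: complex
  assumes finite_B: "finite B" and b0_notin: "b0 \<notin> B"
    and non_collinear: "\<And>s s'. s \<in> B \<Longrightarrow> s' \<in> B \<Longrightarrow> s \<noteq> s' \<Longrightarrow> Im ((s' - b0) / (s - b0)) \<noteq> 0"
begin

text \<open>The affine coordinate with \<open>b0\<close> at 0 and \<open>s\<close> at 1, in which
  the slit of \<open>s\<close> is the real half-line from 1 to infinity.\<close>

definition q :: "complex \<Rightarrow> complex \<Rightarrow> complex" where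
  "q s z = (z - b0) / (s - b0)"

definition ray :: "complex \<Rightarrow> complex set" where
  "ray s = {z. Im (q s z) = 0 \<and> Re (q s z) \<ge> 1}"

definition \<Omega> :: "complex set" where
  "\<Omega> = - (\<Union>s\<in>B. ray s)"

text \<open>An open convex wedge around the slit with apex \<open>s\<close>, the apex excluded.
  Being simply connected and free of branch points for small \<open>\<kappa>\<close>, it carries
  sheets that extend across the slit.\<close>

definition cone :: "real \<Rightarrow> complex \<Rightarrow> complex set" where
  "cone \<kappa> s = {z. \<bar>Im (q s z)\<bar> < \<kappa> * (Re (q s z) - 1)}"

lemma q_self: "s \<in> B \<Longrightarrow> q s s = 1"
  using b0_notin by (auto simp: q_def)

lemma q_change: "s' \<in> B \<Longrightarrow> q s z = q s' z * q s s'"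
  using b0_notin by (auto simp: q_def)

lemma q_affine: "u + v = 1 \<Longrightarrow> q s (u *\<^sub>R x + v *\<^sub>R y) = u *\<^sub>R q s x + v *\<^sub>R q s y"
proof -
  assume "u + v = 1"
  then have "(u *\<^sub>R x + v *\<^sub>R y) - b0 = u *\<^sub>R (x - b0) + v *\<^sub>R (y - b0)"
    by (simp add: algebra_simps flip: scaleR_add_left)
  then show ?thesis by (simp add: q_def add_divide_distrib scaleR_conv_of_real)
qed

lemma q_point: "s \<in> B \<Longrightarrow> q s (b0 + (s - b0) * \<zeta>) = \<zeta>"
  using b0_notin by (auto simp: q_def)

lemma continuous_q: "continuous_on A (q s)"
proof -
  have "q s = (\<lambda>z. (z - b0) * inverse (s - b0))" by (auto simp: q_def divide_inverse)
  then show ?thesis by (auto intro!: continuous_intros)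
qed

lemma closed_ray: "closed (ray s)"
  unfolding ray_def
  by (intro closed_Collect_conj closed_Collect_eq closed_Collect_le continuous_intros continuous_q)

lemma open_\<Omega>: "open \<Omega>"
  unfolding \<Omega>_def using finite_B closed_ray by (intro open_Compl closed_UN) auto

lemma b0_in_\<Omega>: "b0 \<in> \<Omega>"
  by (auto simp: \<Omega>_def ray_def q_def)

lemma starlike_\<Omega>: "starlike \<Omega>"
  unfolding starlike_def
proof (intro bexI[OF _ b0_in_\<Omega>] ballI subsetI)
  fix z w assume z: "z \<in> \<Omega>" and "w \<in> closed_segment b0 z"
  then obtain u where u: "0 \<le> u" "u \<le> 1" "w = (1 - u) *\<^sub>R b0 + u *\<^sub>R z"
    by (auto simp: in_segment)
  have qw: "q s w = u *\<^sub>R q s z" for s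
    using q_affine[of "1 - u" u s b0 z] u by (simp add: q_def)
  show "w \<in> \<Omega>"
  proof (rule ccontr)
    assume "w \<notin> \<Omega>"
    then obtain s where s: "s \<in> B" "u * Im (q s z) = 0" "u * Re (q s z) \<ge> 1"
      by (auto simp: \<Omega>_def ray_def qw)
    then have "u > 0" using u(1) by (cases "u = 0") auto
    then have "Im (q s z) = 0" using s(2) by simp
    moreover have "Re (q s z) > 0" using s(3) \<open>u > 0\<close> by (smt (verit) mult_nonneg_nonpos)
    then have "u * Re (q s z) \<le> Re (q s z)" using u by (simp add: mult_le_cancel_right1)
    then have "Re (q s z) \<ge> 1" using s(3) by linarith
    ultimately show False using z s(1) by (auto simp: \<Omega>_def ray_def)
  qed
qed

lemma simply_connected_\<Omega>: "simply_connected \<Omega>"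
  using starlike_\<Omega> starlike_imp_simply_connected by blast

lemma \<Omega>_disjoint_B: "\<Omega> \<inter> B = {}"
proof -
  have "s \<in> ray s" if "s \<in> B" for s using q_self[OF that] by (simp add: ray_def)
  then show ?thesis by (auto simp: \<Omega>_def)
qed

lemma convex_cone: "convex (cone \<kappa> s)"
proof -
  have "cone \<kappa> s = {z. Im (q s z) - \<kappa> * (Re (q s z) - 1) < 0} \<inter> {z. - Im (q s z) - \<kappa> * (Re (q s z) - 1) < 0}"
    by (auto simp: cone_def abs_less_iff)
  moreover have "convex {z. Im (q s z) - \<kappa> * (Re (q s z) - 1) < 0}"
  proof (rule convex_affine_less)
    fix x y u v assume uv: "u + v = (1 :: real)"
    have R: "Re (q s (u *\<^sub>R x + v *\<^sub>R y)) - 1 = u * (Re (q s x) - 1) + v * (Re (q s y) - 1)"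
      unfolding q_affine[OF uv] using uv by (simp add: algebra_simps)
    show "Im (q s (u *\<^sub>R x + v *\<^sub>R y)) - \<kappa> * (Re (q s (u *\<^sub>R x + v *\<^sub>R y)) - 1) =
        u * (Im (q s x) - \<kappa> * (Re (q s x) - 1)) + v * (Im (q s y) - \<kappa> * (Re (q s y) - 1))"
      unfolding R unfolding q_affine[OF uv] by (simp add: algebra_simps)
  qed
  moreover have "convex {z. - Im (q s z) - \<kappa> * (Re (q s z) - 1) < 0}"
  proof (rule convex_affine_less)
    fix x y u v assume uv: "u + v = (1 :: real)"
    have R: "Re (q s (u *\<^sub>R x + v *\<^sub>R y)) - 1 = u * (Re (q s x) - 1) + v * (Re (q s y) - 1)"
      unfolding q_affine[OF uv] using uv by (simp add: algebra_simps)
    show "- Im (q s (u *\<^sub>R x + v *\<^sub>R y)) - \<kappa> * (Re (q s (u *\<^sub>R x + v *\<^sub>R y)) - 1) =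
        u * (- Im (q s x) - \<kappa> * (Re (q s x) - 1)) + v * (- Im (q s y) - \<kappa> * (Re (q s y) - 1))"
      unfolding R unfolding q_affine[OF uv] by (simp add: algebra_simps)
  qed
  ultimately show ?thesis by (simp add: convex_Int)
qed

lemma convex_half: "convex {z. Im (q s z) > 0}" "convex {z. Im (q s z) < 0}"
proof -
  have "convex {z. - Im (q s z) < 0}"
    by (rule convex_affine_less) (simp add: q_affine)
  then show "convex {z. Im (q s z) > 0}" by simp
  show "convex {z. Im (q s z) < 0}"
    by (rule convex_affine_less) (simp add: q_affine)
qed

lemma open_cone: "open (cone \<kappa> s)"
  unfolding cone_def by (intro open_Collect_less continuous_intros continuous_q)

lemma ray_disjoint: "s \<in> B \<Longrightarrow> s' \<in> B \<Longrightarrow> s \<noteq> s' \<Longrightarrow> z \<in> ray s \<Longrightarrow> z \<notin> ray s'"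
proof
  assume s: "s \<in> B" "s' \<in> B" "s \<noteq> s'" and z: "z \<in> ray s" "z \<in> ray s'"
  have "Im (q s z) = Re (q s' z) * Im (q s s')"
    using z by (subst q_change[OF s(2)]) (simp add: ray_def)
  then have "Im (q s s') = 0" using z by (auto simp: ray_def)
  then show False using non_collinear[OF s] by (simp add: q_def)
qed

text \<open>A point of the ray of \<open>s'\<close> has coordinate \<open>t * q s s'\<close>
  relative to \<open>s\<close>, with \<open>t \<ge> 1\<close>; where it lies to the right of the
  apex 1, its slope seen from there is at least \<open>g (s, s')\<close>. The minimum over all pairs
  is a safe aperture.\<close>

lemma exists_aperture:
  obtains \<kappa> where "\<kappa> > 0"
    "\<And>s s'. s \<in> B \<Longrightarrow> s' \<in> B \<Longrightarrow> s \<noteq> s' \<Longrightarrow> cone \<kappa> s \<inter> ray s' = {}"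
proof -
  define g where "g = (\<lambda>(s, s'). \<bar>Im (q s s')\<bar> / (\<bar>Re (q s s')\<bar> + 1))"
  define D where "D = insert 1 (g ` {(s, s') \<in> B \<times> B. s \<noteq> s'})"
  have "finite {(s, s') \<in> B \<times> B. s \<noteq> s'}"
    by (rule finite_subset[of _ "B \<times> B"]) (use finite_B in auto)
  then have D: "finite D" "D \<noteq> {}" by (auto simp: D_def)
  have pos: "d > 0" if "d \<in> D" for d
    using that non_collinear by (auto simp: D_def g_def q_def intro!: divide_pos_pos)
  define \<kappa> where "\<kappa> = Min D"
  have "\<kappa> > 0" using D pos by (simp add: \<kappa>_def)
  moreover have "cone \<kappa> s \<inter> ray s' = {}" if s: "s \<in> B" "s' \<in> B" "s \<noteq> s'" for s s'
  proof (rule ccontr)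
    assume "\<not> ?thesis"
    then obtain z where z: "z \<in> cone \<kappa> s" "z \<in> ray s'" by blast
    define t where "t = Re (q s' z)"
    have t: "t \<ge> 1" "q s' z = of_real t" using z(2) by (auto simp: ray_def t_def complex_eq_iff)
    have qz: "q s z = of_real t * q s s'" using q_change[OF s(2), of s z] t(2) by simp
    have "\<kappa> \<le> g (s, s')" unfolding \<kappa>_def using s D by (intro Min_le) (auto simp: D_def)
    then have "\<kappa> * (\<bar>Re (q s s')\<bar> + 1) \<le> \<bar>Im (q s s')\<bar>"
      by (simp add: g_def pos_le_divide_eq)
    then have "t * (\<kappa> * (\<bar>Re (q s s')\<bar> + 1)) \<le> t * \<bar>Im (q s s')\<bar>"
      using t(1) by (intro mult_left_mono) auto
    also have "t * \<bar>Im (q s s')\<bar> < \<kappa> * (t * Re (q s s') - 1)"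
      using z(1) t(1) by (simp add: cone_def qz abs_mult)
    also have "\<dots> \<le> t * (\<kappa> * (\<bar>Re (q s s')\<bar> + 1))"
    proof -
      have "t * Re (q s s') - 1 \<le> t * (\<bar>Re (q s s')\<bar> + 1)"
      proof -
        have "t * Re (q s s') \<le> t * \<bar>Re (q s s')\<bar>" using t(1) by (intro mult_left_mono) auto
        then show ?thesis using t(1) unfolding distrib_left by linarith
      qed
      then show ?thesis using \<open>\<kappa> > 0\<close> mult_left_mono[of _ _ \<kappa>] by (simp add: mult.left_commute)
    qed
    finally show False by simp
  qed
  ultimately show ?thesis by (rule that)
qed

text \<open>Density of the slit plane: a point of a slit is moved across it by
  \<open>\<i> * \<tau>\<close> in the coordinate \<open>q s\<close>, so little that no other slit is
  met.\<close>

lemma at_within_\<Omega>: "at z within \<Omega> \<noteq> bot"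
proof (cases "z \<in> \<Omega>")
  case True
  then show ?thesis by (simp add: at_within_open[OF True open_\<Omega>])
next
  case False
  then obtain s where s: "s \<in> B" "z \<in> ray s" by (auto simp: \<Omega>_def)
  define W where "W = - (\<Union>s'\<in>B - {s}. ray s')"
  have W: "open W" "z \<in> W"
    unfolding W_def using finite_B closed_ray ray_disjoint[OF s(1) _ _ s(2)]
    by (auto intro!: open_Compl closed_UN)
  have "z islimpt \<Omega>"
    unfolding islimpt_approachable
  proof (intro allI impI)
    fix e :: real assume "e > 0"
    obtain e' where e': "e' > 0" "ball z e' \<subseteq> W" using W open_contains_ball by blast
    define m where "m = min e e' / 2"
    have m: "m > 0" "m < e" "m < e'" using \<open>e > 0\<close> e'(1) by (auto simp: m_def)
    define \<tau> where "\<tau> = m / norm (s - b0)"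
    have sb: "s - b0 \<noteq> 0" using s b0_notin by auto
    define z' where "z' = z + (s - b0) * (\<i> * \<tau>)"
    have "\<tau> > 0" using m sb by (simp add: \<tau>_def)
    then have "dist z' z = norm (s - b0) * \<tau>"
      by (simp add: z'_def dist_norm norm_mult)
    then have "dist z' z = m" using sb by (simp add: \<tau>_def)
    then have d: "dist z' z < e" "dist z' z < e'" using m by auto
    have "q s z' = q s z + (s - b0) * (\<i> * \<tau>) / (s - b0)"
      by (simp add: z'_def q_def diff_divide_distrib add_divide_distrib)
    then have "q s z' = q s z + \<i> * \<tau>" using sb by simp
    then have "Im (q s z') \<noteq> 0" using s(2) \<open>\<tau> > 0\<close> by (simp add: ray_def)
    then have "z' \<notin> ray s" by (simp add: ray_def)
    moreover have "z' \<in> W" using d(2) e'(2) by (auto simp: dist_commute)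
    ultimately have "z' \<in> \<Omega>" by (auto simp: \<Omega>_def W_def)
    moreover from this have "z' \<noteq> z" using False by auto
    ultimately show "\<exists>x'\<in>\<Omega>. x' \<noteq> z \<and> dist x' z < e" using d(1) by (intro bexI[of _ z'] conjI)
  qed
  then show ?thesis by (simp add: trivial_limit_within)
qed

lemma cone_\<Omega>:
  assumes "s \<in> B" "\<And>s'. s' \<in> B \<Longrightarrow> s \<noteq> s' \<Longrightarrow> cone \<kappa> s \<inter> ray s' = {}" "z \<in> cone \<kappa> s"
  shows "z \<in> \<Omega> \<longleftrightarrow> Im (q s z) \<noteq> 0 \<or> Re (q s z) < 1"
  using assms by (fastforce simp: \<Omega>_def ray_def)

lemma at_within_half_cone:
  assumes s: "s \<in> B" and "\<kappa> > 0" and \<sigma>: "\<sigma> = 1 \<or> \<sigma> = -1"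
  shows "at s within (cone \<kappa> s \<inter> {z. \<sigma> * Im (q s z) > 0}) \<noteq> bot"
proof -
  have sb: "s - b0 \<noteq> 0" using s b0_notin by auto
  have "s islimpt (cone \<kappa> s \<inter> {z. \<sigma> * Im (q s z) > 0})"
    unfolding islimpt_approachable
  proof (intro allI impI)
    fix e :: real assume "e > 0"
    define c where "c = Complex 1 (\<sigma> * \<kappa> / 2)"
    have c: "norm c > 0" by (simp add: c_def complex_eq_iff)
    define \<tau> where "\<tau> = e / 2 / (norm (s - b0) * norm c)"
    have \<tau>: "\<tau> > 0" using \<open>e > 0\<close> sb c by (auto simp: \<tau>_def)
    define z where "z = b0 + (s - b0) * (1 + \<tau> * c)"
    have qz: "q s z = 1 + \<tau> * c" unfolding z_def by (rule q_point[OF s])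
    have "z - s = (s - b0) * (\<tau> * c)" by (simp add: z_def algebra_simps)
    then have "norm (z - s) = norm (s - b0) * \<tau> * norm c" using \<tau> by (simp add: norm_mult)
    then have "dist z s = e / 2" using sb c by (simp add: dist_norm \<tau>_def)
    then have "dist z s < e" using \<open>e > 0\<close> by simp
    moreover have "z \<noteq> s" using \<open>dist z s = e / 2\<close> \<open>e > 0\<close> by auto
    moreover have "z \<in> cone \<kappa> s" using \<sigma> \<tau> \<open>\<kappa> > 0\<close> by (auto simp: cone_def qz c_def abs_mult)
    moreover have "\<sigma> * Im (q s z) > 0" using \<sigma> \<tau> \<open>\<kappa> > 0\<close> by (auto simp: qz c_def)
    ultimately show "\<exists>x'\<in>cone \<kappa> s \<inter> {z. \<sigma> * Im (q s z) > 0}. x' \<noteq> s \<and> dist x' s < e" by blast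
  qed
  then show ?thesis by (simp add: trivial_limit_within)
qed

lemma \<Omega>_ball_connected:
  assumes s: "s \<in> B"
  obtains \<delta>0 where "\<delta>0 > 0" "\<And>\<delta>. 0 < \<delta> \<Longrightarrow> \<delta> \<le> \<delta>0 \<Longrightarrow> connected (\<Omega> \<inter> ball s \<delta>)"
proof -
  have sb: "s - b0 \<noteq> 0" using s b0_notin by auto
  define W where "W = - (\<Union>s'\<in>B - {s}. ray s')"
  have "s \<in> ray s" using q_self[OF s] by (simp add: ray_def)
  then have W: "open W" "s \<in> W"
    unfolding W_def using finite_B closed_ray ray_disjoint[OF s]
    by (auto intro!: open_Compl closed_UN)
  then obtain \<delta>0 where \<delta>0: "\<delta>0 > 0" "ball s \<delta>0 \<subseteq> W" using open_contains_ball by blast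
  have "connected (\<Omega> \<inter> ball s \<delta>)" if \<delta>: "0 < \<delta>" "\<delta> \<le> \<delta>0" for \<delta>
  proof (rule starlike_imp_connected)
    have eq: "\<Omega> \<inter> ball s \<delta> = ball s \<delta> - ray s"
    proof -
      have "ball s \<delta> \<subseteq> W" using \<delta>0(2) \<delta> by (meson order_trans subset_ball)
      then show ?thesis using s by (auto simp: \<Omega>_def W_def)
    qed
    define \<epsilon> where "\<epsilon> = \<delta> / 2 / norm (s - b0)"
    have \<epsilon>: "\<epsilon> > 0" using \<delta> sb by (simp add: \<epsilon>_def)
    \<comment> \<open>A point of the disc on the line of the slit, on the other side of the tip. The
      disc without the slit is star-shaped about it.\<close>
    define c where "c = b0 + (s - b0) * of_real (1 - \<epsilon>)"
    have qc: "q s c = of_real (1 - \<epsilon>)" unfolding c_def by (rule q_point[OF s])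
    have "s - c = (s - b0) * of_real \<epsilon>" by (simp add: c_def algebra_simps)
    then have "norm (s - c) = norm (s - b0) * \<epsilon>" using \<epsilon> by (simp add: norm_mult)
    then have "norm (s - c) = \<delta> / 2" using sb by (simp add: \<epsilon>_def)
    then have "c \<in> ball s \<delta>" using \<delta> by (simp add: dist_norm)
    moreover have "c \<notin> ray s" using \<epsilon> by (simp add: ray_def qc)
    ultimately have c: "c \<in> ball s \<delta> - ray s" by blast
    show "starlike (\<Omega> \<inter> ball s \<delta>)"
      unfolding starlike_def eq
    proof (intro bexI[OF _ c] ballI subsetI)
      fix z w assume z: "z \<in> ball s \<delta> - ray s" and "w \<in> closed_segment c z"
      then obtain u where u: "0 \<le> u" "u \<le> 1" "w = (1 - u) *\<^sub>R c + u *\<^sub>R z"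
        by (auto simp: in_segment)
      have "closed_segment c z \<subseteq> ball s \<delta>"
        using c z by (intro closed_segment_subset convex_ball) auto
      moreover have "w \<notin> ray s"
      proof
        assume w: "w \<in> ray s"
        have "q s w = (1 - u) *\<^sub>R q s c + u *\<^sub>R q s z"
          unfolding u(3) by (rule q_affine) simp
        then have I: "u * Im (q s z) = 0" and R: "(1 - u) * (1 - \<epsilon>) + u * Re (q s z) \<ge> 1"
          using w by (auto simp: ray_def qc)
        have "u \<noteq> 0" using R \<epsilon> by auto
        then have "u > 0" using u by simp
        have "(1 - u) * (1 - \<epsilon>) \<le> 1 - u" using u \<epsilon> by (simp add: mult_left_le)
        then have "u \<le> u * Re (q s z)" using R by linarith
        then have "Re (q s z) \<ge> 1" using \<open>u > 0\<close> by simp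
        moreover have "Im (q s z) = 0" using I \<open>u \<noteq> 0\<close> by simp
        ultimately show False using z by (simp add: ray_def)
      qed
      ultimately show "w \<in> ball s \<delta> - ray s" using \<open>w \<in> closed_segment c z\<close> by blast
    qed
  qed
  with \<delta>0(1) show ?thesis by (rule that)
qed

lemma cone_disjoint_B:
  assumes "s \<in> B" "\<And>s'. s' \<in> B \<Longrightarrow> s \<noteq> s' \<Longrightarrow> cone \<kappa> s \<inter> ray s' = {}"
  shows "cone \<kappa> s \<inter> B = {}"
proof -
  have "s' \<notin> cone \<kappa> s" if "s' \<in> B" for s'
  proof (cases "s' = s")
    case True
    then show ?thesis using q_self[OF assms(1)] by (simp add: cone_def)
  next
    case False
    then show ?thesis using assms(2)[of s'] q_self[OF that] that by (auto simp: ray_def)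
  qed
  then show ?thesis by blast
qed

lemma not_\<Omega>_in_cone:
  assumes "\<kappa> > 0" "z \<notin> B" "z \<notin> \<Omega>"
  obtains s where "s \<in> B" "z \<in> cone \<kappa> s"
proof -
  obtain s where s: "s \<in> B" "Im (q s z) = 0" "Re (q s z) \<ge> 1" using assms by (auto simp: \<Omega>_def ray_def)
  have "Re (q s z) \<noteq> 1"
  proof
    assume "Re (q s z) = 1"
    then have "q s z = 1" using s by (simp add: complex_eq_iff)
    moreover have "s - b0 \<noteq> 0" using s b0_notin by auto
    ultimately have "z = s" by (simp add: q_def)
    then show False using s assms by simp
  qed
  then have "z \<in> cone \<kappa> s" using s assms by (simp add: cone_def)
  with s(1) show ?thesis by (rule that)
qed

end

lemma sheet_limits_factor:
  assumes un: "unramified_off f B" and Y: "sheets f (\<lambda>x. x) U Y" and UB: "U \<inter> B = {}"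
    and s: "at s within U \<noteq> bot" "slice f s \<noteq> 0"
    and L: "\<And>i. i < degree f \<Longrightarrow> tends (Y i) (at s within U) (\<Lambda> i)"
  defines "J \<equiv> {i. i < degree f \<and> \<Lambda> i \<noteq> None}"
  obtains c where "c \<noteq> 0"
    "((\<lambda>x. poly (lead_coeff f) x * (\<Prod>k\<in>{..<degree f} - J. - Y k x)) \<longlongrightarrow> c) (at s within U)"
    "\<And>y. eval2 f s y = c * (\<Prod>i\<in>J. y - the (\<Lambda> i))"
proof -
  have fac: "\<forall>\<^sub>F w in at s within U. eval2 f w y = poly (lead_coeff f) w * (\<Prod>i<degree f. y - Y i w)" for y
  proof -
    have "\<forall>\<^sub>F w in at s within U. w \<in> U" by (simp add: eventually_at_filter)
    then show ?thesis
    proof eventually_elim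
      case (elim w)
      then have "w \<notin> B" using UB by blast
      then show ?case using sheets_factor[OF un Y elim] by simp
    qed
  qed
  have J: "J \<subseteq> {..<degree f}" by (auto simp: J_def)
  have fin: "(Y i \<longlongrightarrow> the (\<Lambda> i)) (at s within U)" if "i \<in> J" for i
    using L[of i] that by (auto simp: J_def tends_def)
  have inf: "filterlim (Y i) at_infinity (at s within U)" if "i \<in> {..<degree f} - J" for i
    using L[of i] that by (auto simp: J_def tends_def)
  have "\<exists>c. c \<noteq> 0 \<and> ((\<lambda>x. poly (lead_coeff f) x * (\<Prod>k\<in>{..<degree f} - J. - Y k x)) \<longlongrightarrow> c) (at s within U) \<and>
      (\<forall>y. eval2 f s y = c * (\<Prod>i\<in>J. y - the (\<Lambda> i)))"
    by (rule slice_limit_factor[OF s(1) tendsto_ident_at s(2) fac finite_lessThan J fin inf]; blast)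
  then show ?thesis using that by blast
qed

lemma sheets_inj: "sheets f \<xi> U Y \<Longrightarrow> x \<in> U \<Longrightarrow> i < degree f \<Longrightarrow> j < degree f \<Longrightarrow> Y i x = Y j x \<longleftrightarrow> i = j"
  by (auto simp: sheets_def bij_betw_def inj_on_def)

lemma holomorphic_inverse_difference_product:
  assumes Y: "sheets f (\<lambda>x. x) U Y" and K: "K \<subseteq> {..<degree f}" and xs: "xs \<notin> U"
  shows "(\<lambda>x. 1 / ((x - xs) ^ m * (\<Prod>i\<in>K. \<Prod>k\<in>{..<degree f} - K. Y i x - Y k x))) holomorphic_on U"
proof (intro holomorphic_intros)
  fix i assume "i \<in> K"
  then show "Y i holomorphic_on U" using Y K by (auto simp: sheets_def)
next
  fix k assume "k \<in> {..<degree f} - K"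
  then show "Y k holomorphic_on U" using Y K by (auto simp: sheets_def)
next
  fix x assume x: "x \<in> U"
  have "Y i x - Y k x \<noteq> 0" if "i \<in> K" "k \<in> {..<degree f} - K" for i k
    using sheets_inj[OF Y x, of i k] that K by auto
  moreover have "finite K" using K finite_subset by blast
  ultimately show "(x - xs) ^ m * (\<Prod>i\<in>K. \<Prod>k\<in>{..<degree f} - K. Y i x - Y k x) \<noteq> 0"
    using xs x by auto
qed

context slit_plane
begin

lemma limits_along_\<Omega>:
  assumes un: "unramified_off f B" and Y: "sheets f (\<lambda>x. x) \<Omega> Y" and s: "s \<in> B" "slice f s \<noteq> 0" and i: "i < degree f"
  shows "\<exists>l. tends (Y i) (at s within \<Omega>) l"
proof -
  obtain \<delta>0 where \<delta>0: "\<delta>0 > 0" "\<And>\<delta>. 0 < \<delta> \<Longrightarrow> \<delta> \<le> \<delta>0 \<Longrightarrow> connected (\<Omega> \<inter> ball s \<delta>)"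
    by (rule \<Omega>_ball_connected[OF s(1)]) (rule that)
  have "(\<exists>l. eval2 f s l = 0 \<and> (Y i \<longlongrightarrow> l) (at s within \<Omega>)) \<or> filterlim (Y i) at_infinity (at s within \<Omega>)"
  proof (rule sheet_limit[OF s(2) \<delta>0(1), where N = "\<lambda>\<delta>. \<Omega> \<inter> ball s \<delta>" and \<xi> = "\<lambda>x. x"])
    fix \<delta> assume \<delta>: "0 < \<delta>" "\<delta> \<le> \<delta>0"
    show "connected (\<Omega> \<inter> ball s \<delta>)" by (rule \<delta>0(2)[OF \<delta>])
    show "\<Omega> \<inter> ball s \<delta> \<subseteq> \<Omega> \<inter> ball s \<delta>0" using \<delta> by auto
    show "\<forall>\<^sub>F w in at s within \<Omega>. w \<in> \<Omega> \<inter> ball s \<delta>"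
      using \<delta> by (auto simp: eventually_at dist_commute)
    show "dist w s < \<delta>" if "w \<in> \<Omega> \<inter> ball s \<delta>" for w using that by (simp add: dist_commute)
  next
    show "continuous_on (\<Omega> \<inter> ball s \<delta>0) (Y i)"
      using sheets_continuous[OF Y i] by (rule continuous_on_subset) blast
    show "eval2 f w (Y i w) = 0" if "w \<in> \<Omega> \<inter> ball s \<delta>0" for w
      using sheets_root[OF Y i] that by blast
  qed
  then show ?thesis
  proof
    assume "\<exists>l. eval2 f s l = 0 \<and> (Y i \<longlongrightarrow> l) (at s within \<Omega>)"
    then obtain l where "(Y i \<longlongrightarrow> l) (at s within \<Omega>)" by blast
    then show ?thesis by (intro exI[of _ "Some l"]) (simp add: tends_def)
  next
    assume "filterlim (Y i) at_infinity (at s within \<Omega>)"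
    then show ?thesis by (intro exI[of _ None]) (simp add: tends_def)
  qed
qed

lemma limits_along_cone:
  assumes X: "sheets f (\<lambda>x. x) (cone \<kappa> s) X" and s: "slice f s \<noteq> 0" and i: "i < degree f"
  shows "\<exists>l. tends (X i) (at s within cone \<kappa> s) l"
proof -
  have "(\<exists>l. eval2 f s l = 0 \<and> (X i \<longlongrightarrow> l) (at s within cone \<kappa> s)) \<or> filterlim (X i) at_infinity (at s within cone \<kappa> s)"
  proof (rule sheet_limit[OF s zero_less_one, where N = "\<lambda>\<delta>. cone \<kappa> s \<inter> ball s \<delta>" and \<xi> = "\<lambda>x. x"])
    fix \<delta> :: real assume \<delta>: "0 < \<delta>" "\<delta> \<le> 1"
    show "connected (cone \<kappa> s \<inter> ball s \<delta>)" by (intro convex_connected convex_Int convex_cone convex_ball)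
    show "cone \<kappa> s \<inter> ball s \<delta> \<subseteq> cone \<kappa> s \<inter> ball s 1" using \<delta> by auto
    show "\<forall>\<^sub>F w in at s within cone \<kappa> s. w \<in> cone \<kappa> s \<inter> ball s \<delta>"
      using \<delta> by (auto simp: eventually_at dist_commute)
    show "dist w s < \<delta>" if "w \<in> cone \<kappa> s \<inter> ball s \<delta>" for w using that by (simp add: dist_commute)
  next
    show "continuous_on (cone \<kappa> s \<inter> ball s 1) (X i)"
      using sheets_continuous[OF X i] by (rule continuous_on_subset) blast
    show "eval2 f w (X i w) = 0" if "w \<in> cone \<kappa> s \<inter> ball s 1" for w
      using sheets_root[OF X i] that by blast
  qed
  then show ?thesis
  proof
    assume "\<exists>l. eval2 f s l = 0 \<and> (X i \<longlongrightarrow> l) (at s within cone \<kappa> s)"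
    then obtain l where "(X i \<longlongrightarrow> l) (at s within cone \<kappa> s)" by blast
    then show ?thesis by (intro exI[of _ "Some l"]) (simp add: tends_def)
  next
    assume "filterlim (X i) at_infinity (at s within cone \<kappa> s)"
    then show ?thesis by (intro exI[of _ None]) (simp add: tends_def)
  qed
qed

text \<open>Crossing a slit permutes the sheets, but only within the blocks of sheets that come together
  at the tip of the slit; a union of blocks is therefore preserved.\<close>

lemma cross_slit:
  assumes un: "unramified_off f B" and Y: "sheets f (\<lambda>x. x) \<Omega> Y" and p0: "slice f s \<noteq> 0"
    and s: "s \<in> B" and \<kappa>: "\<kappa> > 0" "\<And>s'. s' \<in> B \<Longrightarrow> s \<noteq> s' \<Longrightarrow> cone \<kappa> s \<inter> ray s' = {}"
    and \<Lambda>: "\<And>i. i < degree f \<Longrightarrow> tends (Y i) (at s within \<Omega>) (\<Lambda> i)"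
    and K: "K \<subseteq> {..<degree f}" "\<And>i k. i \<in> K \<Longrightarrow> k \<in> {..<degree f} - K \<Longrightarrow> \<Lambda> i \<noteq> \<Lambda> k"
  obtains X A where "sheets f (\<lambda>x. x) (cone \<kappa> s) X" "A \<subseteq> {..<degree f}"
    "\<And>x. x \<in> cone \<kappa> s \<inter> \<Omega> \<Longrightarrow> (\<Prod>a\<in>A. \<Prod>b\<in>{..<degree f} - A. X a x - X b x) =
       (\<Prod>i\<in>K. \<Prod>k\<in>{..<degree f} - K. Y i x - Y k x)"
proof -
  let ?V = "cone \<kappa> s" and ?I = "{..<degree f}"
  have VB: "?V \<inter> B = {}" by (rule cone_disjoint_B[OF s \<kappa>(2)])
  have "at s within ?V \<inter> {z. 1 * Im (q s z) > 0} \<noteq> bot" by (rule at_within_half_cone[OF s \<kappa>(1)]) simp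
  then have "?V \<noteq> {}" by auto
  moreover have "(\<lambda>x. x) \<in> ?V \<rightarrow> - B" using VB by auto
  ultimately obtain X where X: "sheets f (\<lambda>x. x) ?V X"
    using sheets_exist[OF un open_cone convex_imp_simply_connected[OF convex_cone] _ holomorphic_on_ident] by metis
  have "\<forall>a\<in>?I. \<exists>l. tends (X a) (at s within ?V) l" using limits_along_cone[OF X p0] by simp
  from bchoice[OF this] obtain \<nu> where \<nu>: "\<forall>a\<in>?I. tends (X a) (at s within ?V) (\<nu> a)" ..
  \<comment> \<open>The class \<open>K\<close> is recognised by its limits at \<open>s\<close>
    alone, and these are the same on both sides of the slit.\<close>
  define A where "A = {a\<in>?I. \<nu> a \<in> \<Lambda> ` K}"
  have A: "A \<subseteq> ?I" by (auto simp: A_def)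
  \<comment> \<open>On one half of the cone the sheets \<open>X\<close> are the sheets
    \<open>Y\<close> in another order \<open>\<pi>\<close>. This order may depend on the half, but
    it preserves limits, so it takes \<open>A\<close> onto \<open>K\<close> in either case.\<close>
  have half: "(\<Prod>a\<in>A. \<Prod>b\<in>?I - A. X a x - X b x) = (\<Prod>i\<in>K. \<Prod>k\<in>?I - K. Y i x - Y k x)"
    if \<sigma>: "\<sigma> = 1 \<or> \<sigma> = -1" and x: "x \<in> ?V \<inter> {z. \<sigma> * Im (q s z) > 0}" for \<sigma> :: real and x
  proof -
    define C where "C = ?V \<inter> {z. \<sigma> * Im (q s z) > 0}"
    have Cne: "at s within C \<noteq> bot" unfolding C_def by (rule at_within_half_cone[OF s \<kappa>(1) \<sigma>])
    have "convex {z. \<sigma> * Im (q s z) > 0}" using \<sigma> convex_half[of s] by auto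
    then have "connected C" unfolding C_def by (intro convex_connected convex_Int convex_cone)
    have CV: "C \<subseteq> ?V" by (auto simp: C_def)
    have C\<Omega>: "C \<subseteq> \<Omega>"
    proof
      fix z assume z: "z \<in> C"
      then have "Im (q s z) \<noteq> 0" by (auto simp: C_def)
      then show "z \<in> \<Omega>" using cone_\<Omega>[OF s \<kappa>(2), of z] z by (auto simp: C_def)
    qed
    have xC: "x \<in> C" using x by (simp add: C_def)
    have bX: "bij_betw (\<lambda>a. X a z) ?I {y. eval2 f z y = 0}" if "z \<in> C" for z
      using X CV that by (auto simp: sheets_def)
    have bY: "bij_betw (\<lambda>i. Y i z) ?I {y. eval2 f z y = 0}" if "z \<in> C" for z
      using Y C\<Omega> that by (auto simp: sheets_def)
    have "\<forall>a\<in>?I. \<exists>i. i \<in> ?I \<and> Y i x = X a x"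
      using bX[OF xC] bY[OF xC] unfolding bij_betw_def by (metis (no_types, lifting) imageE imageI)
    from bchoice[OF this] obtain \<pi> where \<pi>: "\<forall>a\<in>?I. \<pi> a \<in> ?I \<and> Y (\<pi> a) x = X a x" ..
    have eq: "X a z = Y (\<pi> a) z" if "a \<in> ?I" "z \<in> C" for a z
    proof (rule sheet_unique[OF un \<open>connected C\<close>, of "\<lambda>x. x" "X a" "Y (\<pi> a)" x])
      show "continuous_on C (X a)"
        using sheets_continuous[OF X, of a] that CV continuous_on_subset by blast
      show "continuous_on C (Y (\<pi> a))"
        using sheets_continuous[OF Y, of "\<pi> a"] that C\<Omega> \<pi> continuous_on_subset by blast
      show "eval2 f w (X a w) = 0" if "w \<in> C" for w
        using sheets_root[OF X, of a w] \<open>a \<in> ?I\<close> CV that by auto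
      show "eval2 f w (Y (\<pi> a) w) = 0" if "w \<in> C" for w
        using sheets_root[OF Y, of "\<pi> a" w] \<open>a \<in> ?I\<close> \<pi> C\<Omega> that by auto
      show "(\<lambda>x. x) \<in> C \<rightarrow> - B" using CV VB by auto
      show "X a x = Y (\<pi> a) x" using \<pi> that(1) by simp
    qed (use xC that in auto)
    have inj: "inj_on \<pi> ?I"
    proof (rule inj_onI)
      fix a b assume ab: "a \<in> ?I" "b \<in> ?I" "\<pi> a = \<pi> b"
      then have "X a x = X b x" using \<pi> by metis
      then show "a = b" using bX[OF xC] ab by (auto simp: bij_betw_def inj_on_def)
    qed
    have \<pi>I: "\<pi> ` ?I = ?I"
      using \<pi> by (intro endo_inj_surj inj) auto
    have \<nu>_eq: "\<nu> a = \<Lambda> (\<pi> a)" if a: "a \<in> ?I" for a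
    proof (rule tends_unique[OF Cne])
      show "tends (X a) (at s within C) (\<nu> a)"
        using \<nu> a by (intro tends_mono[OF _ at_le[OF CV]]) auto
      have "tends (Y (\<pi> a)) (at s within C) (\<Lambda> (\<pi> a))"
        using \<Lambda> \<pi> a by (intro tends_mono[OF _ at_le[OF C\<Omega>]]) auto
      moreover have "\<forall>\<^sub>F z in at s within C. Y (\<pi> a) z = X a z"
        using eq[OF a] by (simp add: eventually_at_filter)
      ultimately show "tends (X a) (at s within C) (\<Lambda> (\<pi> a))" using tends_cong by blast
    qed
    have A_iff: "a \<in> A \<longleftrightarrow> \<pi> a \<in> K" if a: "a \<in> ?I" for a
    proof
      assume "\<pi> a \<in> K"
      then show "a \<in> A" using \<nu>_eq[OF a] a by (auto simp: A_def)
    next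
      assume "a \<in> A"
      then obtain i where "i \<in> K" "\<Lambda> (\<pi> a) = \<Lambda> i" using \<nu>_eq[OF a] by (auto simp: A_def)
      then show "\<pi> a \<in> K" using K(2)[of i "\<pi> a"] \<pi> a by auto
    qed
    have "\<pi> ` A = K"
    proof
      show "\<pi> ` A \<subseteq> K" using A_iff A by blast
      show "K \<subseteq> \<pi> ` A"
      proof
        fix i assume i: "i \<in> K"
        then obtain a where "a \<in> ?I" "i = \<pi> a" using K(1) \<pi>I by blast
        then show "i \<in> \<pi> ` A" using A_iff i by blast
      qed
    qed
    moreover have "\<pi> ` (?I - A) = ?I - K"
      using inj_on_image_set_diff[OF inj, of ?I A] A \<pi>I \<open>\<pi> ` A = K\<close> by auto
    ultimately have bij: "bij_betw \<pi> A K" "bij_betw \<pi> (?I - A) (?I - K)"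
      using inj A by (auto simp: bij_betw_def intro: inj_on_subset)
    have "(\<Prod>i\<in>K. \<Prod>k\<in>?I - K. Y i x - Y k x) = (\<Prod>a\<in>A. \<Prod>b\<in>?I - A. Y (\<pi> a) x - Y (\<pi> b) x)"
      by (simp add: prod.reindex_bij_betw[OF bij(1), symmetric] prod.reindex_bij_betw[OF bij(2), symmetric])
    also have "\<dots> = (\<Prod>a\<in>A. \<Prod>b\<in>?I - A. X a x - X b x)"
      using \<pi> A by (intro prod.cong refl) auto
    finally show ?thesis ..
  qed
  show ?thesis
  proof (rule that[OF X A])
    fix x assume x: "x \<in> ?V \<inter> \<Omega>"
    have "\<kappa> * (Re (q s x) - 1) > 0" using x abs_ge_zero[of "Im (q s x)"] by (auto simp: cone_def)
    then have "Re (q s x) > 1" using \<kappa>(1) by (simp add: zero_less_mult_iff)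
    then have "Im (q s x) \<noteq> 0" using cone_\<Omega>[OF s \<kappa>(2), of x] x by auto
    then show "(\<Prod>a\<in>A. \<Prod>b\<in>?I - A. X a x - X b x) = (\<Prod>i\<in>K. \<Prod>k\<in>?I - K. Y i x - Y k x)"
      using half[of 1 x] half[of "-1" x] x by (cases "Im (q s x) > 0") auto
  qed
qed

text \<open>Bounds on the glued function are proved on \<open>\<Omega>\<close>, where it is
  explicit, and pass to the slits by continuity and density.\<close>

lemma dense_bound:
  assumes \<Phi>: "continuous_on (- B) \<Phi>" and g: "continuous_on UNIV g" and P: "open P"
    and bd: "\<And>x. x \<in> \<Omega> \<Longrightarrow> x \<in> P \<Longrightarrow> norm (\<Phi> x :: complex) * g x \<le> (C :: real)"
    and x: "x \<notin> B" "x \<in> P"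
  shows "norm (\<Phi> x) * g x \<le> C"
proof (rule tendsto_upperbound[OF _ _ at_within_\<Omega>])
  have "open (- B)" using finite_B by (simp add: finite_imp_closed open_Compl)
  then have "isCont \<Phi> x" "isCont g x" using \<Phi> g x by (auto simp: continuous_on_eq_continuous_at)
  then have "((\<lambda>z. norm (\<Phi> z) * g z) \<longlongrightarrow> norm (\<Phi> x) * g x) (at x)"
    unfolding isCont_def by (intro tendsto_intros)
  then show "((\<lambda>z. norm (\<Phi> z) * g z) \<longlongrightarrow> norm (\<Phi> x) * g x) (at x within \<Omega>)"
    by (rule tendsto_within_subset) simp
  have "\<forall>\<^sub>F z in at x within \<Omega>. z \<in> P"
    using P x(2) eventually_at_topological by blast
  moreover have "\<forall>\<^sub>F z in at x within \<Omega>. z \<in> \<Omega>" by (simp add: eventually_at_filter)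
  ultimately show "\<forall>\<^sub>F z in at x within \<Omega>. norm (\<Phi> z) * g z \<le> C"
    by eventually_elim (rule bd)
qed

end

text \<open>For an escaping sheet, \<open>Y i - Y k = - Y k * (1 - Y i / Y k)\<close> behaves like
  \<open>- Y k\<close>, so the factor \<open>a\<close> that makes the product of the escaping sheets
  converge does the same for the differences.\<close>

lemma limit_of_differences:
  fixes Y :: "'i \<Rightarrow> 'b \<Rightarrow> complex"
  assumes I: "finite I" "J \<subseteq> I" "K \<subseteq> J"
    and c: "((\<lambda>x. a x * (\<Prod>k\<in>I - J. - Y k x)) \<longlongrightarrow> c) F"
    and fin: "\<And>k. k \<in> J \<Longrightarrow> (Y k \<longlongrightarrow> l k) F"
    and inf: "\<And>k. k \<in> I - J \<Longrightarrow> filterlim (Y k) at_infinity F"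
    and i: "i \<in> K"
  shows "((\<lambda>x. a x * (\<Prod>k\<in>I - K. Y i x - Y k x)) \<longlongrightarrow> c * (\<Prod>k\<in>J - K. l i - l k)) F"
proof (rule Lim_transform_eventually)
  have "i \<in> J" using i I by blast
  have q: "((\<lambda>x. Y i x / Y k x) \<longlongrightarrow> 0) F" if "k \<in> I - J" for k
    by (rule tendsto_divide_0[OF fin[OF \<open>i \<in> J\<close>] inf[OF that]])
  have "((\<lambda>x. (a x * (\<Prod>k\<in>I - J. - Y k x)) * (\<Prod>k\<in>I - J. 1 - Y i x / Y k x) * (\<Prod>k\<in>J - K. Y i x - Y k x))
      \<longlongrightarrow> c * (\<Prod>k\<in>I - J. 1 - 0) * (\<Prod>k\<in>J - K. l i - l k)) F"
    by (intro tendsto_intros c q fin \<open>i \<in> J\<close>) auto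
  then show "((\<lambda>x. (a x * (\<Prod>k\<in>I - J. - Y k x)) * (\<Prod>k\<in>I - J. 1 - Y i x / Y k x) * (\<Prod>k\<in>J - K. Y i x - Y k x))
      \<longlongrightarrow> c * (\<Prod>k\<in>J - K. l i - l k)) F" by simp
  have "\<forall>\<^sub>F x in F. \<forall>k\<in>I - J. Y k x \<noteq> 0"
    using I(1) filterlim_at_infinity_imp_eventually_ne[OF inf] by (intro eventually_ball_finite) auto
  then show "\<forall>\<^sub>F x in F. (a x * (\<Prod>k\<in>I - J. - Y k x)) * (\<Prod>k\<in>I - J. 1 - Y i x / Y k x) * (\<Prod>k\<in>J - K. Y i x - Y k x)
      = a x * (\<Prod>k\<in>I - K. Y i x - Y k x)"
  proof eventually_elim
    case (elim x)
    have IK: "I - K = (I - J) \<union> (J - K)" using I by blast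
    have "(\<Prod>k\<in>I - K. Y i x - Y k x) = (\<Prod>k\<in>I - J. Y i x - Y k x) * (\<Prod>k\<in>J - K. Y i x - Y k x)"
      unfolding IK by (rule prod.union_disjoint) (use I in \<open>auto intro: finite_subset\<close>)
    also have "(\<Prod>k\<in>I - J. Y i x - Y k x) = (\<Prod>k\<in>I - J. - Y k x * (1 - Y i x / Y k x))"
      using elim by (intro prod.cong) (auto simp: field_simps)
    also have "\<dots> = (\<Prod>k\<in>I - J. - Y k x) * (\<Prod>k\<in>I - J. 1 - Y i x / Y k x)"
      by (rule prod.distrib)
    finally show ?case by (simp only: mult_ac)
  qed
qed

text \<open>If too few sheets come together over the finite branch points (at \<open>xs\<close> one sheet or more runs
  off to infinity), then the sheets split into two classes that never meet. The product of all
  differences between the classes, times \<open>(x - xs)\<^sup>k\<close>, is single-valued, entire, free of zeros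
  and tends to infinity, which is impossible.\<close>

lemma few_merges_contradiction:
  fixes f :: bipoly
  assumes un: "unramified_off f B" and xs: "xs \<in> B"
    and p0: "\<And>x. slice f x \<noteq> 0" and lc: "lead_coeff f = [:- xs, 1:]"
    and sep: "c > 0" "\<And>x y y'. norm x > \<rho> \<Longrightarrow> eval2 f x y = 0 \<Longrightarrow> eval2 f x y' = 0 \<Longrightarrow> y \<noteq> y' \<Longrightarrow>
        norm (y - y') \<ge> c * norm x"
    and few: "(\<Sum>s\<in>B. degree f - (card {y. eval2 f s y = 0} + (if s = xs then 1 else 0))) + 2 \<le> degree f"
  shows False
proof -
  let ?n = "degree f" and ?I = "{..<degree f}"
  have finB: "finite B" using un by (simp add: unramified_off_def)
  obtain b0 where b0: "b0 \<notin> B"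
      "\<And>s s'. s \<in> B \<Longrightarrow> s' \<in> B \<Longrightarrow> s \<noteq> s' \<Longrightarrow> Im ((s' - b0) / (s - b0)) \<noteq> 0"
    by (rule exists_non_collinear_point[OF finB]) (rule that)
  interpret slit_plane B b0 by unfold_locales (use finB b0 in auto)
  obtain \<kappa> where \<kappa>: "\<kappa> > 0" "\<And>s s'. s \<in> B \<Longrightarrow> s' \<in> B \<Longrightarrow> s \<noteq> s' \<Longrightarrow> cone \<kappa> s \<inter> ray s' = {}"
    by (rule exists_aperture) (rule that)
  have "(\<lambda>x. x) \<in> \<Omega> \<rightarrow> - B" "\<Omega> \<noteq> {}" using \<Omega>_disjoint_B b0_in_\<Omega> by auto
  then obtain Y where Y: "sheets f (\<lambda>x. x) \<Omega> Y"
    using sheets_exist[OF un open_\<Omega> simply_connected_\<Omega> _ holomorphic_on_ident] by metis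
  have "\<exists>\<Lambda>. \<forall>i\<in>?I. tends (Y i) (at s within \<Omega>) (\<Lambda> i)" if "s \<in> B" for s
    using limits_along_\<Omega>[OF un Y that p0] by (intro bchoice) simp
  then have "\<forall>s\<in>B. \<exists>\<Lambda>. \<forall>i\<in>?I. tends (Y i) (at s within \<Omega>) (\<Lambda> i)" by blast
  from bchoice[OF this] obtain \<Lambda> where "\<forall>s\<in>B. \<forall>i\<in>?I. tends (Y i) (at s within \<Omega>) (\<Lambda> s i)" ..
  then have \<Lambda>: "\<And>s i. s \<in> B \<Longrightarrow> i < ?n \<Longrightarrow> tends (Y i) (at s within \<Omega>) (\<Lambda> s i)" by simp
  define J where "J s = {i. i < ?n \<and> \<Lambda> s i \<noteq> None}" for s
  have JI: "J s \<subseteq> ?I" and finJ: "finite (J s)" for s by (auto simp: J_def)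
  have "\<exists>c. c \<noteq> 0 \<and> ((\<lambda>x. (x - xs) * (\<Prod>k\<in>?I - J s. - Y k x)) \<longlongrightarrow> c) (at s within \<Omega>) \<and>
      (\<forall>y. eval2 f s y = c * (\<Prod>i\<in>J s. y - the (\<Lambda> s i)))" if s: "s \<in> B" for s
  proof -
    obtain c where "c \<noteq> 0"
      "((\<lambda>x. poly (lead_coeff f) x * (\<Prod>k\<in>?I - J s. - Y k x)) \<longlongrightarrow> c) (at s within \<Omega>)"
      "\<And>y. eval2 f s y = c * (\<Prod>i\<in>J s. y - the (\<Lambda> s i))"
      unfolding J_def
      by (rule sheet_limits_factor[OF un Y \<Omega>_disjoint_B at_within_\<Omega> p0, of s "\<Lambda> s"])
        (use \<Lambda>[OF s] that in auto)
    then show ?thesis by (auto simp: lc)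
  qed
  then have "\<forall>s\<in>B. \<exists>c. c \<noteq> 0 \<and> ((\<lambda>x. (x - xs) * (\<Prod>k\<in>?I - J s. - Y k x)) \<longlongrightarrow> c) (at s within \<Omega>) \<and>
      (\<forall>y. eval2 f s y = c * (\<Prod>i\<in>J s. y - the (\<Lambda> s i)))" by blast
  from bchoice[OF this] obtain d where "\<forall>s\<in>B. d s \<noteq> 0 \<and> ((\<lambda>x. (x - xs) * (\<Prod>k\<in>?I - J s. - Y k x)) \<longlongrightarrow> d s) (at s within \<Omega>) \<and>
      (\<forall>y. eval2 f s y = d s * (\<Prod>i\<in>J s. y - the (\<Lambda> s i)))" ..
  then have d: "\<And>s. s \<in> B \<Longrightarrow> d s \<noteq> 0"
      "\<And>s. s \<in> B \<Longrightarrow> ((\<lambda>x. (x - xs) * (\<Prod>k\<in>?I - J s. - Y k x)) \<longlongrightarrow> d s) (at s within \<Omega>)"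
      "\<And>s y. s \<in> B \<Longrightarrow> eval2 f s y = d s * (\<Prod>i\<in>J s. y - the (\<Lambda> s i))" by blast+
  have degJ: "degree (slice f s) = card (J s)" if s: "s \<in> B" for s
  proof -
    have "poly (slice f s) y = poly (smult (d s) (\<Prod>i\<in>J s. [:- the (\<Lambda> s i), 1:])) y" for y
      by (simp add: poly_slice d(3)[OF s] poly_prod)
    then have "slice f s = smult (d s) (\<Prod>i\<in>J s. [:- the (\<Lambda> s i), 1:])"
      by (simp add: poly_eq_poly_eq_iff[symmetric] fun_eq_iff)
    then show ?thesis using d(1)[OF s] by (simp add: degree_prod_sum_eq)
  qed
  have roots: "{y. eval2 f s y = 0} = (\<lambda>i. the (\<Lambda> s i)) ` J s" if s: "s \<in> B" for s
    using d(1,3)[OF s] finJ[of s] by (auto simp: prod_zero_iff)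
  have J_xs: "J xs \<noteq> ?I"
  proof
    assume "J xs = ?I"
    then have "degree (slice f xs) = ?n" using degJ[OF xs] by simp
    moreover have "coeff (slice f xs) ?n = 0" by (simp add: coeff_slice lc)
    moreover have "?n > 0" using un by (simp add: unramified_off_def)
    ultimately show False using leading_coeff_0_iff[of "slice f xs"] p0[of xs] by simp
  qed
  have J_other: "J s = ?I" if "s \<in> B" "s \<noteq> xs" for s
  proof -
    have "degree (slice f s) = ?n" using that by (intro degree_slice) (simp add: lc)
    then show ?thesis using degJ[OF that(1)] JI[of s] by (intro card_subset_eq) auto
  qed
  \<comment> \<open>Some sheet takes the value \<open>None\<close> at \<open>xs\<close>; this adds
    one to the number of limits there and saves one merger.\<close>
  have "card {y. eval2 f s y = 0} + (if s = xs then 1 else 0) \<le> card (\<Lambda> s ` ?I)" if s: "s \<in> B" for s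
  proof -
    have "\<Lambda> s ` J s = Some ` {y. eval2 f s y = 0}"
      unfolding roots[OF s] image_image by (intro image_cong refl) (auto simp: J_def)
    then have 1: "card (\<Lambda> s ` J s) = card {y. eval2 f s y = 0}" by (simp add: card_image)
    show ?thesis
    proof (cases "s = xs")
      case False
      then show ?thesis using 1 J_other[OF s] by simp
    next
      case True
      obtain k where "k \<in> ?I" "k \<notin> J xs" using J_xs JI[of xs] by blast
      then have "None \<in> \<Lambda> s ` ?I" using True by (force simp: J_def)
      then have "insert None (\<Lambda> s ` J s) \<subseteq> \<Lambda> s ` ?I" using JI[of s] by blast
      then have "card (insert None (\<Lambda> s ` J s)) \<le> card (\<Lambda> s ` ?I)" by (intro card_mono) auto
      moreover have "None \<notin> \<Lambda> s ` J s" by (auto simp: J_def)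
      ultimately show ?thesis using 1 True finJ by simp
    qed
  qed
  then have "(\<Sum>s\<in>B. card ?I - card (\<Lambda> s ` ?I)) \<le> (\<Sum>s\<in>B. ?n - (card {y. eval2 f s y = 0} + (if s = xs then 1 else 0)))"
    by (intro sum_mono) (simp add: diff_le_mono2)
  then have few': "(\<Sum>s\<in>B. card ?I - card (\<Lambda> s ` ?I)) + 2 \<le> card ?I" using few by simp
  obtain K' where K': "K' \<subseteq> ?I" "K' \<noteq> {}" "K' \<noteq> ?I"
      "\<And>b i k. b \<in> B \<Longrightarrow> i \<in> K' \<Longrightarrow> k \<in> ?I - K' \<Longrightarrow> \<Lambda> b i \<noteq> \<Lambda> b k"
    by (rule disconnected_of_few_merges[OF finite_lessThan finB few']) (rule that)
  \<comment> \<open>The sheets escaping at \<open>xs\<close> share the limit \<open>None\<close>, so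
    they lie in one class; \<open>K\<close> is the class without them.\<close>
  define K where "K = (if \<exists>i\<in>K'. \<Lambda> xs i = None then ?I - K' else K')"
  have K: "K \<subseteq> ?I" "K \<noteq> {}" using K'(1-3) by (auto simp: K_def)
  have K_sep: "\<Lambda> s i \<noteq> \<Lambda> s k" if "s \<in> B" "i \<in> K" "k \<in> ?I - K" for s i k
  proof (cases "\<exists>i\<in>K'. \<Lambda> xs i = None")
    case True
    then have "i \<in> ?I - K'" "k \<in> K'" using that K'(1) by (auto simp: K_def)
    then show ?thesis using K'(4)[OF that(1), of k i] by metis
  next
    case False
    then have "K = K'" unfolding K_def by (rule if_not_P)
    then show ?thesis using that K'(4)[OF that(1), of i k] by simp
  qed
  have K_xs: "\<Lambda> xs i \<noteq> None" if i: "i \<in> K" for i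
  proof (cases "\<exists>i\<in>K'. \<Lambda> xs i = None")
    case True
    then obtain k where k: "k \<in> K'" "\<Lambda> xs k = None" by blast
    have "K = ?I - K'" unfolding K_def using True by (rule if_P)
    then show ?thesis using K'(4)[OF xs k(1), of i] k(2) i by metis
  next
    case False
    then have "K = K'" unfolding K_def by (rule if_not_P)
    then have "i \<in> K'" using i by simp
    then show ?thesis using False by auto
  qed
  have KJ: "K \<subseteq> J s" if "s \<in> B" for s
  proof (cases "s = xs")
    case True
    then show ?thesis using K_xs K(1) by (auto simp: J_def)
  next
    case False
    then show ?thesis using J_other[OF that] K(1) by simp
  qed
  have finK: "finite K" using K(1) finite_subset by blast
  \<comment> \<open>Liouville's theorem is applied to the reciprocal of the product, which is
    bounded near \<open>B\<close> and decays at infinity. Each \<open>i\<close> in \<open>K\<close>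
    receives one factor \<open>x - xs\<close> to balance the sheets that escape at
    \<open>xs\<close>.\<close>
  define G where "G x = 1 / ((x - xs) ^ card K * (\<Prod>i\<in>K. \<Prod>k\<in>?I - K. Y i x - Y k x))" for x
  have xs\<Omega>: "xs \<notin> \<Omega>" using xs \<Omega>_disjoint_B by blast
  have \<Omega>B: "\<Omega> \<subseteq> - B" using \<Omega>_disjoint_B by blast
  obtain \<Phi> where \<Phi>: "\<Phi> holomorphic_on - B" "\<And>x. x \<in> \<Omega> \<Longrightarrow> \<Phi> x = G x"
  proof (rule holomorphic_glue[where D = "- B" and \<Omega> = \<Omega> and G = G, OF at_within_\<Omega> _ \<Omega>B])
    fix x assume x: "x \<in> - B"
    show "\<exists>V h. open V \<and> x \<in> V \<and> V \<subseteq> - B \<and> h holomorphic_on V \<and> (\<forall>z\<in>V \<inter> \<Omega>. h z = G z)"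
    proof (cases "x \<in> \<Omega>")
      case True
      have "G holomorphic_on \<Omega>"
        unfolding G_def by (rule holomorphic_inverse_difference_product[OF Y K(1) xs\<Omega>])
      then show ?thesis using open_\<Omega> True \<Omega>B by blast
    next
      case False
      obtain s where s: "s \<in> B" "x \<in> cone \<kappa> s" by (rule not_\<Omega>_in_cone[OF \<kappa>(1) _ False]) (use x that in auto)
      obtain X A where X: "sheets f (\<lambda>x. x) (cone \<kappa> s) X" "A \<subseteq> ?I"
        "\<And>x. x \<in> cone \<kappa> s \<inter> \<Omega> \<Longrightarrow> (\<Prod>a\<in>A. \<Prod>b\<in>?I - A. X a x - X b x) = (\<Prod>i\<in>K. \<Prod>k\<in>?I - K. Y i x - Y k x)"
        by (rule cross_slit[OF un Y p0 s(1) \<kappa>(1) \<kappa>(2)[OF s(1)] \<Lambda>[OF s(1)] K(1) K_sep[OF s(1)]])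
          (use that in auto)
      have VB: "cone \<kappa> s \<inter> B = {}" by (rule cone_disjoint_B[OF s(1) \<kappa>(2)[OF s(1)]])
      define h where "h x = 1 / ((x - xs) ^ card K * (\<Prod>a\<in>A. \<Prod>b\<in>?I - A. X a x - X b x))" for x
      have "h holomorphic_on cone \<kappa> s"
        unfolding h_def using xs VB by (intro holomorphic_inverse_difference_product[OF X(1,2)]) blast
      moreover have "\<forall>z\<in>cone \<kappa> s \<inter> \<Omega>. h z = G z" using X(3) by (simp add: h_def G_def)
      ultimately show ?thesis using open_cone s(2) VB by blast
    qed
  qed (use that in auto)
  have cont\<Phi>: "continuous_on (- B) \<Phi>" using \<Phi>(1) holomorphic_on_imp_continuous_on by blast
  have near: "\<exists>C \<delta>. \<delta> > 0 \<and> (\<forall>x. x \<notin> B \<longrightarrow> dist x s < \<delta> \<longrightarrow> norm (\<Phi> x) \<le> C)" if s: "s \<in> B" for s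
  proof -
    let ?F = "at s within \<Omega>"
    define l where "l i = the (\<Lambda> s i)" for i
    have lim: "(Y k \<longlongrightarrow> l k) ?F" if "k \<in> J s" for k
      using \<Lambda>[OF s, of k] that by (auto simp: J_def tends_def l_def)
    have inf: "filterlim (Y k) at_infinity ?F" if "k \<in> ?I - J s" for k
      using \<Lambda>[OF s, of k] that by (auto simp: J_def tends_def)
    \<comment> \<open>The limit of the denominator at \<open>s\<close>: it is nonzero since
      \<open>d s\<close> is nonzero and no sheet of \<open>K\<close> shares its limit with a sheet
      outside \<open>K\<close>.\<close>
    define e where "e = (\<Prod>i\<in>K. d s * (\<Prod>k\<in>J s - K. l i - l k))"
    have "e \<noteq> 0"
    proof -
      have "l i \<noteq> l k" if "i \<in> K" "k \<in> J s - K" for i k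
        using K_sep[OF s that(1), of k] that KJ[OF s] JI[of s] by (auto simp: l_def J_def)
      then show ?thesis using d(1)[OF s] finK finJ[of s] by (auto simp: e_def prod_zero_iff)
    qed
    have "((\<lambda>x. \<Prod>i\<in>K. (x - xs) * (\<Prod>k\<in>?I - K. Y i x - Y k x)) \<longlongrightarrow> e) ?F"
      unfolding e_def
      by (intro tendsto_prod limit_of_differences[OF finite_lessThan JI KJ[OF s] d(2)[OF s] lim inf])
    then have "((\<lambda>x. norm ((x - xs) ^ card K * (\<Prod>i\<in>K. \<Prod>k\<in>?I - K. Y i x - Y k x))) \<longlongrightarrow> norm e) ?F"
      by (intro tendsto_norm) (simp add: prod.distrib)
    then have "\<forall>\<^sub>F x in ?F. norm ((x - xs) ^ card K * (\<Prod>i\<in>K. \<Prod>k\<in>?I - K. Y i x - Y k x)) > norm e / 2"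
      by (rule order_tendstoD) (use \<open>e \<noteq> 0\<close> in simp)
    then obtain \<delta> where \<delta>: "\<delta> > 0" "\<And>x. x \<in> \<Omega> \<Longrightarrow> x \<noteq> s \<Longrightarrow> dist x s < \<delta> \<Longrightarrow>
        norm ((x - xs) ^ card K * (\<Prod>i\<in>K. \<Prod>k\<in>?I - K. Y i x - Y k x)) > norm e / 2"
      unfolding eventually_at by blast
    have "norm (\<Phi> x) * 1 \<le> 1 / (norm e / 2)" if x: "x \<notin> B" "x \<in> ball s \<delta>" for x
    proof (rule dense_bound[OF cont\<Phi> _ open_ball _ x])
      fix z assume z: "z \<in> \<Omega>" "z \<in> ball s \<delta>"
      have "z \<noteq> s" using z(1) s \<Omega>_disjoint_B by blast
      then have gt: "norm ((z - xs) ^ card K * (\<Prod>i\<in>K. \<Prod>k\<in>?I - K. Y i z - Y k z)) > norm e / 2"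
        using \<delta>(2)[OF z(1)] z(2) by (simp add: dist_commute)
      have pos: "norm e / 2 > 0" using \<open>e \<noteq> 0\<close> by simp
      show "norm (\<Phi> z) * 1 \<le> 1 / (norm e / 2)"
        unfolding \<Phi>(2)[OF z(1)] G_def norm_divide norm_one mult_1_right
        using gt pos by (intro divide_left_mono mult_pos_pos) linarith+
    qed (intro continuous_intros)
    then show ?thesis using \<delta>(1) by (intro exI[of _ "1 / (norm e / 2)"] exI[of _ \<delta>]) (auto simp: dist_commute)
  qed
  \<comment> \<open>Beyond \<open>1 / c\<close> distinct sheets differ by at least 1; beyond
    \<open>2 * norm xs\<close> the distance to \<open>xs\<close> is at least
    \<open>norm z / 2\<close>; beyond 2 this distance is at least 1, so its power
    \<open>card K\<close> is no smaller than itself.\<close>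
  define R where "R = max \<rho> (max (1 / c) (max 2 (2 * norm xs)))"
  have far: "norm (\<Phi> x) \<le> 2 / norm x" if x: "x \<notin> B" "norm x > R" for x
  proof -
    have "norm (\<Phi> x) * norm x \<le> 2"
    proof (rule dense_bound[OF cont\<Phi> _ _ _ x(1), where P = "{x. norm x > R}" and g = norm])
      show "continuous_on UNIV (norm :: complex \<Rightarrow> real)" by (intro continuous_intros)
      show "open {x :: complex. R < norm x}" by (intro open_Collect_less continuous_intros)
      show "x \<in> {x. norm x > R}" using x by simp
      fix z assume z: "z \<in> \<Omega>" "z \<in> {x. norm x > R}"
      have zR: "norm z > \<rho>" "norm z > 1 / c" "norm z > 2" "norm z > 2 * norm xs" using z(2) by (auto simp: R_def)
      have "norm (Y i z - Y k z) \<ge> 1" if ik: "i \<in> K" "k \<in> ?I - K" for i k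
      proof -
        have "i < ?n" "k < ?n" "i \<noteq> k" using ik K(1) by auto
        then have "norm (Y i z - Y k z) \<ge> c * norm z"
          using sep(2)[OF zR(1)] sheets_root[OF Y _ z(1)] sheets_inj[OF Y z(1)] by simp
        moreover have "c * norm z \<ge> 1" using zR(2) sep(1) by (simp add: field_simps)
        ultimately show ?thesis by linarith
      qed
      then have "1 \<le> norm (\<Prod>i\<in>K. \<Prod>k\<in>?I - K. Y i z - Y k z)"
        unfolding prod_norm[symmetric] by (intro prod_ge_1)
      moreover have "norm z / 2 \<le> norm (z - xs) ^ card K"
      proof -
        have "norm z / 2 \<le> norm (z - xs)" using norm_triangle_ineq2[of z xs] zR(4) by linarith
        moreover have "norm (z - xs) ^ 1 \<le> norm (z - xs) ^ card K"
          using K(2) finK zR(3) calculation by (intro power_increasing) (auto simp: Suc_le_eq card_gt_0_iff)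
        ultimately show ?thesis by simp
      qed
      ultimately have "norm z / 2 * 1 \<le> norm (z - xs) ^ card K * norm (\<Prod>i\<in>K. \<Prod>k\<in>?I - K. Y i z - Y k z)"
        by (intro mult_mono) auto
      then have le: "norm z / 2 \<le> norm (z - xs) ^ card K * norm (\<Prod>i\<in>K. \<Prod>k\<in>?I - K. Y i z - Y k z)" (is "_ \<le> ?D")
        by simp
      have "0 < norm z / 2" using zR(3) by linarith
      then have "1 / ?D \<le> 1 / (norm z / 2)"
        by (rule frac_le[OF zero_le_one order_refl _ le])
      then have "norm (\<Phi> z) \<le> 2 / norm z"
        unfolding \<Phi>(2)[OF z(1)] G_def norm_divide norm_mult norm_power by simp
      then show "norm (\<Phi> z) * norm z \<le> 2"
        using zR(3) by (subst (asm) pos_le_divide_eq) linarith+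
    qed
    moreover have "norm x > 0" using x(2) by (auto simp: R_def)
    ultimately show ?thesis by (simp add: pos_le_divide_eq)
  qed
  have "\<Phi> b0 = 0"
    by (rule holomorphic_off_finite_decay[OF finB _ \<Phi>(1) near far b0(1)]) (use xs in auto)
  moreover have "G b0 \<noteq> 0"
  proof -
    have "Y i b0 - Y k b0 \<noteq> 0" if "i \<in> K" "k \<in> ?I - K" for i k
      using sheets_inj[OF Y b0_in_\<Omega>, of i k] that K(1) by auto
    moreover have "b0 \<noteq> xs" using b0(1) xs by blast
    ultimately show ?thesis using finK by (auto simp: G_def prod_zero_iff)
  qed
  ultimately show False using \<Phi>(2)[OF b0_in_\<Omega>] by simp
qed

subsection \<open>An asymptotic direction as the vertical direction\<close>

definition tdeg_le :: "bipoly \<Rightarrow> nat \<Rightarrow> bool" where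
  "tdeg_le h D \<longleftrightarrow> (\<forall>i j. coeff (coeff h j) i \<noteq> 0 \<longrightarrow> i + j \<le> D)"

text \<open>The form of degree \<open>D\<close> of \<open>h\<close>, restricted to
  \<open>x = 1\<close>. If \<open>D\<close> is the total degree, its roots are the slopes
  \<open>y / x\<close> of the asymptotic directions; a vertical direction shows as a drop of its
  degree.\<close>

definition top_form :: "bipoly \<Rightarrow> nat \<Rightarrow> complex poly" where
  "top_form h D = (\<Sum>j\<le>D. monom (coeff (coeff h j) (D - j)) j)"

lemma coeff_top_form: "coeff (top_form h D) j = (if j \<le> D then coeff (coeff h j) (D - j) else 0)"
  by (simp add: top_form_def coeff_sum coeff_monom)

lemma poly_as_sum:
  fixes p :: "complex poly"
  assumes "degree p \<le> N"
  shows "poly p x = (\<Sum>i\<le>N. coeff p i * x ^ i)"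
  unfolding poly_altdef using assms by (intro sum.mono_neutral_left) (auto simp: coeff_eq_0)

lemma tdeg_le_degree: "tdeg_le h D \<Longrightarrow> degree h \<le> D"
  unfolding tdeg_le_def by (metis leading_coeff_0_iff le_add2 le_trans degree_0 le0)

lemma tdeg_le_degree_coeff: "tdeg_le h D \<Longrightarrow> degree (coeff h j) \<le> D - j"
  unfolding tdeg_le_def
  by (metis add_le_imp_le_diff degree_0 le0 leading_coeff_0_iff)

lemma eval2_double_sum:
  assumes "tdeg_le h D"
  shows "eval2 h x y = (\<Sum>j\<le>D. \<Sum>i\<le>D - j. coeff (coeff h j) i * x ^ i * y ^ j)"
proof -
  have "eval2 h x y = (\<Sum>j\<le>D. coeff (slice h x) j * y ^ j)"
    unfolding poly_slice[symmetric]
    using degree_slice_le[of h x] tdeg_le_degree[OF assms] by (intro poly_as_sum) linarith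
  also have "\<dots> = (\<Sum>j\<le>D. (\<Sum>i\<le>D - j. coeff (coeff h j) i * x ^ i) * y ^ j)"
    unfolding coeff_slice by (intro sum.cong refl arg_cong2[of _ _ _ _ times] poly_as_sum tdeg_le_degree_coeff[OF assms])
  finally show ?thesis by (simp add: sum_distrib_right)
qed

lemma tdeg_le_pderiv: "tdeg_le h (Suc D) \<Longrightarrow> tdeg_le (pderiv h) D"
  unfolding tdeg_le_def by (force simp: coeff_pderiv of_nat_poly)

lemma top_form_pderiv: "top_form (pderiv h) D = pderiv (top_form h (Suc D))"
proof (rule poly_eqI)
  fix k
  show "coeff (top_form (pderiv h) D) k = coeff (pderiv (top_form h (Suc D))) k"
    by (simp add: coeff_top_form coeff_pderiv of_nat_poly)
qed

text \<open>With \<open>y = x * z\<close> and \<open>z\<close> bounded, every term of total degree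
  below \<open>D\<close> lacks at least one factor \<open>norm x\<close>.\<close>

lemma top_form_estimate:
  assumes "tdeg_le h D"
  obtains C where "C \<ge> 0" "\<And>x z. norm x \<ge> 1 \<Longrightarrow> norm z \<le> Z \<Longrightarrow>
    norm (eval2 h x (x * z) - x ^ D * poly (top_form h D) z) \<le> C * norm x ^ D / norm x"
proof
  let ?a = "\<lambda>i j. coeff (coeff h j) i"
  define C where "C = (\<Sum>j\<le>D. \<Sum>i<D - j. norm (?a i j) * \<bar>Z\<bar> ^ j)"
  show "C \<ge> 0" by (auto simp: C_def intro!: sum_nonneg)
  fix x z :: complex assume x: "norm x \<ge> 1" and z: "norm z \<le> Z"
  have "eval2 h x (x * z) - x ^ D * poly (top_form h D) z =
      (\<Sum>j\<le>D. (\<Sum>i\<le>D - j. ?a i j * x ^ i * (x * z) ^ j) - x ^ D * (?a (D - j) j * z ^ j))"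
    by (simp add: eval2_double_sum[OF assms] top_form_def poly_sum poly_monom sum_distrib_left sum_subtractf)
  also have "\<dots> = (\<Sum>j\<le>D. \<Sum>i<D - j. ?a i j * x ^ i * (x * z) ^ j)"
  proof (intro sum.cong refl)
    fix j assume "j \<in> {..D}"
    then have "x ^ D = x ^ (D - j) * x ^ j" by (simp flip: power_add)
    then have "?a (D - j) j * x ^ (D - j) * (x * z) ^ j = x ^ D * (?a (D - j) j * z ^ j)"
      by (simp add: power_mult_distrib)
    moreover have "(\<Sum>i\<le>D - j. ?a i j * x ^ i * (x * z) ^ j) =
        (\<Sum>i<D - j. ?a i j * x ^ i * (x * z) ^ j) + ?a (D - j) j * x ^ (D - j) * (x * z) ^ j"
      unfolding lessThan_Suc_atMost[symmetric] by simp
    ultimately show "(\<Sum>i\<le>D - j. ?a i j * x ^ i * (x * z) ^ j) - x ^ D * (?a (D - j) j * z ^ j) =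
        (\<Sum>i<D - j. ?a i j * x ^ i * (x * z) ^ j)" by simp
  qed
  also have "norm \<dots> \<le> (\<Sum>j\<le>D. \<Sum>i<D - j. norm (?a i j) * \<bar>Z\<bar> ^ j * (norm x ^ D / norm x))"
  proof (intro sum_norm_le)
    fix i j assume j: "j \<in> {..D}" and i: "i \<in> {..<D - j}"
    have "norm (?a i j * x ^ i * (x * z) ^ j) = norm (?a i j) * (norm z ^ j * norm x ^ (i + j))"
      by (simp add: norm_mult norm_power power_mult_distrib power_add)
    also have "\<dots> \<le> norm (?a i j) * (\<bar>Z\<bar> ^ j * (norm x ^ D / norm x))"
    proof (intro mult_left_mono mult_mono power_mono)
      have "norm x ^ (i + j) * norm x = norm x ^ Suc (i + j)" by simp
      also have "\<dots> \<le> norm x ^ D" using i x by (intro power_increasing) auto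
      finally show "norm x ^ (i + j) \<le> norm x ^ D / norm x" using x by (subst pos_le_divide_eq) auto
    qed (use z in auto)
    finally show "norm (?a i j * x ^ i * (x * z) ^ j) \<le> norm (?a i j) * \<bar>Z\<bar> ^ j * (norm x ^ D / norm x)"
      by simp
  qed
  also have "\<dots> = C * norm x ^ D / norm x"
    by (simp add: C_def sum_distrib_right sum_divide_distrib)
  finally show "norm (eval2 h x (x * z) - x ^ D * poly (top_form h D) z) \<le> C * norm x ^ D / norm x" .
qed

lemma tdeg_bound:
  assumes "tdeg_le h D"
  obtains C where "C \<ge> 0" "\<And>x y. norm x \<ge> 1 \<Longrightarrow> norm y \<le> Z * norm x \<Longrightarrow> norm (eval2 h x y) \<le> C * norm x ^ D"
proof
  let ?a = "\<lambda>i j. coeff (coeff h j) i"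
  define C where "C = (\<Sum>j\<le>D. \<Sum>i\<le>D - j. norm (?a i j) * \<bar>Z\<bar> ^ j)"
  show "C \<ge> 0" by (auto simp: C_def intro!: sum_nonneg)
  fix x y :: complex assume x: "norm x \<ge> 1" and y: "norm y \<le> Z * norm x"
  have "Z * norm x \<le> \<bar>Z\<bar> * norm x" by (intro mult_right_mono) auto
  then have y': "norm y \<le> \<bar>Z\<bar> * norm x" using y by linarith
  have "norm (eval2 h x y) \<le> (\<Sum>j\<le>D. \<Sum>i\<le>D - j. norm (?a i j) * \<bar>Z\<bar> ^ j * norm x ^ D)"
    unfolding eval2_double_sum[OF assms]
  proof (intro sum_norm_le)
    fix i j assume j: "j \<in> {..D}" and i: "i \<in> {..D - j}"
    have "norm (?a i j * x ^ i * y ^ j) = norm (?a i j) * (norm x ^ i * norm y ^ j)"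
      by (simp add: norm_mult norm_power)
    also have "\<dots> \<le> norm (?a i j) * (norm x ^ i * (\<bar>Z\<bar> * norm x) ^ j)"
      using y' by (intro mult_left_mono power_mono) auto
    also have "\<dots> = norm (?a i j) * \<bar>Z\<bar> ^ j * norm x ^ (i + j)"
      by (simp add: power_mult_distrib power_add)
    also have "\<dots> \<le> norm (?a i j) * \<bar>Z\<bar> ^ j * norm x ^ D"
      using i j x by (intro mult_left_mono power_increasing) auto
    finally show "norm (?a i j * x ^ i * y ^ j) \<le> norm (?a i j) * \<bar>Z\<bar> ^ j * norm x ^ D" .
  qed
  also have "\<dots> = C * norm x ^ D" by (simp add: C_def sum_distrib_right)
  finally show "norm (eval2 h x y) \<le> C * norm x ^ D" .
qed

text \<open>Where \<open>norm y > norm x\<close>, the bound \<open>m + 1\<close> on the total degree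
  makes every monomial of lower degree in \<open>y\<close> at most
  \<open>norm x ^ 2 * norm y ^ (m - 1)\<close>. Against the leading term
  \<open>\<kappa> * x * y ^ m\<close> this forces \<open>y = O(x)\<close>.\<close>

lemma asymptotic_root_bound:
  assumes td: "tdeg_le h (Suc m)" and deg: "degree h = m" and lc: "lead_coeff h = [:0, \<kappa>:]" and \<kappa>: "\<kappa> \<noteq> 0"
  obtains Z where "\<And>x y. norm x \<ge> 1 \<Longrightarrow> eval2 h x y = 0 \<Longrightarrow> norm y \<le> Z * norm x"
proof (cases m)
  case 0
  have "eval2 h x y = \<kappa> * x" for x y
    using deg lc by (simp add: eval2_altdef 0)
  then show ?thesis using that[of 0] \<kappa> by fastforce
next
  case (Suc k)
  define h' where "h' = h - monom [:0, \<kappa>:] m"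
  have coeff_h': "coeff h' j = (if j = m then 0 else coeff h j)" for j
    using deg lc by (simp add: h'_def coeff_monom)
  have h': "eval2 h x y = \<kappa> * x * y ^ m + eval2 h' x y" for x y
    by (simp add: h'_def eval2_diff eval2_def poly_monom poly_power poly_mult)
  have small: "coeff (coeff h' j) i = 0" if "j > k" for i j
    using that coeff_h'[of j] deg Suc by (cases "j = m") (auto simp: coeff_eq_0)
  have td': "tdeg_le h' (Suc m)" using td by (auto simp: tdeg_le_def coeff_h')
  define S where "S = (\<Sum>j\<le>k. \<Sum>i\<le>Suc m - j. norm (coeff (coeff h' j) i))"
  show ?thesis
  proof (rule that[of "max 1 (S / norm \<kappa>)"])
    fix x y assume x: "norm x \<ge> 1" and y: "eval2 h x y = 0"
    show "norm y \<le> max 1 (S / norm \<kappa>) * norm x"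
    proof (cases "norm y \<le> norm x")
      case True
      have "1 * norm x \<le> max 1 (S / norm \<kappa>) * norm x" by (intro mult_right_mono) auto
      then show ?thesis using True by linarith
    next
      case False
      then have y0: "norm y > 0" and xy: "norm x \<le> norm y" using x by linarith+
      have "eval2 h' x y = (\<Sum>j\<le>Suc m. \<Sum>i\<le>Suc m - j. coeff (coeff h' j) i * x ^ i * y ^ j)"
        by (rule eval2_double_sum[OF td'])
      also have "\<dots> = (\<Sum>j\<le>k. \<Sum>i\<le>Suc m - j. coeff (coeff h' j) i * x ^ i * y ^ j)"
        by (intro sum.mono_neutral_right) (auto simp: small Suc)
      also have "norm \<dots> \<le> (\<Sum>j\<le>k. \<Sum>i\<le>Suc m - j. norm (coeff (coeff h' j) i) * (norm x ^ 2 * norm y ^ k))"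
      proof (intro sum_norm_le)
        fix i j assume j: "j \<in> {..k}" and i: "i \<in> {..Suc m - j}"
        have "norm x ^ i * norm y ^ j \<le> norm x ^ (2 + (k - j)) * norm y ^ j"
          using i j x Suc by (intro mult_right_mono power_increasing) auto
        also have "\<dots> = norm x ^ 2 * (norm x ^ (k - j) * norm y ^ j)"
          unfolding power_add by (simp only: mult.assoc)
        also have "\<dots> \<le> norm x ^ 2 * (norm y ^ (k - j) * norm y ^ j)"
          using xy by (intro mult_left_mono mult_right_mono power_mono) auto
        also have "norm y ^ (k - j) * norm y ^ j = norm y ^ k" using j by (simp flip: power_add)
        finally have "norm x ^ i * norm y ^ j \<le> norm x ^ 2 * norm y ^ k" .
        from mult_left_mono[OF this norm_ge_zero[of "coeff (coeff h' j) i"]]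
        show "norm (coeff (coeff h' j) i * x ^ i * y ^ j) \<le> norm (coeff (coeff h' j) i) * (norm x ^ 2 * norm y ^ k)"
          by (simp add: norm_mult norm_power mult.assoc)
      qed
      also have "\<dots> = S * (norm x ^ 2 * norm y ^ k)" by (simp only: S_def sum_distrib_right)
      finally have "norm (eval2 h' x y) \<le> S * (norm x ^ 2 * norm y ^ k)" .
      moreover have "\<kappa> * x * y ^ m = - eval2 h' x y" using y h'[of x y] by (simp add: add_eq_0_iff2)
      then have "norm \<kappa> * norm x * norm y ^ m = norm (eval2 h' x y)"
        by (metis norm_minus_cancel norm_mult norm_power)
      ultimately have "(norm x * norm y ^ k) * (norm \<kappa> * norm y) \<le> (norm x * norm y ^ k) * (S * norm x)"
        by (simp add: Suc power2_eq_square mult_ac)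
      moreover have "norm x * norm y ^ k > 0" using x y0 by (intro mult_pos_pos) auto
      ultimately have "norm \<kappa> * norm y \<le> S * norm x" by (rule mult_left_le_imp_le)
      then have "norm y \<le> S / norm \<kappa> * norm x" using \<kappa> by (simp add: field_simps)
      also have "\<dots> \<le> max 1 (S / norm \<kappa>) * norm x" by (intro mult_right_mono) auto
      finally show ?thesis .
    qed
  qed
qed

lemma eval2_strip_bound:
  assumes "degree h \<le> N"
  obtains C where "C \<ge> 0" "\<And>x y. norm x \<le> 1 \<Longrightarrow> norm y \<ge> 1 \<Longrightarrow> norm (eval2 h x y) \<le> C * norm y ^ N"
proof
  define C where "C = (\<Sum>j\<le>degree h. \<Sum>i\<le>degree (coeff h j). norm (coeff (coeff h j) i))"
  show "C \<ge> 0" by (auto simp: C_def intro!: sum_nonneg)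
  fix x y :: complex assume x: "norm x \<le> 1" and y: "norm y \<ge> 1"
  have "norm (eval2 h x y) \<le> (\<Sum>j\<le>degree h. (\<Sum>i\<le>degree (coeff h j). norm (coeff (coeff h j) i)) * norm y ^ N)"
    unfolding eval2_altdef
  proof (intro sum_norm_le)
    fix j assume j: "j \<in> {..degree h}"
    have "norm (poly (coeff h j) x) \<le> (\<Sum>i\<le>degree (coeff h j). norm (coeff (coeff h j) i))"
      unfolding poly_altdef
    proof (intro sum_norm_le)
      fix i
      have "norm x ^ i \<le> 1" using x by (intro power_le_one) auto
      then show "norm (coeff (coeff h j) i * x ^ i) \<le> norm (coeff (coeff h j) i)"
        by (simp add: norm_mult norm_power mult_left_le)
    qed
    moreover have "norm y ^ j \<le> norm y ^ N" using j assms y by (intro power_increasing) auto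
    ultimately show "norm (poly (coeff h j) x * y ^ j) \<le> (\<Sum>i\<le>degree (coeff h j). norm (coeff (coeff h j) i)) * norm y ^ N"
      unfolding norm_mult norm_power by (intro mult_mono sum_nonneg) auto
  qed
  also have "\<dots> = C * norm y ^ N" by (simp add: C_def sum_distrib_right)
  finally show "norm (eval2 h x y) \<le> C * norm y ^ N" .
qed

lemma roots_locally_bounded:
  assumes "poly (lead_coeff p) x0 \<noteq> 0"
  obtains \<delta> M where "\<delta> > 0" "\<And>x y. dist x x0 < \<delta> \<Longrightarrow> eval2 p x y = 0 \<Longrightarrow> norm y \<le> M"
proof -
  let ?a = "poly (lead_coeff p)"
  have "((\<lambda>x. norm (?a x)) \<longlongrightarrow> norm (?a x0)) (nhds x0)" by (intro tendsto_intros filterlim_ident)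
  then have "\<forall>\<^sub>F x in nhds x0. norm (?a x) > norm (?a x0) / 2"
    by (rule order_tendstoD) (use assms in auto)
  then obtain \<delta> where \<delta>: "\<delta> > 0" "\<And>x. dist x x0 < \<delta> \<Longrightarrow> norm (?a x) > norm (?a x0) / 2"
    unfolding eventually_nhds_metric by blast
  show ?thesis
  proof (cases "degree p")
    case 0
    have "eval2 p x y = ?a x" for x y by (simp add: eval2_altdef 0)
    then have "eval2 p x y \<noteq> 0" if "dist x x0 < \<delta>" for x y using \<delta>(2)[OF that] by auto
    then show ?thesis using that[OF \<delta>(1), of 0] by blast
  next
    case (Suc m)
    then have "degree p > 0" by simp
    from root_poly_growth[OF this] obtain C k where C: "C \<ge> 0"
      "\<And>x y. eval2 p x y = 0 \<Longrightarrow> norm (?a x * y) \<le> C * (1 + norm x) ^ k"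
      by (auto simp: poly_growth_def)
    show ?thesis
    proof (rule that[OF \<delta>(1)])
      fix x y assume x: "dist x x0 < \<delta>" and y: "eval2 p x y = 0"
      have "norm x \<le> norm x0 + \<delta>" using x norm_triangle_sub[of x x0] by (simp add: dist_norm)
      have "norm (?a x0) / 2 * norm y \<le> norm (?a x) * norm y"
        using \<delta>(2)[OF x] by (intro mult_right_mono) auto
      also have "\<dots> \<le> C * (1 + norm x) ^ k" using C(2)[OF y] by (simp add: norm_mult)
      also have "\<dots> \<le> C * (1 + (norm x0 + \<delta>)) ^ k"
        using C(1) \<open>norm x \<le> norm x0 + \<delta>\<close> by (intro mult_left_mono power_mono) auto
      finally show "norm y \<le> C * (1 + (norm x0 + \<delta>)) ^ k / (norm (?a x0) / 2)"
        using assms by (subst pos_le_divide_eq) (auto simp: mult.commute)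
    qed
  qed
qed

text \<open>A root of \<open>s\<close> of multiplicity \<open>e\<close> is a root of the derivative
  of multiplicity \<open>e - 1\<close>. With \<open>r\<close> distinct roots this uses up
  \<open>degree s - r\<close> of the \<open>degree s - 1\<close> roots of the derivative.\<close>

lemma size_filter_proots_pderiv:
  assumes "degree (s :: complex poly) > 0"
  shows "size (filter_mset (\<lambda>y. poly s y \<noteq> 0) (proots (pderiv s))) = card {y. poly s y = 0} - 1"
proof -
  have s0: "s \<noteq> 0" using assms by auto
  have s'0: "pderiv s \<noteq> 0" using assms by (simp add: pderiv_eq_0_iff)
  let ?R = "{y. poly s y = 0}"
  have fin: "finite ?R" using s0 by (rule poly_roots_finite)
  have "size (proots (pderiv s)) = size (filter_mset (\<lambda>y. poly s y \<noteq> 0) (proots (pderiv s))) +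
      size (filter_mset (\<lambda>y. \<not> poly s y \<noteq> 0) (proots (pderiv s)))"
    using arg_cong[OF multiset_partition[of "proots (pderiv s)" "\<lambda>y. poly s y \<noteq> 0"], of size]
    unfolding size_union .
  moreover have "size (filter_mset (\<lambda>y. \<not> poly s y \<noteq> 0) (proots (pderiv s))) = (\<Sum>y\<in>?R. order y (pderiv s))"
  proof -
    have "set_mset (filter_mset (\<lambda>y. \<not> poly s y \<noteq> 0) (proots (pderiv s))) \<subseteq> ?R" by auto
    then have "size (filter_mset (\<lambda>y. \<not> poly s y \<noteq> 0) (proots (pderiv s))) =
        (\<Sum>y\<in>?R. count (filter_mset (\<lambda>y. \<not> poly s y \<noteq> 0) (proots (pderiv s))) y)"
      unfolding size_multiset_overloaded_eq using fin
      by (intro sum.mono_neutral_left ballI) (simp_all only: not_in_iff Diff_iff simp_thms)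
    also have "\<dots> = (\<Sum>y\<in>?R. order y (pderiv s))"
      using s'0 by (intro sum.cong refl) simp
    finally show ?thesis .
  qed
  moreover have "(\<Sum>y\<in>?R. order y (pderiv s)) + card ?R = degree s"
  proof -
    have "order y s = order y (pderiv s) + 1" if "y \<in> ?R" for y
      using order_pderiv[OF s0, of y] that s0 by (simp add: order_root)
    then have "(\<Sum>y\<in>?R. order y s) = (\<Sum>y\<in>?R. order y (pderiv s) + 1)"
      by (intro sum.cong refl)
    also have "\<dots> = (\<Sum>y\<in>?R. order y (pderiv s)) + card ?R"
      by (simp only: sum.distrib card_eq_sum)
    finally have "(\<Sum>y\<in>?R. order y s) = (\<Sum>y\<in>?R. order y (pderiv s)) + card ?R" .
    then show ?thesis using degree_eq_sum_order[OF s0 fin] by simp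
  qed
  moreover have "size (proots (pderiv s)) = degree s - 1"
    by (simp add: size_proots_complex degree_pderiv)
  moreover have "card ?R > 0"
  proof -
    have "?R \<noteq> {}" using assms fundamental_theorem_of_algebra[of s] constant_degree[of s] by auto
    then show ?thesis using fin by (simp add: card_gt_0_iff)
  qed
  ultimately show ?thesis by linarith
qed

text \<open>Coordinates in which the direction of the \<open>y\<close>-axis is one of the asymptotic directions:
  the total degree is \<open>n + 1\<close>, but the degree in \<open>y\<close> is only \<open>n\<close>, with leading coefficient \<open>x\<close>.\<close>

locale vertical_asymptote =
  fixes f :: bipoly and n :: nat
  assumes n_pos: "n > 0" and deg_f: "degree f = n" and lc_f: "lead_coeff f = [:0, 1:]"
    and td_f: "tdeg_le f (Suc n)"
    and separable: "\<And>z. poly (top_form f (Suc n)) z = 0 \<Longrightarrow> poly (pderiv (top_form f (Suc n))) z \<noteq> 0"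
    and crit: "\<And>x y. critical_point f x y \<Longrightarrow> eval2 f x y = 0"
begin

lemma coeff_f_n: "coeff f n = [:0, 1:]"
  using lc_f deg_f by simp

lemma degree_fy: "degree (pderiv f) = n - 1"
  by (simp add: degree_pderiv deg_f)

lemma lc_fy: "lead_coeff (pderiv f) = [:0, of_nat n:]"
proof -
  have "lead_coeff (pderiv f) = of_nat n * [:0, 1:]"
    using n_pos by (simp add: degree_fy coeff_pderiv coeff_f_n)
  then show ?thesis by (simp add: of_nat_poly)
qed

lemma td_fy: "tdeg_le (pderiv f) n"
  using td_f by (rule tdeg_le_pderiv)

lemma fy_root_bound:
  obtains Z where "\<And>x y. norm x \<ge> 1 \<Longrightarrow> eval2 (pderiv f) x y = 0 \<Longrightarrow> norm y \<le> Z * norm x"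
proof -
  obtain m where m: "n = Suc m" using n_pos by (cases n) auto
  show ?thesis
    by (rule asymptotic_root_bound[of "pderiv f" m "of_nat n"])
      (use td_fy degree_fy lc_fy n_pos m that in auto)
qed

lemma f_root_bound:
  obtains Z where "\<And>x y. norm x \<ge> 1 \<Longrightarrow> eval2 f x y = 0 \<Longrightarrow> norm y \<le> Z * norm x"
  by (rule asymptotic_root_bound[OF td_f deg_f lc_f]) (use that in auto)

text \<open>The top form and its derivative have no common root, so on a compact disc of slopes the
  sum of their norms has a positive minimum. For large \<open>x\<close> the larger of the two
  dominates the lower terms of \<open>f\<close> or of \<open>pderiv f\<close>.\<close>

lemma gap:
  obtains c \<rho> where "c > 0" "\<rho> \<ge> 1" "\<And>x y. norm x > \<rho> \<Longrightarrow> norm y \<le> Z * norm x \<Longrightarrow>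
    c * norm x ^ Suc n \<le> norm (eval2 f x y) \<or> c * norm x ^ n \<le> norm (eval2 (pderiv f) x y)"
proof -
  let ?g = "top_form f (Suc n)"
  let ?h = "\<lambda>z. norm (poly ?g z) + norm (poly (pderiv ?g) z)"
  have pos: "?h z > 0" for z
    using separable[of z] by (cases "poly ?g z = 0") (auto intro: add_pos_nonneg)
  have "\<exists>c0>0. \<forall>z\<in>cball 0 \<bar>Z\<bar>. c0 \<le> ?h z"
  proof -
    have "continuous_on (cball 0 \<bar>Z\<bar>) ?h" by (intro continuous_intros)
    then obtain z0 where "\<forall>z\<in>cball 0 \<bar>Z\<bar>. ?h z0 \<le> ?h z"
      using continuous_attains_inf[of "cball 0 \<bar>Z\<bar>" ?h] by auto
    then show ?thesis using pos by blast
  qed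
  then obtain c0 where c0: "c0 > 0" "\<And>z. norm z \<le> \<bar>Z\<bar> \<Longrightarrow> c0 \<le> ?h z" by auto
  obtain C1 where C1: "C1 \<ge> 0" "\<And>x z. norm x \<ge> 1 \<Longrightarrow> norm z \<le> \<bar>Z\<bar> \<Longrightarrow>
      norm (eval2 f x (x * z) - x ^ Suc n * poly ?g z) \<le> C1 * norm x ^ Suc n / norm x"
    by (rule top_form_estimate[OF td_f, of "\<bar>Z\<bar>"]) (rule that)
  obtain C2 where C2: "C2 \<ge> 0" "\<And>x z. norm x \<ge> 1 \<Longrightarrow> norm z \<le> \<bar>Z\<bar> \<Longrightarrow>
      norm (eval2 (pderiv f) x (x * z) - x ^ n * poly (top_form (pderiv f) n) z) \<le> C2 * norm x ^ n / norm x"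
    by (rule top_form_estimate[OF td_fy, of "\<bar>Z\<bar>"]) (rule that)
  \<comment> \<open>Relative to the power of \<open>x\<close>, the errors are at most
    \<open>c0 / 4\<close> beyond this radius, while one of the two leading terms is at least
    \<open>c0 / 2\<close>.\<close>
  define \<rho> where "\<rho> = max 1 (max (4 * C1 / c0) (4 * C2 / c0))"
  show ?thesis
  proof (rule that[of "c0 / 4" \<rho>])
    fix x y :: complex assume x: "norm x > \<rho>" and y: "norm y \<le> Z * norm x"
    have x1: "norm x \<ge> 1" "norm x > 0" and xC: "4 * C1 / c0 \<le> norm x" "4 * C2 / c0 \<le> norm x"
      using x by (auto simp: \<rho>_def)
    have small: "C / norm x \<le> c0 / 4" if "4 * C / c0 \<le> norm x" for C
      using that c0(1) x1(2) by (simp add: field_simps)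
    define z where "z = y / x"
    have xz: "y = x * z" using x1 by (auto simp: z_def)
    have "norm z \<le> Z" using y x1 by (simp add: z_def norm_divide pos_divide_le_eq)
    then have z: "norm z \<le> \<bar>Z\<bar>" by linarith
    have "c0 / 2 \<le> norm (poly ?g z) \<or> c0 / 2 \<le> norm (poly (pderiv ?g) z)"
      using c0(2)[OF z] by linarith
    then show "c0 / 4 * norm x ^ Suc n \<le> norm (eval2 f x y) \<or> c0 / 4 * norm x ^ n \<le> norm (eval2 (pderiv f) x y)"
    proof
      assume g: "c0 / 2 \<le> norm (poly ?g z)"
      have "norm (eval2 f x y - x ^ Suc n * poly ?g z) \<le> C1 / norm x * norm x ^ Suc n"
        using C1(2)[OF x1(1) z] by (simp add: xz)
      also have "\<dots> \<le> c0 / 4 * norm x ^ Suc n" using small[OF xC(1)] by (intro mult_right_mono) auto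
      finally have "norm (x ^ Suc n * poly ?g z) - c0 / 4 * norm x ^ Suc n \<le> norm (eval2 f x y)"
        using norm_triangle_ineq2[of "x ^ Suc n * poly ?g z" "eval2 f x y"] by (simp only: norm_minus_commute)
      moreover have "norm x ^ Suc n * (c0 / 2) \<le> norm (x ^ Suc n * poly ?g z)"
        unfolding norm_mult norm_power using g by (intro mult_left_mono) auto
      moreover have "norm x ^ Suc n * (c0 / 2) = c0 / 4 * norm x ^ Suc n + c0 / 4 * norm x ^ Suc n"
        by (simp add: algebra_simps)
      ultimately show ?thesis by linarith
    next
      assume g: "c0 / 2 \<le> norm (poly (pderiv ?g) z)"
      have "norm (eval2 (pderiv f) x y - x ^ n * poly (pderiv ?g) z) \<le> C2 / norm x * norm x ^ n"
        using C2(2)[OF x1(1) z] by (simp add: xz top_form_pderiv)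
      also have "\<dots> \<le> c0 / 4 * norm x ^ n" using small[OF xC(2)] by (intro mult_right_mono) auto
      finally have "norm (x ^ n * poly (pderiv ?g) z) - c0 / 4 * norm x ^ n \<le> norm (eval2 (pderiv f) x y)"
        using norm_triangle_ineq2[of "x ^ n * poly (pderiv ?g) z" "eval2 (pderiv f) x y"] by (simp only: norm_minus_commute)
      moreover have "norm x ^ n * (c0 / 2) \<le> norm (x ^ n * poly (pderiv ?g) z)"
        unfolding norm_mult norm_power using g by (intro mult_left_mono) auto
      moreover have "norm x ^ n * (c0 / 2) = c0 / 4 * norm x ^ n + c0 / 4 * norm x ^ n"
        by (simp add: algebra_simps)
      ultimately show ?thesis by linarith
    qed
  qed (use c0 in \<open>auto simp: \<rho>_def\<close>)
qed

text \<open>Euler's relation: the operator multiplies the monomial with exponents \<open>i\<close>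
  and \<open>j\<close> by \<open>n + 1 - i - j\<close>, which removes the terms of degree
  \<open>n + 1\<close>.\<close>

lemma euler_bound:
  obtains C where "C \<ge> 0" "\<And>x y. norm x \<ge> 1 \<Longrightarrow> norm y \<le> Z * norm x \<Longrightarrow>
    norm (of_nat (Suc n) * eval2 f x y - x * eval2 (partial_x f) x y - y * eval2 (pderiv f) x y) \<le> C * norm x ^ n"
proof -
  define E where "E = smult [:of_nat (Suc n):] f - smult [:0, 1:] (partial_x f) - pCons 0 (pderiv f)"
  have E: "eval2 E x y = of_nat (Suc n) * eval2 f x y - x * eval2 (partial_x f) x y - y * eval2 (pderiv f) x y" for x y
    by (simp add: E_def eval2_diff eval2_smult eval2_pCons)
  have coeff_E: "coeff (coeff E j) i = (of_nat (Suc n) - of_nat i - of_nat j) * coeff (coeff f j) i" for i j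
  proof -
    have "coeff (coeff (smult [:0, 1:] (partial_x f)) j) i = of_nat i * coeff (coeff f j) i"
      by (cases i) (simp_all add: partial_x_def coeff_map_poly coeff_pderiv)
    moreover have "coeff (coeff (pCons 0 (pderiv f)) j) i = of_nat j * coeff (coeff f j) i"
      by (cases j) (simp_all add: coeff_pderiv of_nat_poly)
    ultimately show ?thesis by (simp add: E_def algebra_simps)
  qed
  have "tdeg_le E n"
    unfolding tdeg_le_def
  proof (intro allI impI)
    fix i j assume nz: "coeff (coeff E j) i \<noteq> 0"
    then have "i + j \<le> Suc n" using td_f by (auto simp: coeff_E tdeg_le_def)
    moreover have "i + j \<noteq> Suc n"
    proof
      assume "i + j = Suc n"
      then have "of_nat (Suc n) = (of_nat i + of_nat j :: complex)" by (metis of_nat_add)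
      then show False using nz by (simp add: coeff_E)
    qed
    ultimately show "i + j \<le> n" by simp
  qed
  then obtain C where "C \<ge> 0" "\<And>x y. norm x \<ge> 1 \<Longrightarrow> norm y \<le> Z * norm x \<Longrightarrow> norm (eval2 E x y) \<le> C * norm x ^ n"
    by (rule tdeg_bound[of E n Z]) (rule that)
  then show ?thesis using that unfolding E by blast
qed

text \<open>On the polar curve \<open>gap\<close> makes \<open>norm f\<close> at least
  \<open>c * norm x ^ (n + 1)\<close>. By Euler's relation \<open>(n + 1) * f\<close> equals
  \<open>x * partial_x f\<close> up to an error of at most \<open>norm f\<close>, and
  \<open>n + 1 \<ge> 2\<close> leaves room for the constant 1.\<close>

lemma control_at_infinity:
  obtains \<rho> where "\<rho> \<ge> 1" "\<And>x y. norm x > \<rho> \<Longrightarrow> eval2 (pderiv f) x y = 0 \<Longrightarrow>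
    eval2 f x y \<noteq> 0 \<and> norm (eval2 f x y) \<le> 1 * norm x * norm (eval2 (partial_x f) x y)"
proof -
  obtain Z where Z: "\<And>x y. norm x \<ge> 1 \<Longrightarrow> eval2 (pderiv f) x y = 0 \<Longrightarrow> norm y \<le> Z * norm x"
    by (rule fy_root_bound) (rule that)
  obtain c \<rho> where gap: "c > 0" "\<rho> \<ge> 1" "\<And>x y. norm x > \<rho> \<Longrightarrow> norm y \<le> Z * norm x \<Longrightarrow>
      c * norm x ^ Suc n \<le> norm (eval2 f x y) \<or> c * norm x ^ n \<le> norm (eval2 (pderiv f) x y)"
    by (rule gap[of Z]) (rule that)
  obtain C where C: "C \<ge> 0" "\<And>x y. norm x \<ge> 1 \<Longrightarrow> norm y \<le> Z * norm x \<Longrightarrow>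
      norm (of_nat (Suc n) * eval2 f x y - x * eval2 (partial_x f) x y - y * eval2 (pderiv f) x y) \<le> C * norm x ^ n"
    by (rule euler_bound[of Z]) (rule that)
  show ?thesis
  proof (rule that[of "max \<rho> (C / c)"])
    fix x y assume x: "norm x > max \<rho> (C / c)" and y: "eval2 (pderiv f) x y = 0"
    have x1: "norm x \<ge> 1" "norm x > \<rho>" "C < c * norm x" using x gap(1,2) by (auto simp: field_simps)
    have yZ: "norm y \<le> Z * norm x" by (rule Z[OF x1(1) y])
    have "c * norm x ^ n > 0" using gap(1) x1(1) by (intro mult_pos_pos zero_less_power) linarith+
    then have big: "c * norm x ^ Suc n \<le> norm (eval2 f x y)" using gap(3)[OF x1(2) yZ] y by auto
    moreover have "c * norm x ^ Suc n > 0" using gap(1) x1(1) by (intro mult_pos_pos zero_less_power) linarith+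
    ultimately have "eval2 f x y \<noteq> 0" by auto
    have "C * norm x ^ n \<le> (c * norm x) * norm x ^ n" using x1(3) by (intro mult_right_mono) auto
    also have "\<dots> = c * norm x ^ Suc n" by simp
    finally have "C * norm x ^ n \<le> norm (eval2 f x y)" using big by linarith
    moreover have "norm (of_nat (Suc n) * eval2 f x y - x * eval2 (partial_x f) x y) \<le> C * norm x ^ n"
      using C(2)[OF x1(1) yZ] y by simp
    moreover have "norm (of_nat (Suc n) * eval2 f x y) \<le> norm (x * eval2 (partial_x f) x y) +
        norm (of_nat (Suc n) * eval2 f x y - x * eval2 (partial_x f) x y)"
      by (rule norm_triangle_sub)
    moreover have "2 * norm (eval2 f x y) \<le> norm (of_nat (Suc n) * eval2 f x y)"
      unfolding norm_mult norm_of_nat using n_pos by (intro mult_right_mono) auto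
    ultimately have "norm (eval2 f x y) \<le> norm (x * eval2 (partial_x f) x y)" by linarith
    then show "eval2 f x y \<noteq> 0 \<and> norm (eval2 f x y) \<le> 1 * norm x * norm (eval2 (partial_x f) x y)"
      using \<open>eval2 f x y \<noteq> 0\<close> by (simp add: norm_mult)
  qed (use gap in auto)
qed

text \<open>Taylor expansion at a root: by \<open>gap\<close> the first y-derivative is at least
  \<open>c * norm x ^ n\<close>, and the second is of order at most \<open>norm x ^ (n - 1)\<close>,
  so the next root is no closer than a multiple of \<open>norm x\<close>.\<close>

lemma root_separation:
  obtains c \<rho> where "c > 0" "\<And>x y y'. norm x > \<rho> \<Longrightarrow> eval2 f x y = 0 \<Longrightarrow> eval2 f x y' = 0 \<Longrightarrow> y \<noteq> y' \<Longrightarrow>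
    norm (y - y') \<ge> c * norm x"
proof -
  obtain Z where Z: "\<And>x y. norm x \<ge> 1 \<Longrightarrow> eval2 f x y = 0 \<Longrightarrow> norm y \<le> Z * norm x"
    by (rule f_root_bound) (rule that)
  obtain c \<rho> where gap: "c > 0" "\<rho> \<ge> 1" "\<And>x y. norm x > \<rho> \<Longrightarrow> norm y \<le> Z * norm x \<Longrightarrow>
      c * norm x ^ Suc n \<le> norm (eval2 f x y) \<or> c * norm x ^ n \<le> norm (eval2 (pderiv f) x y)"
    by (rule gap[of Z]) (rule that)
  obtain m where m: "n = Suc m" using n_pos by (cases n) auto
  have "tdeg_le (pderiv (pderiv f)) m" using td_fy unfolding m by (rule tdeg_le_pderiv)
  then obtain C where C: "C \<ge> 0" "\<And>x y. norm x \<ge> 1 \<Longrightarrow> norm y \<le> Z * norm x \<Longrightarrow>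
      norm (eval2 (pderiv (pderiv f)) x y) \<le> C * norm x ^ m"
    by (rule tdeg_bound[of _ m Z]) (rule that)
  show ?thesis
  \<comment> \<open>The summand 1 guards against \<open>C = 0\<close>.\<close>
  proof (rule that[of "c / (C + 1)" \<rho>])
    fix x y y' assume x: "norm x > \<rho>" and y: "eval2 f x y = 0" "eval2 f x y' = 0" "y \<noteq> y'"
    have x1: "norm x \<ge> 1" using x gap(2) by linarith
    let ?S = "cball (0 :: complex) (Z * norm x)" and ?B = "C * norm x ^ m"
    have S: "y \<in> ?S" "y' \<in> ?S" using Z[OF x1] y by auto
    have deriv1: "((\<lambda>w. eval2 h x w) has_field_derivative eval2 (pderiv h) x w) (at w within A)" for h w A
      using eval2_has_derivative[where p = h and \<xi> = "\<lambda>_. x" and Y = "\<lambda>w. w" and w = w and U = A, OF DERIV_const DERIV_ident]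
      by (simp add: partial_y_def)
    have lip: "norm (eval2 (pderiv f) x w - eval2 (pderiv f) x y) \<le> ?B * norm (w - y)" if "w \<in> ?S" for w
      by (rule field_differentiable_bound[OF convex_cball[of 0 "Z * norm x"], where f' = "\<lambda>w. eval2 (pderiv (pderiv f)) x w"])
        (use deriv1 C(2)[OF x1] S that in auto)
    define k where "k w = eval2 f x w - eval2 (pderiv f) x y * w" for w
    have "norm (k y' - k y) \<le> (?B * norm (y' - y)) * norm (y' - y)"
    proof (rule field_differentiable_bound[where S = "closed_segment y y'" and f' = "\<lambda>w. eval2 (pderiv f) x w - eval2 (pderiv f) x y"])
      show "convex (closed_segment y y')" by simp
      fix w assume w: "w \<in> closed_segment y y'"
      show "(k has_field_derivative eval2 (pderiv f) x w - eval2 (pderiv f) x y) (at w within closed_segment y y')"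
        unfolding k_def by (auto intro!: derivative_eq_intros deriv1)
      have "closed_segment y y' \<subseteq> ?S" using S by (intro closed_segment_subset convex_cball)
      then have "norm (eval2 (pderiv f) x w - eval2 (pderiv f) x y) \<le> ?B * norm (w - y)" using w by (intro lip) auto
      also have "\<dots> \<le> ?B * norm (y' - y)"
        using segment_bound1[OF w] C(1) by (intro mult_left_mono) auto
      finally show "norm (eval2 (pderiv f) x w - eval2 (pderiv f) x y) \<le> ?B * norm (y' - y)" .
    qed auto
    moreover have "k y' - k y = - eval2 (pderiv f) x y * (y' - y)" using y by (simp add: k_def algebra_simps)
    ultimately have "norm (eval2 (pderiv f) x y) * norm (y' - y) \<le> (?B * norm (y' - y)) * norm (y' - y)"
      by (simp add: norm_mult)
    then have upper: "norm (eval2 (pderiv f) x y) \<le> ?B * norm (y' - y)"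
      using y(3) by (simp add: mult_le_cancel_right)
    have "c * norm x ^ Suc n > 0" using gap(1) x1 by (intro mult_pos_pos zero_less_power) linarith+
    then have "c * norm x ^ n \<le> norm (eval2 (pderiv f) x y)"
      using gap(3)[OF x, of y] S(1) y(1) by auto
    also note upper
    also have "?B * norm (y' - y) \<le> (C + 1) * norm x ^ m * norm (y' - y)"
      by (intro mult_right_mono) auto
    finally have "norm x ^ m * (c * norm x) \<le> norm x ^ m * ((C + 1) * norm (y' - y))"
      by (simp add: m mult_ac)
    moreover have "norm x ^ m > 0" using x1 by (intro zero_less_power) linarith
    ultimately have "c * norm x \<le> (C + 1) * norm (y' - y)" by (rule mult_left_le_imp_le)
    then show "c / (C + 1) * norm x \<le> norm (y - y')"
      using C(1) by (simp add: field_simps norm_minus_commute)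
  qed (use gap C in auto)
qed

lemma degree_slice_off_0:
  assumes "x \<noteq> 0"
  shows "degree (slice f x) = n"
  using assms deg_f by (subst degree_slice) (auto simp: lc_f)

lemma degree_slice_0: "degree (slice f 0) < n"
proof -
  have "coeff (slice f 0) n = 0" by (simp add: coeff_slice coeff_f_n)
  moreover have "degree (slice f 0) \<le> n" using degree_slice_le[of f 0] deg_f by simp
  ultimately show ?thesis using n_pos by (metis leading_coeff_0_iff degree_0 le_neq_implies_less)
qed

text \<open>Near \<open>x = 0\<close> write \<open>f = \<phi>(y) + x w(x,y)\<close>, where \<open>w\<close> has leading term \<open>y\<^sup>n\<close>. On the polar
  \<open>f\<^sub>y = 0\<close> the derivative of \<open>\<phi>\<close> is of the order of \<open>x y\<^sup>n\<^sup>-\<^sup>1\<close>, so that \<open>f = O(x y\<^sup>n)\<close>, while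
  \<open>f\<^sub>x\<close> is of the order of \<open>y\<^sup>n\<close>.\<close>

lemma control_at_vertical_asymptote:
  assumes pos: "degree (slice f 0) > 0"
  shows "\<exists>\<delta> M C. \<delta> > 0 \<and> (\<forall>x y. x \<noteq> 0 \<longrightarrow> dist x 0 < \<delta> \<longrightarrow> norm y > M \<longrightarrow> eval2 (pderiv f) x y = 0 \<longrightarrow>
        norm (eval2 f x y) \<le> C * norm (x - 0) * norm (eval2 (partial_x f) x y))"
proof -
  define \<phi> where "\<phi> = slice f 0"
  define N where "N = degree \<phi>"
  have N: "N > 0" "N < n" using pos degree_slice_0 by (auto simp: N_def \<phi>_def)
  obtain m where m: "n = Suc m" using n_pos by (cases n) auto
  obtain N' where N': "N = Suc N'" using N by (cases N) auto
  \<comment> \<open>\<open>poly_shift 1\<close> drops the constant term of each coefficient and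
    divides the rest by \<open>x\<close>, so that \<open>f = \<phi> + x * w\<close>.\<close>
  define w where "w = map_poly (poly_shift 1) f"
  have coeff_w: "coeff w j = poly_shift 1 (coeff f j)" for j
    by (simp add: w_def coeff_map_poly)
  have coeff_f: "coeff f j = pCons (coeff (coeff f j) 0) (coeff w j)" for j
    by (simp add: poly_eq_iff coeff_w coeff_poly_shift coeff_pCons split: nat.splits)
  have w_n: "coeff w n = 1"
    by (simp add: coeff_w coeff_f_n poly_eq_iff coeff_poly_shift coeff_pCons split: nat.splits)
  have w_hi: "coeff w j = 0" if "j > n" for j
    using that deg_f by (simp add: coeff_w coeff_eq_0 poly_eq_iff coeff_poly_shift)
  have deg_w: "degree w \<le> n" by (rule degree_le) (use w_hi in auto)
  have f_eq: "eval2 f x y = poly \<phi> y + x * eval2 w x y" for x y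
  proof -
    have "slice f x = \<phi> + smult x (slice w x)"
    proof (rule poly_eqI)
      fix j
      have "poly (coeff f j) x = coeff (coeff f j) 0 + x * poly (coeff w j) x"
        by (subst coeff_f) simp
      then show "coeff (slice f x) j = coeff (\<phi> + smult x (slice w x)) j"
        by (simp add: \<phi>_def coeff_slice poly_0_coeff_0)
    qed
    then show ?thesis by (metis poly_add poly_smult poly_slice)
  qed
  have fy_eq: "eval2 (pderiv f) x y = poly (pderiv \<phi>) y + x * eval2 (pderiv w) x y" for x y
  proof -
    have "slice f x = \<phi> + smult x (slice w x)"
      by (simp add: poly_eq_poly_eq_iff[symmetric] fun_eq_iff poly_slice f_eq)
    then have "slice (pderiv f) x = pderiv \<phi> + smult x (slice (pderiv w) x)"
      by (simp add: pderiv_slice pderiv_add pderiv_smult)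
    then show ?thesis by (metis poly_add poly_smult poly_slice)
  qed
  define v where "v = w - monom 1 n"
  have w_eq: "eval2 w x y = y ^ n + eval2 v x y" for x y
    by (simp add: v_def eval2_diff eval2_def poly_monom)
  have coeff_v: "coeff v j = 0" if "j > m" for j
    using that w_n w_hi[of j] by (cases "j = n") (auto simp: v_def m coeff_monom)
  have deg_v: "degree v \<le> m" by (rule degree_le) (use coeff_v in auto)
  have fx_eq: "eval2 (partial_x f) x y = eval2 w x y + x * eval2 (partial_x w) x y" for x y
  proof -
    have "((\<lambda>x. eval2 f x y) has_field_derivative eval2 (partial_x f) x y) (at x)"
      using eval2_has_derivative[where p = f and \<xi> = "\<lambda>x. x" and Y = "\<lambda>_. y", OF DERIV_ident DERIV_const] by simp
    moreover have "((\<lambda>x. poly \<phi> y + x * eval2 w x y) has_field_derivative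
        (eval2 w x y + x * eval2 (partial_x w) x y)) (at x)"
      using eval2_has_derivative[where p = w and \<xi> = "\<lambda>x. x" and Y = "\<lambda>_. y", OF DERIV_ident DERIV_const]
      by (auto intro!: derivative_eq_intros)
    ultimately show ?thesis unfolding f_eq by (rule DERIV_unique)
  qed
  have deg_wx: "degree (partial_x w) \<le> m"
  proof (rule degree_le, intro allI impI)
    fix j assume "j > m"
    then show "coeff (partial_x w) j = 0"
      using w_n w_hi[of j] by (cases "j = n") (auto simp: partial_x_def coeff_map_poly m pderiv_1)
  qed
  have deg_wy: "degree (pderiv w) \<le> m" using deg_w by (simp add: degree_pderiv m)
  obtain C1 where C1: "C1 \<ge> 0" "\<And>x y. norm x \<le> 1 \<Longrightarrow> norm y \<ge> 1 \<Longrightarrow> norm (eval2 w x y) \<le> C1 * norm y ^ n"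
    by (rule eval2_strip_bound[OF deg_w]) (rule that)
  obtain C2 where C2: "C2 \<ge> 0" "\<And>x y. norm x \<le> 1 \<Longrightarrow> norm y \<ge> 1 \<Longrightarrow> norm (eval2 v x y) \<le> C2 * norm y ^ m"
    by (rule eval2_strip_bound[OF deg_v]) (rule that)
  obtain C3 where C3: "C3 \<ge> 0" "\<And>x y. norm x \<le> 1 \<Longrightarrow> norm y \<ge> 1 \<Longrightarrow> norm (eval2 (partial_x w) x y) \<le> C3 * norm y ^ m"
    by (rule eval2_strip_bound[OF deg_wx]) (rule that)
  obtain C4 where C4: "C4 \<ge> 0" "\<And>x y. norm x \<le> 1 \<Longrightarrow> norm y \<ge> 1 \<Longrightarrow> norm (eval2 (pderiv w) x y) \<le> C4 * norm y ^ m"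
    by (rule eval2_strip_bound[OF deg_wy]) (rule that)
  have "degree (map_poly (\<lambda>c. [:c:]) \<phi>) \<le> N" unfolding N_def
    by (rule degree_le) (auto simp: coeff_map_poly coeff_eq_0)
  then obtain C5 where C5: "C5 \<ge> 0"
    "\<And>x y. norm x \<le> 1 \<Longrightarrow> norm y \<ge> 1 \<Longrightarrow> norm (eval2 (map_poly (\<lambda>c. [:c:]) \<phi>) x y) \<le> C5 * norm y ^ N"
    by (rule eval2_strip_bound) (rule that)
  have "eval2 (map_poly (\<lambda>c. [:c:]) \<phi>) x y = poly \<phi> y" for x y
    by (induction \<phi>) (simp_all add: map_poly_pCons eval2_pCons)
  then have C5': "norm (poly \<phi> y) \<le> C5 * norm y ^ N" if "norm y \<ge> 1" for y
    using C5(2)[of 0 y] that by simp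
  define c where "c = norm (lead_coeff (pderiv \<phi>)) / 2"
  have "pderiv \<phi> \<noteq> 0" using N by (simp add: N_def pderiv_eq_0_iff)
  then have c: "c > 0" by (simp add: c_def)
  have "degree (pderiv \<phi>) = N'" using N' by (simp add: degree_pderiv N_def)
  then have "((\<lambda>y. poly (pderiv \<phi>) y / y ^ N') \<longlongrightarrow> lead_coeff (pderiv \<phi>)) at_infinity"
    using poly_div_power_tendsto[of "pderiv \<phi>" N'] by simp
  then have "((\<lambda>y. norm (poly (pderiv \<phi>) y / y ^ N')) \<longlongrightarrow> norm (lead_coeff (pderiv \<phi>))) at_infinity"
    by (rule tendsto_norm)
  then have "\<forall>\<^sub>F y in at_infinity. norm (poly (pderiv \<phi>) y / y ^ N') > c"
    by (rule order_tendstoD) (use c in \<open>simp add: c_def\<close>)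
  then obtain M0 where M0: "\<And>y. norm y \<ge> M0 \<Longrightarrow> norm (poly (pderiv \<phi>) y / y ^ N') > c"
    unfolding eventually_at_infinity by blast
  \<comment> \<open>Beyond \<open>2 * (C2 + C3)\<close> the remaining terms of
    \<open>partial_x f\<close> are at most half of \<open>y ^ n\<close>. That 2 enters
    \<open>D\<close>, together with the bounds \<open>C5 * (C4 / c)\<close> for
    \<open>\<phi>\<close> and \<open>C1\<close> for \<open>w\<close>.\<close>
  define M where "M = max 1 (max M0 (2 * (C2 + C3)))"
  define D where "D = 2 * (C5 * (C4 / c) + C1)"
  have "norm (eval2 f x y) \<le> D * norm x * norm (eval2 (partial_x f) x y)"
    if x: "norm x < 1" and y: "norm y > M" and fy: "eval2 (pderiv f) x y = 0" for x y
  proof -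
    have y1: "norm y \<ge> 1" "norm y \<ge> M0" "2 * (C2 + C3) \<le> norm y" using y by (auto simp: M_def)
    have y0: "norm y > 0" using y1 by linarith
    have x1: "norm x \<le> 1" using x by simp
    have "c * norm y ^ N' \<le> norm (poly (pderiv \<phi>) y)"
      using M0[OF y1(2)] y0 by (simp add: norm_divide norm_power pos_less_divide_eq)
    also have "poly (pderiv \<phi>) y = - (x * eval2 (pderiv w) x y)"
      using fy fy_eq[of x y] by (simp add: add_eq_0_iff2)
    also have "norm \<dots> \<le> norm x * (C4 * norm y ^ m)"
      unfolding norm_minus_cancel norm_mult using C4(2)[OF x1 y1(1)] by (intro mult_left_mono) auto
    finally have "c * norm y ^ N' * norm y \<le> norm x * (C4 * norm y ^ m) * norm y"
      by (intro mult_right_mono) auto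
    then have "c * norm y ^ N \<le> C4 * (norm x * norm y ^ n)" by (simp add: m N' mult_ac)
    then have yN: "norm y ^ N \<le> C4 / c * (norm x * norm y ^ n)"
      using c by (simp add: pos_le_divide_eq mult.commute)
    have "norm (eval2 f x y) \<le> norm (poly \<phi> y) + norm x * norm (eval2 w x y)"
      unfolding f_eq by (rule order_trans[OF norm_triangle_ineq]) (simp add: norm_mult)
    also have "\<dots> \<le> C5 * norm y ^ N + norm x * (C1 * norm y ^ n)"
      using C5'[OF y1(1)] C1(2)[OF x1 y1(1)] by (intro add_mono mult_left_mono) auto
    also have "\<dots> \<le> C5 * (C4 / c * (norm x * norm y ^ n)) + norm x * (C1 * norm y ^ n)"
      using yN C5(1) by (intro add_right_mono mult_left_mono) auto
    also have "\<dots> = (D / 2) * norm x * norm y ^ n" by (simp add: D_def algebra_simps)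
    finally have f_le: "norm (eval2 f x y) \<le> (D / 2) * norm x * norm y ^ n" .
    have "norm (x * eval2 (partial_x w) x y) \<le> 1 * (C3 * norm y ^ m)"
      unfolding norm_mult using C3(2)[OF x1 y1(1)] x1 by (intro mult_mono) auto
    then have "norm (eval2 v x y + x * eval2 (partial_x w) x y) \<le> C2 * norm y ^ m + 1 * (C3 * norm y ^ m)"
      using C2(2)[OF x1 y1(1)] by (intro order_trans[OF norm_triangle_ineq] add_mono)
    also have "\<dots> = (C2 + C3) * norm y ^ m" by (simp add: algebra_simps)
    also have "\<dots> \<le> norm y / 2 * norm y ^ m" using y1(3) by (intro mult_right_mono) auto
    also have "\<dots> = norm y ^ n / 2" by (simp add: m)
    finally have "norm (y ^ n) - norm y ^ n / 2 \<le> norm (y ^ n) - norm (eval2 v x y + x * eval2 (partial_x w) x y)" by linarith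
    also have "\<dots> \<le> norm (y ^ n + (eval2 v x y + x * eval2 (partial_x w) x y))" by (rule norm_diff_ineq)
    also have "y ^ n + (eval2 v x y + x * eval2 (partial_x w) x y) = eval2 (partial_x f) x y"
      by (simp add: fx_eq w_eq)
    finally have "norm y ^ n \<le> 2 * norm (eval2 (partial_x f) x y)" by (simp add: norm_power)
    moreover have "D / 2 * norm x \<ge> 0" using C1(1) C4(1) C5(1) c by (auto simp: D_def intro!: mult_nonneg_nonneg add_nonneg_nonneg)
    ultimately have "(D / 2) * norm x * norm y ^ n \<le> (D / 2) * norm x * (2 * norm (eval2 (partial_x f) x y))"
      by (intro mult_left_mono)
    with f_le show ?thesis by simp
  qed
  then show ?thesis by (intro exI[of _ 1] exI[of _ M] exI[of _ D]) auto
qed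

text \<open>Where the leading coefficient is nonzero no root escapes, and with \<open>M\<close> a
  local bound for the roots the condition is vacuous.\<close>

lemma control_near_regular:
  assumes "\<And>x y. eval2 p x y = 0 \<Longrightarrow> eval2 (pderiv f) x y = 0" "poly (lead_coeff p) x0 \<noteq> 0"
  shows "\<exists>\<delta> M C. \<delta> > 0 \<and> (\<forall>x y. x \<noteq> x0 \<longrightarrow> dist x x0 < \<delta> \<longrightarrow> norm y > M \<longrightarrow> eval2 p x y = 0 \<longrightarrow>
        norm (eval2 f x y) \<le> C * norm (x - x0) * norm (eval2 (partial_x f) x y))"
proof -
  obtain \<delta> M where "\<delta> > 0" "\<And>x y. dist x x0 < \<delta> \<Longrightarrow> eval2 p x y = 0 \<Longrightarrow> norm y \<le> M"
    by (rule roots_locally_bounded[OF assms(2)]) (rule that)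
  then show ?thesis by (intro exI[of _ \<delta>] exI[of _ M] exI[of _ 0]) (auto simp: not_le[symmetric])
qed

text \<open>A common factor of \<open>f\<close> and \<open>pderiv f\<close> of positive degree in
  \<open>y\<close> would have zeros over arbitrarily large \<open>x\<close>, where
  \<open>control_at_infinity\<close> excludes them. The point 0 is added to \<open>B\<close> because
  the leading coefficient vanishes there.\<close>

lemma generic_fibres:
  obtains B where "unramified_off f B" "0 \<in> B"
proof -
  obtain \<rho> where \<rho>: "\<rho> \<ge> 1" "\<And>x y. norm x > \<rho> \<Longrightarrow> eval2 (pderiv f) x y = 0 \<Longrightarrow>
      eval2 f x y \<noteq> 0 \<and> norm (eval2 f x y) \<le> 1 * norm x * norm (eval2 (partial_x f) x y)"
    by (rule control_at_infinity) (rule that)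
  have "f \<noteq> 0" using deg_f n_pos by auto
  then obtain g a b c h c' k where g: "g \<noteq> 0" "g = a * f + b * pderiv f" "c \<noteq> 0" "smult c f = g * h"
      "c' \<noteq> 0" "smult c' (pderiv f) = g * k"
    by (rule bezout_gcd[of f "pderiv f"]) (rule that)
  have "degree g = 0"
  proof (rule ccontr)
    assume dg: "degree g \<noteq> 0"
    define T where "T = {x. poly (lead_coeff g * c * c') x = 0}"
    have "finite T" unfolding T_def using g(1,3,5) by (intro poly_roots_finite) simp
    have "infinite {x :: complex. norm x > \<rho>}"
    proof
      assume fin: "finite {x :: complex. norm x > \<rho>}"
      have "UNIV \<subseteq> cball (0 :: complex) \<rho> \<union> {x. norm x > \<rho>}" by auto
      then have "bounded (UNIV :: complex set)"
        using bounded_subset bounded_Un bounded_cball finite_imp_bounded[OF fin] by metis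
      then show False by simp
    qed
    then have "{x :: complex. norm x > \<rho>} - T \<noteq> {}" using \<open>finite T\<close> by (metis Diff_infinite_finite infinite_imp_nonempty)
    then obtain x where x: "norm x > \<rho>" "x \<notin> T" by blast
    then have nz: "poly (lead_coeff g) x \<noteq> 0" "poly c x \<noteq> 0" "poly c' x \<noteq> 0" by (auto simp: T_def)
    have "degree (slice g x) \<noteq> 0" using dg degree_slice[OF nz(1)] by simp
    then obtain y where "poly (slice g x) y = 0"
      using fundamental_theorem_of_algebra[of "slice g x"] constant_degree[of "slice g x"] by auto
    then have gy: "eval2 g x y = 0" by (simp add: poly_slice)
    have "poly c x * eval2 f x y = 0" "poly c' x * eval2 (pderiv f) x y = 0"
      using gy arg_cong[OF g(4), of "\<lambda>p. eval2 p x y"] arg_cong[OF g(6), of "\<lambda>p. eval2 p x y"]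
      by (simp_all add: eval2_smult eval2_mult)
    then show False using nz \<rho>(2)[OF x(1), of y] by simp
  qed
  then obtain e where e: "g = [:e:]" by (auto elim: degree_eq_zeroE)
  have "e \<noteq> 0" using g(1) unfolding e by auto
  moreover have "a * f + b * pderiv f = [:e:]" unfolding e[symmetric] g(2)[symmetric] ..
  moreover have "degree f > 0" using deg_f n_pos by simp
  ultimately have "\<exists>S. unramified_off f S" by (rule unramified_off_bezout)
  then obtain S where "unramified_off f S" ..
  then have "unramified_off f (S \<union> {0})" by (rule unramified_off_insert) simp
  then show ?thesis by (rule that) simp
qed

theorem vertical_line_component: "eval2 f 0 y = 0"
proof -
  have "slice f 0 = 0"
  proof (rule ccontr)
    assume nz: "slice f 0 \<noteq> 0"
    \<comment> \<open>If the slice were a nonzero constant, \<open>partial_y f\<close> would vanish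
      on the line \<open>x = 0\<close>, while \<open>partial_x f\<close> restricts to a polynomial
      of positive degree; a root of it would be a critical point with nonzero value.\<close>
    have pos: "degree (slice f 0) > 0"
    proof (rule ccontr)
      assume "\<not> ?thesis"
      then obtain a where a: "slice f 0 = [:a:]" by (auto elim: degree_eq_zeroE)
      have "coeff (slice (partial_x f) 0) n = 1"
        by (simp add: coeff_slice partial_x_def coeff_map_poly coeff_f_n pderiv_pCons)
      then have "degree (slice (partial_x f) 0) > 0" using n_pos le_degree[of "slice (partial_x f) 0" n] by simp
      then obtain y where y: "eval2 (partial_x f) 0 y = 0"
        using fundamental_theorem_of_algebra[of "slice (partial_x f) 0"] constant_degree[of "slice (partial_x f) 0"]
        by (auto simp: poly_slice)
      have "eval2 (partial_y f) 0 y = 0"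
        unfolding partial_y_def poly_slice[symmetric] pderiv_slice a by simp
      then have "eval2 f 0 y = 0" using crit y by (simp add: critical_point_def)
      then have "poly (slice f 0) y = 0" by (simp add: poly_slice)
      then show False using nz by (simp add: a)
    qed
    have slice_pos: "degree (slice f x) > 0" for x
      using pos degree_slice_off_0[of x] n_pos by (cases "x = 0") auto
    have p0: "slice f x \<noteq> 0" for x using slice_pos[of x] by auto
    have n2: "n \<ge> 2" using pos degree_slice_0 by linarith
    obtain \<rho> where \<rho>: "\<rho> \<ge> 1" "\<And>x y. norm x > \<rho> \<Longrightarrow> eval2 (pderiv f) x y = 0 \<Longrightarrow>
        eval2 f x y \<noteq> 0 \<and> norm (eval2 f x y) \<le> 1 * norm x * norm (eval2 (partial_x f) x y)"
      by (rule control_at_infinity) (rule that)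
    have pc: "polar_control f (pderiv f)"
      unfolding polar_control_def
    proof (intro conjI allI impI)
      show "slice (pderiv f) x0 \<noteq> 0" for x0
        using slice_pos[of x0] by (simp add: pderiv_slice pderiv_eq_0_iff)
      show "eval2 (partial_y f) x y = 0" if "eval2 (pderiv f) x y = 0" for x y
        using that by (simp add: partial_y_def)
      show "\<exists>\<rho> C. \<forall>x y. norm x > \<rho> \<longrightarrow> eval2 (pderiv f) x y = 0 \<longrightarrow>
          eval2 f x y \<noteq> 0 \<and> norm (eval2 f x y) \<le> C * norm x * norm (eval2 (partial_x f) x y)"
        using \<rho>(2) by blast
      show "\<exists>\<delta> M C. \<delta> > 0 \<and> (\<forall>x y. x \<noteq> x0 \<longrightarrow> dist x x0 < \<delta> \<longrightarrow> norm y > M \<longrightarrow> eval2 (pderiv f) x y = 0 \<longrightarrow>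
          norm (eval2 f x y) \<le> C * norm (x - x0) * norm (eval2 (partial_x f) x y))" for x0
      proof (cases "x0 = 0")
        case True
        then show ?thesis using control_at_vertical_asymptote[OF pos] by simp
      next
        case False
        then show ?thesis using n_pos by (intro control_near_regular) (auto simp: lc_fy)
      qed
    qed
    obtain B where B: "unramified_off f B" "0 \<in> B" by (rule generic_fibres) (rule that)
    have finB: "finite B" using B(1) by (simp add: unramified_off_def)
    have cnt: "(\<Sum>s\<in>B. degree (pderiv f) - bad_count f (pderiv f) s) \<le> degree (pderiv f)"
      by (rule polar_count[OF pc finB crit])
    let ?r = "\<lambda>s. card {y. eval2 f s y = 0}"
    \<comment> \<open>The two shifts by one cancel: \<open>(n - 1) - (r - 1) = n - r\<close>, the
      number of mergers over \<open>s\<close>.\<close>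
    have "bad_count f (pderiv f) s = ?r s - 1" for s
      unfolding bad_count_def pderiv_slice poly_slice[symmetric]
      by (rule size_filter_proots_pderiv[OF slice_pos])
    moreover have r_pos: "?r s > 0" for s
    proof -
      have "finite {y. eval2 f s y = 0}" using poly_roots_finite[OF p0[of s]] by (simp add: poly_slice)
      moreover have "{y. eval2 f s y = 0} \<noteq> {}"
        using slice_pos[of s] fundamental_theorem_of_algebra[of "slice f s"] constant_degree[of "slice f s"]
        by (auto simp: poly_slice)
      ultimately show ?thesis by (simp add: card_gt_0_iff)
    qed
    ultimately have "degree (pderiv f) - bad_count f (pderiv f) s = n - ?r s" for s
      using n_pos r_pos[of s] by (simp add: degree_fy)
    then have cnt': "(\<Sum>s\<in>B. n - ?r s) \<le> n - 1" using cnt by (simp add: degree_fy)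
    have "?r 0 \<le> degree (slice f 0)"
      using card_poly_roots_bound[OF p0[of 0]] by (simp add: poly_slice)
    then have r0: "?r 0 < n" using degree_slice_0 by linarith
    have "(\<Sum>s\<in>B. n - ?r s) = (n - ?r 0) + (\<Sum>s\<in>B - {0}. n - ?r s)"
      using finB B(2) by (rule sum.remove)
    moreover have "(\<Sum>s\<in>B. n - (?r s + (if s = 0 then 1 else 0))) =
        (n - (?r 0 + (if (0 :: complex) = 0 then 1 else 0))) + (\<Sum>s\<in>B - {0}. n - (?r s + (if s = 0 then 1 else 0)))"
      using finB B(2) by (rule sum.remove)
    moreover have "(\<Sum>s\<in>B - {0}. n - (?r s + (if s = 0 then 1 else 0))) = (\<Sum>s\<in>B - {0}. n - ?r s)"
      by (intro sum.cong) auto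
    ultimately have "(\<Sum>s\<in>B. n - (?r s + (if s = 0 then 1 else 0))) + 1 = (\<Sum>s\<in>B. n - ?r s)"
      using r0 by simp
    \<comment> \<open>The extra limit at infinity over 0 turns the bound \<open>n - 1\<close> into
      \<open>n - 2\<close>. The natural subtraction there is exact because fewer than
      \<open>n\<close> roots are finite.\<close>
    then have few: "(\<Sum>s\<in>B. degree f - (?r s + (if s = 0 then 1 else 0))) + 2 \<le> degree f"
      using cnt' n2 unfolding deg_f by linarith
    obtain c \<rho>' where sep: "c > 0" "\<And>x y y'. norm x > \<rho>' \<Longrightarrow> eval2 f x y = 0 \<Longrightarrow> eval2 f x y' = 0 \<Longrightarrow> y \<noteq> y' \<Longrightarrow>
        norm (y - y') \<ge> c * norm x"
      by (rule root_separation) (rule that)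
    show False
      by (rule few_merges_contradiction[OF B p0 _ sep few]) (use lc_f in simp_all)
  qed
  then show ?thesis by (metis poly_0 poly_slice)
qed

text \<open>Now \<open>f = x g\<close>, and on the roots of \<open>p = g\<^sub>y\<close> the whole growth of \<open>f / f\<^sub>x\<close> is used up by the
  line \<open>x = 0\<close>, so that no further singular points are left over for the other fibres.\<close>

theorem singular_points_vertical:
  assumes sing: "eval2 f x1 y1 = 0" "eval2 (pderiv f) x1 y1 = 0"
  shows "x1 = 0"
proof (rule ccontr)
  assume x1: "x1 \<noteq> 0"
  \<comment> \<open>The polar curve without the line \<open>x = 0\<close>: \<open>pderiv f\<close>
    is divisible by \<open>x\<close>, and the quotient has a constant leading coefficient, so none
    of its roots escapes.\<close>
  define p where "p = map_poly (poly_shift 1) (pderiv f)"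
  have f0: "slice f 0 = 0"
    using vertical_line_component by (simp add: poly_eq_poly_eq_iff[symmetric] fun_eq_iff poly_slice)
  have fy_eq: "eval2 (pderiv f) x y = x * eval2 p x y" for x y
  proof -
    have "coeff (coeff (pderiv f) j) 0 = 0" for j
    proof -
      have "slice (pderiv f) 0 = 0" by (simp add: pderiv_slice f0)
      then show ?thesis by (metis coeff_0 coeff_slice poly_0_coeff_0)
    qed
    then have "coeff (pderiv f) j = pCons 0 (coeff p j)" for j
      by (simp add: p_def coeff_map_poly poly_eq_iff coeff_poly_shift coeff_pCons split: nat.splits)
    then have "slice (pderiv f) x = smult x (slice p x)"
      by (intro poly_eqI) (simp add: coeff_slice)
    then show ?thesis by (metis poly_smult poly_slice)
  qed
  have p_root: "eval2 (pderiv f) x y = 0" if "eval2 p x y = 0" for x y using that by (simp add: fy_eq)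
  have coeff_p: "coeff p j = poly_shift 1 (coeff (pderiv f) j)" for j by (simp add: p_def coeff_map_poly)
  have "coeff p (n - 1) = [:of_nat n:]"
    using lc_fy unfolding degree_fy coeff_p
    by (simp add: poly_eq_iff coeff_poly_shift coeff_pCons split: nat.splits)
  moreover have "degree p \<le> n - 1"
    by (rule degree_le) (use degree_fy in \<open>auto simp: coeff_p coeff_eq_0\<close>)
  ultimately have deg_p: "degree p = n - 1" and lc_p: "lead_coeff p = [:of_nat n:]"
    using n_pos le_degree[of p "n - 1"] by (auto simp: le_antisym)
  have deg_slice_p: "degree (slice p x) = n - 1" and slice_p: "slice p x \<noteq> 0" for x
  proof -
    have "poly (lead_coeff p) x \<noteq> 0" using n_pos by (simp add: lc_p)
    then show "degree (slice p x) = n - 1" by (simp add: degree_slice deg_p)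
    have "coeff (slice p x) (n - 1) \<noteq> 0" using lc_p n_pos by (simp add: coeff_slice deg_p)
    then show "slice p x \<noteq> 0" by auto
  qed
  obtain \<rho> where \<rho>: "\<rho> \<ge> 1" "\<And>x y. norm x > \<rho> \<Longrightarrow> eval2 (pderiv f) x y = 0 \<Longrightarrow>
      eval2 f x y \<noteq> 0 \<and> norm (eval2 f x y) \<le> 1 * norm x * norm (eval2 (partial_x f) x y)"
    by (rule control_at_infinity) (rule that)
  have pc: "polar_control f p"
    unfolding polar_control_def
  proof (intro conjI allI impI)
    show "\<exists>\<rho> C. \<forall>x y. norm x > \<rho> \<longrightarrow> eval2 p x y = 0 \<longrightarrow>
        eval2 f x y \<noteq> 0 \<and> norm (eval2 f x y) \<le> C * norm x * norm (eval2 (partial_x f) x y)"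
      using \<rho>(2) p_root by blast
    show "\<exists>\<delta> M C. \<delta> > 0 \<and> (\<forall>x y. x \<noteq> x0 \<longrightarrow> dist x x0 < \<delta> \<longrightarrow> norm y > M \<longrightarrow> eval2 p x y = 0 \<longrightarrow>
        norm (eval2 f x y) \<le> C * norm (x - x0) * norm (eval2 (partial_x f) x y))" for x0
      using n_pos p_root by (intro control_near_regular) (auto simp: lc_p)
  qed (use slice_p p_root in \<open>auto simp: partial_y_def\<close>)
  have "(\<Sum>s\<in>{0, x1}. degree p - bad_count f p s) \<le> degree p"
    by (rule polar_count[OF pc _ crit]) simp
  \<comment> \<open>\<open>f\<close> vanishes on the whole line \<open>x = 0\<close>, so the fibre
    over 0 alone exhausts the bound \<open>degree p\<close>.\<close>
  moreover have "bad_count f p 0 = 0"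
    by (simp add: bad_count_def vertical_line_component)
  \<comment> \<open>Every root of \<open>p\<close> over \<open>x1\<close> would have to be one where
    \<open>f\<close> is nonzero, but \<open>y1\<close> is among these roots.\<close>
  ultimately have bad: "degree p \<le> bad_count f p x1" using x1 by simp
  have y1: "y1 \<in># proots (slice p x1)"
    using sing(2) x1 slice_p[of x1] by (simp add: fy_eq poly_slice)
  have "bad_count f p x1 < size (proots (slice p x1))"
    unfolding bad_count_def
  proof (rule mset_subset_size)
    show "filter_mset (\<lambda>y. eval2 f x1 y \<noteq> 0) (proots (slice p x1)) \<subset># proots (slice p x1)"
    proof (rule subset_mset.le_neq_trans[OF multiset_filter_subset])
      show "filter_mset (\<lambda>y. eval2 f x1 y \<noteq> 0) (proots (slice p x1)) \<noteq> proots (slice p x1)"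
      proof
        assume "filter_mset (\<lambda>y. eval2 f x1 y \<noteq> 0) (proots (slice p x1)) = proots (slice p x1)"
        then have "y1 \<in># filter_mset (\<lambda>y. eval2 f x1 y \<noteq> 0) (proots (slice p x1))" using y1 by simp
        then show False using sing(1) by simp
      qed
    qed
  qed
  then show False using bad by (simp add: size_proots_complex deg_slice_p deg_p)
qed

end

subsection \<open>The asymptotic lines are concurrent\<close>

definition hom_part :: "bipoly \<Rightarrow> nat \<Rightarrow> complex \<Rightarrow> complex \<Rightarrow> complex" where
  "hom_part h k x y = (\<Sum>j\<le>k. coeff (coeff h j) (k - j) * x ^ (k - j) * y ^ j)"

lemma hom_part_scale: "hom_part h k (t * x) (t * y) = t ^ k * hom_part h k x y"
proof -
  have "(t * x) ^ (k - j) * (t * y) ^ j = t ^ k * (x ^ (k - j) * y ^ j)" if "j \<le> k" for j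
  proof -
    have "t ^ (k - j) * t ^ j = t ^ k" using that by (simp add: power_add[symmetric])
    then show ?thesis by (simp add: power_mult_distrib mult_ac)
  qed
  then show ?thesis
    unfolding hom_part_def sum_distrib_left by (intro sum.cong) (simp_all add: mult_ac)
qed

lemma poly_top_form: "poly (top_form h k) z = hom_part h k 1 z"
  by (simp add: top_form_def hom_part_def poly_sum poly_monom)

lemma eval2_hom_parts:
  assumes "tdeg_le h d"
  shows "eval2 h x y = (\<Sum>k\<le>d. hom_part h k x y)"
proof -
  let ?t = "\<lambda>j i. coeff (coeff h j) i * x ^ i * y ^ j"
  have "eval2 h x y = (\<Sum>j\<le>d. \<Sum>i\<le>d - j. ?t j i)"
    by (rule eval2_double_sum[OF assms])
  also have "\<dots> = (\<Sum>(j, i)\<in>(SIGMA j:{..d}. {..d - j}). ?t j i)"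
    by (rule sum.Sigma) auto
  also have "\<dots> = (\<Sum>(j, i)\<in>{(j, i). j + i \<le> d}. ?t j i)"
    by (intro sum.cong) auto
  also have "\<dots> = (\<Sum>k\<le>d. \<Sum>j\<le>k. ?t j (k - j))"
    by (rule sum.triangle_reindex_eq)
  finally show ?thesis by (simp only: hom_part_def)
qed

lemma tdeg_le_0 [simp]: "tdeg_le 0 d"
  by (simp add: tdeg_le_def)

lemma tdeg_le_add: "tdeg_le p d \<Longrightarrow> tdeg_le q d \<Longrightarrow> tdeg_le (p + q) d"
  unfolding tdeg_le_def by (metis add.right_neutral add_0 coeff_add)

lemma tdeg_le_sum: "(\<And>i. i \<in> A \<Longrightarrow> tdeg_le (g i) d) \<Longrightarrow> tdeg_le (sum g A) d"
  by (induction A rule: infinite_finite_induct) (auto intro: tdeg_le_add)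

lemma tdeg_le_mono: "tdeg_le p d \<Longrightarrow> d \<le> e \<Longrightarrow> tdeg_le p e"
  unfolding tdeg_le_def by (meson order_trans)

lemma tdeg_le_mult:
  assumes "tdeg_le p d" "tdeg_le q e"
  shows "tdeg_le (p * q) (d + e)"
  unfolding tdeg_le_def
proof (intro allI impI)
  fix i j assume "coeff (coeff (p * q) j) i \<noteq> 0"
  then have "(\<Sum>k\<le>j. \<Sum>l\<le>i. coeff (coeff p k) l * coeff (coeff q (j - k)) (i - l)) \<noteq> 0"
    by (simp add: coeff_mult coeff_sum)
  then obtain k where k: "k \<le> j" "(\<Sum>l\<le>i. coeff (coeff p k) l * coeff (coeff q (j - k)) (i - l)) \<noteq> 0"
    by (auto elim: sum.not_neutral_contains_not_neutral)
  then obtain l where l: "l \<le> i" "coeff (coeff p k) l * coeff (coeff q (j - k)) (i - l) \<noteq> 0"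
    by (auto elim: sum.not_neutral_contains_not_neutral)
  then have "l + k \<le> d" "(i - l) + (j - k) \<le> e"
    using assms unfolding tdeg_le_def by (metis mult_eq_0_iff)+
  then show "i + j \<le> d + e" using k(1) l(1) by linarith
qed

lemma tdeg_le_const: "tdeg_le [:[:c:]:] d"
  by (auto simp: tdeg_le_def coeff_pCons split: nat.splits)

lemma tdeg_le_power: "tdeg_le p 1 \<Longrightarrow> tdeg_le (p ^ k) k"
proof (induction k)
  case 0
  show ?case using tdeg_le_const[of 1 0] by (simp add: one_pCons)
next
  case (Suc k)
  then show ?case using tdeg_le_mult[of p 1 "p ^ k" k] by simp
qed

lemma tdeg_le_affine: "tdeg_le [:[:c, a:], [:b:]:] 1"
  by (auto simp: tdeg_le_def coeff_pCons split: nat.splits)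

lemma affine_substitution:
  assumes "tdeg_le h d"
  obtains f where "tdeg_le f d"
    "\<And>u v. eval2 f u v = \<kappa> * (eval2 h (a * u + b * v + s) (a' * u + b' * v + s') - c)"
proof
  define L where "L = [:[:s, a:], [:b:]:]"
  define L' where "L' = [:[:s', a':], [:b':]:]"
  define g where "g = (\<Sum>j\<le>degree h. \<Sum>i\<le>degree (coeff h j). [:[:coeff (coeff h j) i:]:] * (L ^ i * L' ^ j))"
  define f where "f = [:[:\<kappa>:]:] * (g + [:[:- c:]:])"
  have "tdeg_le ([:[:coeff (coeff h j) i:]:] * (L ^ i * L' ^ j)) d" for i j
  proof (cases "coeff (coeff h j) i = 0")
    case False
    then have "i + j \<le> d" using assms by (simp add: tdeg_le_def)
    moreover have "tdeg_le (L ^ i) i" "tdeg_le (L' ^ j) j"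
      unfolding L_def L'_def by (intro tdeg_le_power tdeg_le_affine)+
    then have "tdeg_le ([:[:coeff (coeff h j) i:]:] * (L ^ i * L' ^ j)) (0 + (i + j))"
      by (intro tdeg_le_mult tdeg_le_const)
    ultimately show ?thesis by (auto intro: tdeg_le_mono)
  qed simp
  then have "tdeg_le g d" unfolding g_def by (intro tdeg_le_sum)
  then have "tdeg_le f (0 + d)"
    unfolding f_def by (intro tdeg_le_mult tdeg_le_add tdeg_le_const)
  then show "tdeg_le f d" by simp
  fix u v
  have "eval2 g u v = eval2 h (eval2 L u v) (eval2 L' u v)"
    by (simp only: g_def eval2_sum eval2_mult eval2_power eval2_const eval2_altdef[of h] poly_altdef[of "coeff h _"]
        sum_distrib_right mult.assoc) simp
  moreover have "eval2 L u v = a * u + b * v + s" "eval2 L' u v = a' * u + b' * v + s'"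
    by (simp_all add: L_def L'_def eval2_pCons algebra_simps)
  ultimately show "eval2 f u v = \<kappa> * (eval2 h (a * u + b * v + s) (a' * u + b' * v + s') - c)"
    by (simp add: f_def eval2_smult eval2_add eval2_const)
qed

text \<open>Evaluates the homogenization \<open>\<tau>\<^sup>d h(x/\<tau>, y/\<tau>)\<close> of both sides at \<open>\<tau> = 0\<close>.\<close>

lemma hom_part_affine:
  assumes h: "tdeg_le h d" and f: "tdeg_le f d" and d: "d > 0"
    and eq: "\<And>u v. eval2 f u v = \<kappa> * (eval2 h (a * u + b * v + s) (a' * u + b' * v + s') - c)"
  shows "hom_part f d u v = \<kappa> * hom_part h d (a * u + b * v) (a' * u + b' * v)"
proof -
  define G where "G = (\<lambda>p x y \<tau>. \<Sum>k\<le>d. \<tau> ^ (d - k) * hom_part p k x y)"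
  have G: "G p x y \<tau> = \<tau> ^ d * eval2 p (x / \<tau>) (y / \<tau>)" if "tdeg_le p d" "\<tau> \<noteq> 0" for p x y \<tau>
  proof -
    have "hom_part p k x y = \<tau> ^ k * hom_part p k (x / \<tau>) (y / \<tau>)" for k
      using hom_part_scale[of p k \<tau> "x / \<tau>" "y / \<tau>"] that(2) by simp
    then have "\<tau> ^ (d - k) * hom_part p k x y = \<tau> ^ d * hom_part p k (x / \<tau>) (y / \<tau>)" if "k \<le> d" for k
      using that by (simp add: mult.assoc[symmetric] power_add[symmetric])
    then show ?thesis
      unfolding G_def eval2_hom_parts[OF that(1)] sum_distrib_left by (intro sum.cong) auto
  qed
  have G0: "G p x y 0 = hom_part p d x y" for p x y
  proof -
    have "G p x y 0 = (\<Sum>k\<le>d. if k = d then hom_part p k x y else 0)"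
      unfolding G_def by (intro sum.cong) auto
    then show ?thesis by simp
  qed
  let ?x = "a * u + b * v" and ?y = "a' * u + b' * v"
  define A where "A = (\<lambda>\<tau>. G f u v \<tau>)"
  define B where "B = (\<lambda>\<tau>. \<kappa> * (G h (?x + s * \<tau>) (?y + s' * \<tau>) \<tau> - c * \<tau> ^ d))"
  have "A \<tau> = B \<tau>" if "\<tau> \<noteq> 0" for \<tau>
  proof -
    have 1: "a * (u / \<tau>) + b * (v / \<tau>) + s = (?x + s * \<tau>) / \<tau>"
      and 2: "a' * (u / \<tau>) + b' * (v / \<tau>) + s' = (?y + s' * \<tau>) / \<tau>"
      using that by (simp_all add: add_divide_distrib)
    have "A \<tau> = \<tau> ^ d * (\<kappa> * (eval2 h ((?x + s * \<tau>) / \<tau>) ((?y + s' * \<tau>) / \<tau>) - c))"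
      unfolding A_def G[OF f that] eq[of "u / \<tau>" "v / \<tau>"] 1 2 ..
    also have "\<dots> = B \<tau>"
      unfolding B_def G[OF h that] by (simp only: right_diff_distrib mult_ac)
    finally show ?thesis .
  qed
  then have "(A \<midarrow>0\<rightarrow> B 0) \<longleftrightarrow> (B \<midarrow>0\<rightarrow> B 0)" by (intro LIM_equal) simp
  moreover have "isCont A 0" "isCont B 0"
    unfolding A_def B_def G_def hom_part_def by simp_all
  ultimately have "A \<midarrow>0\<rightarrow> A 0" "A \<midarrow>0\<rightarrow> B 0" unfolding isCont_def by blast+
  then have "A 0 = B 0" by (rule LIM_unique)
  then show ?thesis using d by (simp add: A_def B_def G0)
qed

lemma critical_point_affine:
  assumes eq: "\<And>u v. eval2 f u v = \<kappa> * (eval2 h (a * u + b * v + s) (a' * u + b' * v + s') - c)"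
  shows "eval2 (partial_x f) u v = \<kappa> * (a * eval2 (partial_x h) (a * u + b * v + s) (a' * u + b' * v + s') +
      a' * eval2 (partial_y h) (a * u + b * v + s) (a' * u + b' * v + s'))"
    and "eval2 (partial_y f) u v = \<kappa> * (b * eval2 (partial_x h) (a * u + b * v + s) (a' * u + b' * v + s') +
      b' * eval2 (partial_y h) (a * u + b * v + s) (a' * u + b' * v + s'))"
proof -
  let ?X = "a * u + b * v + s" and ?Y = "a' * u + b' * v + s'"
  have "((\<lambda>u. eval2 f u v) has_field_derivative eval2 (partial_x f) u v) (at u)"
    using eval2_has_derivative[where p = f and \<xi> = "\<lambda>u. u" and Y = "\<lambda>_. v", OF DERIV_ident DERIV_const] by simp
  moreover have "((\<lambda>u. \<kappa> * (eval2 h (a * u + b * v + s) (a' * u + b' * v + s') - c)) has_field_derivative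
      \<kappa> * (eval2 (partial_x h) ?X ?Y * a + eval2 (partial_y h) ?X ?Y * a')) (at u)"
    by (rule derivative_eq_intros eval2_has_derivative refl | simp)+
  ultimately show "eval2 (partial_x f) u v = \<kappa> * (a * eval2 (partial_x h) ?X ?Y + a' * eval2 (partial_y h) ?X ?Y)"
    unfolding eq by (auto dest: DERIV_unique simp: mult.commute)
  have "((\<lambda>v. eval2 f u v) has_field_derivative eval2 (partial_y f) u v) (at v)"
    using eval2_has_derivative[where p = f and \<xi> = "\<lambda>_. u" and Y = "\<lambda>v. v", OF DERIV_const DERIV_ident] by simp
  moreover have "((\<lambda>v. \<kappa> * (eval2 h (a * u + b * v + s) (a' * u + b' * v + s') - c)) has_field_derivative
      \<kappa> * (eval2 (partial_x h) ?X ?Y * b + eval2 (partial_y h) ?X ?Y * b')) (at v)"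
    by (rule derivative_eq_intros eval2_has_derivative refl | simp)+
  ultimately show "eval2 (partial_y f) u v = \<kappa> * (b * eval2 (partial_x h) ?X ?Y + b' * eval2 (partial_y h) ?X ?Y)"
    unfolding eq by (auto dest: DERIV_unique simp: mult.commute)
qed

text \<open>A common zero of two factors would make their coefficient vectors proportional, so
  exactly one factor vanishes at a root, and its slope is nonzero.\<close>

lemma simple_roots_prod_linear:
  fixes A D :: "'i \<Rightarrow> complex"
  assumes fin: "finite I" and ne: "\<And>j. j \<in> I \<Longrightarrow> A j \<noteq> 0 \<or> D j \<noteq> 0"
    and np: "\<And>j k. j \<in> I \<Longrightarrow> k \<in> I \<Longrightarrow> j \<noteq> k \<Longrightarrow> A j * D k \<noteq> A k * D j"
    and root: "poly (\<Prod>j\<in>I. [:A j, D j:]) z = 0"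
  shows "poly (pderiv (\<Prod>j\<in>I. [:A j, D j:])) z \<noteq> 0"
proof -
  obtain j where j: "j \<in> I" "A j + z * D j = 0" using root fin by (auto simp: poly_prod)
  have A: "A j = - z * D j" using j(2) by (simp add: eq_neg_iff_add_eq_0)
  then have D: "D j \<noteq> 0" using ne[OF j(1)] by auto
  have "A k + z * D k \<noteq> 0" if "k \<in> I - {j}" for k
  proof
    assume "A k + z * D k = 0"
    then have "A k = - z * D k" by (simp add: eq_neg_iff_add_eq_0)
    then show False using np[OF j(1), of k] that A by (auto simp: mult_ac)
  qed
  then have R: "poly (\<Prod>k\<in>I - {j}. [:A k, D k:]) z \<noteq> 0" using fin by (simp add: poly_prod)
  have "(\<Prod>k\<in>I. [:A k, D k:]) = [:A j, D j:] * (\<Prod>k\<in>I - {j}. [:A k, D k:])"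
    using fin j(1) by (rule prod.remove)
  then have "poly (pderiv (\<Prod>k\<in>I. [:A k, D k:])) z = D j * poly (\<Prod>k\<in>I - {j}. [:A k, D k:]) z"
    using j(2) by (simp add: pderiv_mult pderiv_pCons del: mult_pCons_left)
  then show ?thesis using D R by simp
qed

text \<open>The vector \<open>(p, q)\<close> takes the value 1 under the i-th form and
  \<open>(- b i, a i)\<close> spans its kernel. In coordinates \<open>u\<close>, \<open>v\<close>
  along these vectors, shifted by \<open>\<sigma>\<close>, the function
  \<open>\<kappa> * (H - c)\<close> fits the locale \<open>vertical_asymptote\<close>.
  \<open>A j\<close> and \<open>D j\<close> are the values of the j-th form on the two vectors, and
  \<open>\<kappa>\<close> makes the coefficient of \<open>u * v ^ n\<close> equal to 1.\<close>

lemma asymptotic_line: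
  fixes a b :: "nat \<Rightarrow> complex"
  assumes td: "tdeg_le H (Suc n)" and n: "n > 0"
    and hom: "\<And>x y. hom_part H (Suc n) x y = (\<Prod>j<Suc n. a j * x + b j * y)"
    and np: "\<And>j k. j < Suc n \<Longrightarrow> k < Suc n \<Longrightarrow> j \<noteq> k \<Longrightarrow> a j * b k \<noteq> a k * b j"
    and crit_H: "\<And>x y. critical_point H x y \<Longrightarrow> eval2 H x y = c"
    and i: "i < Suc n"
  shows "\<exists>\<sigma>. (\<forall>x y. a i * x + b i * y = \<sigma> \<longrightarrow> eval2 H x y = c) \<and>
    (\<forall>x y. critical_point H x y \<longrightarrow> a i * x + b i * y = \<sigma>)"
proof -
  \<comment> \<open>A zero form would be proportional to any other one; \<open>n > 0\<close>
    supplies a second index.\<close>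
  have ne: "a j \<noteq> 0 \<or> b j \<noteq> 0" if "j < Suc n" for j
    using np[of j 1] np[of j 0] that n by (cases "j = 0") auto
  obtain p q where pq: "a i * p + b i * q = 1"
  proof (cases "a i = 0")
    case True
    with ne[OF i] show ?thesis by (intro that[of 0 "1 / b i"]) simp
  next
    case False
    then show ?thesis by (intro that[of "1 / a i" 0]) simp
  qed
  define A where "A j = a j * p + b j * q" for j
  define D where "D j = a i * b j - a j * b i" for j
  define J where "J = {..<Suc n} - {i}"
  define \<kappa> where "\<kappa> = 1 / (\<Prod>j\<in>J. D j)"
  define T where "T = smult \<kappa> (\<Prod>j<Suc n. [:A j, D j:])"
  have D_ne: "D j \<noteq> 0" if "j \<in> J" for j using np[of i j] i that by (auto simp: J_def D_def)
  then have \<kappa>: "\<kappa> \<noteq> 0" by (simp add: \<kappa>_def J_def)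
  have card_J: "card J = n" using i by (simp add: J_def)
  have "(\<Prod>j<Suc n. [:A j, D j:]) = [:A i, D i:] * (\<Prod>j\<in>J. [:A j, D j:])"
    unfolding J_def by (rule prod.remove) (use i in auto)
  then have T_J: "T = smult \<kappa> (\<Prod>j\<in>J. [:A j, D j:])"
    using pq by (simp add: T_def A_def D_def one_pCons[symmetric])
  have "degree (\<Prod>j\<in>J. [:A j, D j:]) = (\<Sum>j\<in>J. degree [:A j, D j:])"
    using D_ne by (intro degree_prod_sum_eq) auto
  also have "\<dots> = (\<Sum>j\<in>J. 1)" using D_ne by (intro sum.cong) auto
  finally have deg_P: "degree (\<Prod>j\<in>J. [:A j, D j:]) = n" by (simp add: card_J)
  have "lead_coeff (\<Prod>j\<in>J. [:A j, D j:]) = (\<Prod>j\<in>J. lead_coeff [:A j, D j:])"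
    by (rule lead_coeff_prod)
  also have "\<dots> = (\<Prod>j\<in>J. D j)" using D_ne by (intro prod.cong) auto
  finally have T_n: "coeff T n = 1" using \<kappa> by (simp add: T_J deg_P \<kappa>_def)
  have T_Suc: "coeff T (Suc n) = 0" by (simp add: T_J coeff_eq_0 deg_P)
  have sep: "poly (pderiv T) z \<noteq> 0" if "poly T z = 0" for z
  proof -
    have "A j * D k - A k * D j = (a j * b k - a k * b j) * (a i * p + b i * q)" for j k
      by (simp add: A_def D_def algebra_simps)
    then have "A j * D k - A k * D j = a j * b k - a k * b j" for j k by (simp add: pq)
    then have AD: "A j * D k \<noteq> A k * D j" if "j < Suc n" "k < Suc n" "j \<noteq> k" for j k
      using np[OF that] by (metis eq_iff_diff_eq_0)
    have "A j \<noteq> 0 \<or> D j \<noteq> 0" if "j < Suc n" for j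
      using AD[of j 1] AD[of j 0] that n by (cases "j = 0") auto
    then have "poly (pderiv (\<Prod>j<Suc n. [:A j, D j:])) z \<noteq> 0"
      using that \<kappa> AD by (intro simple_roots_prod_linear) (auto simp: T_def)
    then show ?thesis using \<kappa> by (simp add: T_def pderiv_smult)
  qed
  have "\<exists>f. tdeg_le f (Suc n) \<and>
      (\<forall>u v. eval2 f u v = \<kappa> * (eval2 H (p * u + (- b i) * v + p * \<sigma>) (q * u + a i * v + q * \<sigma>) - c))" for \<sigma>
    by (rule affine_substitution[OF td, of \<kappa> p "- b i" "p * \<sigma>" q "a i" "q * \<sigma>" c]) blast
  then obtain F where td_F: "\<And>\<sigma>. tdeg_le (F \<sigma>) (Suc n)"
    and F: "\<And>\<sigma> u v. eval2 (F \<sigma>) u v =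
      \<kappa> * (eval2 H (p * u + (- b i) * v + p * \<sigma>) (q * u + a i * v + q * \<sigma>) - c)"
    by metis
  have top_F: "top_form (F \<sigma>) (Suc n) = T" for \<sigma>
  proof -
    have "poly (top_form (F \<sigma>) (Suc n)) z = poly T z" for z
    proof -
      have "poly (top_form (F \<sigma>) (Suc n)) z = \<kappa> * hom_part H (Suc n) (p * 1 + (- b i) * z) (q * 1 + a i * z)"
        unfolding poly_top_form by (rule hom_part_affine[OF td td_F _ F]) simp
      also have "\<dots> = \<kappa> * (\<Prod>j<Suc n. A j + z * D j)"
        unfolding hom by (intro arg_cong[of _ _ "times \<kappa>"] prod.cong) (simp_all add: A_def D_def algebra_simps)
      finally show ?thesis by (simp add: T_def poly_prod del: prod.lessThan_Suc)
    qed
    then show ?thesis by (simp add: poly_eq_poly_eq_iff[symmetric] fun_eq_iff)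
  qed
  define e where "e \<sigma> = coeff (coeff (F \<sigma>) n) 0" for \<sigma>
  have coeff_n: "coeff (F \<sigma>) n = [:e \<sigma>, 1:]" for \<sigma>
  proof (rule poly_eqI)
    fix k :: nat
    consider "k = 0" | "k = 1" | "k > 1" by linarith
    then show "coeff (coeff (F \<sigma>) n) k = coeff [:e \<sigma>, 1:] k"
    proof cases
      case 2
      have "coeff (coeff (F \<sigma>) n) 1 = coeff T n"
        unfolding top_F[of \<sigma>, symmetric] coeff_top_form by simp
      then show ?thesis using 2 T_n by simp
    next
      case 3
      then have "coeff (coeff (F \<sigma>) n) k = 0"
        using td_F[of \<sigma>] unfolding tdeg_le_def by (metis add.commute add_less_cancel_left not_le plus_1_eq_Suc)
      then show ?thesis using 3 by (simp add: coeff_pCons split: nat.splits)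
    qed (simp add: e_def)
  qed
  have deg_F: "degree (F \<sigma>) = n" for \<sigma>
  proof (rule antisym)
    have "coeff (F \<sigma>) (Suc n) = 0"
    proof (rule poly_eqI)
      fix k
      show "coeff (coeff (F \<sigma>) (Suc n)) k = coeff 0 k"
      proof (cases k)
        case 0
        have "coeff (coeff (F \<sigma>) (Suc n)) 0 = coeff T (Suc n)"
          unfolding top_F[of \<sigma>, symmetric] coeff_top_form by simp
        then show ?thesis using 0 T_Suc by simp
      next
        case (Suc l)
        then have "\<not> k + Suc n \<le> Suc n" by simp
        then show ?thesis using td_F[of \<sigma>] unfolding tdeg_le_def by (metis coeff_0)
      qed
    qed
    moreover have "degree (F \<sigma>) \<le> Suc n" by (rule tdeg_le_degree[OF td_F])
    ultimately show "degree (F \<sigma>) \<le> n"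
      by (metis degree_0 le_SucE leading_coeff_0_iff zero_le)
    show "n \<le> degree (F \<sigma>)" by (rule le_degree) (simp add: coeff_n)
  qed
  \<comment> \<open>The leading coefficient of \<open>F \<sigma>\<close> is
    \<open>e \<sigma> + u\<close>, and shifting the line adds the shift to \<open>e\<close>. This
    shift makes the coefficient exactly \<open>u\<close>, as the locale demands.\<close>
  define \<sigma> where "\<sigma> = - e 0"
  have "slice (F \<sigma>) 0 = slice (F 0) \<sigma>"
    by (simp add: poly_eq_poly_eq_iff[symmetric] fun_eq_iff poly_slice F add.commute)
  then have "e \<sigma> = e 0 + \<sigma>"
    using coeff_slice[of "F \<sigma>" 0 n] coeff_slice[of "F 0" \<sigma> n] by (simp add: coeff_n)
  then have e: "e \<sigma> = 0" by (simp add: \<sigma>_def)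
  note D1 = critical_point_affine(1)[OF F, of \<sigma>] and D2 = critical_point_affine(2)[OF F, of \<sigma>]
  interpret vertical_asymptote "F \<sigma>" n
  proof
    show "lead_coeff (F \<sigma>) = [:0, 1:]" by (simp add: deg_F coeff_n e)
    fix u v assume cp: "critical_point (F \<sigma>) u v"
    let ?X = "p * u + (- b i) * v + p * \<sigma>" and ?Y = "q * u + a i * v + q * \<sigma>"
    have 1: "p * eval2 (partial_x H) ?X ?Y + q * eval2 (partial_y H) ?X ?Y = 0"
      and 2: "- b i * eval2 (partial_x H) ?X ?Y + a i * eval2 (partial_y H) ?X ?Y = 0"
      using cp \<kappa> unfolding critical_point_def D1 D2 by auto
    have "eval2 (partial_x H) ?X ?Y = (a i * p + b i * q) * eval2 (partial_x H) ?X ?Y" by (simp add: pq)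
    also have "\<dots> = a i * (p * eval2 (partial_x H) ?X ?Y + q * eval2 (partial_y H) ?X ?Y) -
        q * (- b i * eval2 (partial_x H) ?X ?Y + a i * eval2 (partial_y H) ?X ?Y)"
      by (simp add: algebra_simps)
    finally have x: "eval2 (partial_x H) ?X ?Y = 0" by (simp only: 1 2) simp
    have "eval2 (partial_y H) ?X ?Y = (a i * p + b i * q) * eval2 (partial_y H) ?X ?Y" by (simp add: pq)
    also have "\<dots> = b i * (p * eval2 (partial_x H) ?X ?Y + q * eval2 (partial_y H) ?X ?Y) +
        p * (- b i * eval2 (partial_x H) ?X ?Y + a i * eval2 (partial_y H) ?X ?Y)"
      by (simp add: algebra_simps)
    finally have "eval2 (partial_y H) ?X ?Y = 0" by (simp only: 1 2) simp
    with x show "eval2 (F \<sigma>) u v = 0" by (simp only: F) (simp add: crit_H critical_point_def)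
  qed (use n deg_F td_F sep in \<open>auto simp: top_F\<close>)
  \<comment> \<open>The inverse change of coordinates, with
    \<open>v = p * y - q * x\<close>.\<close>
  have coords: "x = p * (a i * x + b i * y - \<sigma>) + (- b i) * (p * y - q * x) + p * \<sigma>"
    "y = q * (a i * x + b i * y - \<sigma>) + a i * (p * y - q * x) + q * \<sigma>" for x y
  proof -
    have "x = (a i * p + b i * q) * x" "y = (a i * p + b i * q) * y" by (simp_all add: pq)
    then show "x = p * (a i * x + b i * y - \<sigma>) + (- b i) * (p * y - q * x) + p * \<sigma>"
      "y = q * (a i * x + b i * y - \<sigma>) + a i * (p * y - q * x) + q * \<sigma>"
      by (simp_all add: algebra_simps)
  qed
  show ?thesis
  proof (intro exI[of _ \<sigma>] conjI allI impI)
    fix x y assume "a i * x + b i * y = \<sigma>"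
    then show "eval2 H x y = c"
      using vertical_line_component[of "p * y - q * x"] F[of \<sigma> 0 "p * y - q * x"] coords(1)[of x y] coords(2)[of y x] \<kappa> by simp
  next
    fix x y assume cp: "critical_point H x y"
    let ?u = "a i * x + b i * y - \<sigma>" and ?v = "p * y - q * x"
    have "eval2 (F \<sigma>) ?u ?v = 0"
      unfolding F coords(1)[of x y, symmetric] coords(2)[of y x, symmetric] using crit_H[OF cp] by simp
    moreover have "eval2 (pderiv (F \<sigma>)) ?u ?v = 0"
      unfolding partial_y_def[symmetric] D2 coords(1)[of x y, symmetric] coords(2)[of y x, symmetric] using cp by (simp add: critical_point_def)
    ultimately have "?u = 0" by (rule singular_points_vertical)
    then show "a i * x + b i * y = \<sigma>" by simp
  qed
qed

text \<open>A form of degree \<open>k\<close> that vanishes on more than \<open>k\<close> lines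
  through the origin is zero. The lines are counted by their slopes as roots of
  \<open>top_form\<close>, so a line \<open>x = 0\<close> is treated apart.\<close>

lemma hom_part_zero:
  fixes a b :: "nat \<Rightarrow> complex"
  assumes np: "\<And>i j. i < d \<Longrightarrow> j < d \<Longrightarrow> i \<noteq> j \<Longrightarrow> a i * b j \<noteq> a j * b i"
    and zero: "\<And>i. i < d \<Longrightarrow> hom_part h k (- b i) (a i) = 0" and k: "k < d"
  shows "hom_part h k x y = 0"
proof -
  let ?Q = "top_form h k"
  have hom_Q: "hom_part h k u v = u ^ k * poly ?Q (v / u)" if "u \<noteq> 0" for u v
    using hom_part_scale[of h k u 1 "v / u"] that by (simp add: poly_top_form)
  have hom_0: "hom_part h k 0 v = coeff ?Q k * v ^ k" for v
  proof -
    have "hom_part h k 0 v = (\<Sum>j\<le>k. if j = k then coeff ?Q k * v ^ k else 0)"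
      unfolding hom_part_def by (intro sum.cong) (auto simp: coeff_top_form)
    then show ?thesis by simp
  qed
  have deg: "degree ?Q \<le> k" by (rule degree_le) (simp add: coeff_top_form)
  define I where "I = {i. i < d \<and> b i \<noteq> 0}"
  have "inj_on (\<lambda>i. a i / (- b i)) I"
  proof (rule inj_onI)
    fix i j assume ij: "i \<in> I" "j \<in> I" "a i / (- b i) = a j / (- b j)"
    then have "a i * b j = a j * b i" by (auto simp: I_def field_simps)
    then show "i = j" using np[of i j] ij by (auto simp: I_def)
  qed
  then have card_I: "card ((\<lambda>i. a i / (- b i)) ` I) = card I" by (rule card_image)
  have roots: "(\<lambda>i. a i / (- b i)) ` I \<subseteq> {z. poly ?Q z = 0}"
  proof clarify
    fix i assume "i \<in> I"
    then have i: "i < d" "- b i \<noteq> 0" by (auto simp: I_def)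
    then show "poly ?Q (a i / - b i) = 0" using zero[OF i(1)] unfolding hom_Q[OF i(2)] by simp
  qed
  have "?Q = 0"
  proof (rule ccontr)
    assume nz: "?Q \<noteq> 0"
    have "card I \<le> card {z. poly ?Q z = 0}"
      unfolding card_I[symmetric] using roots poly_roots_finite[OF nz] by (intro card_mono)
    also have "\<dots> \<le> degree ?Q" by (rule card_poly_roots_bound[OF nz])
    finally have le: "card I \<le> degree ?Q" .
    show False
    proof (cases "\<exists>i0<d. b i0 = 0")
      case False
      then have "I = {..<d}" by (auto simp: I_def)
      then show False using le deg k by simp
    next
      \<comment> \<open>The vertical line has no slope and costs one root, but it makes the
        coefficient of \<open>y ^ k\<close> vanish and so lowers the degree as well.\<close>
      case True
      then obtain i0 where i0: "i0 < d" "b i0 = 0" by blast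
      have "b i \<noteq> 0" if "i < d" "i \<noteq> i0" for i using np[OF that(1) i0(1) that(2)] i0 by auto
      then have "I = {..<d} - {i0}" using i0 by (auto simp: I_def)
      then have card: "card I = d - 1" using i0 by simp
      have "coeff ?Q k = 0"
      proof (cases "d = 1")
        case True
        then have "k = 0" using k by simp
        then show ?thesis using zero[OF i0(1)] hom_0[of "a i0"] i0 by simp
      next
        case False
        then obtain j where "j < d" "j \<noteq> i0" using i0 by (metis less_one linorder_neqE_nat not_less_zero nat_neq_iff k gr_zeroI)
        then have "a i0 \<noteq> 0" using np[of i0 j] i0 by auto
        then show ?thesis using zero[OF i0(1)] hom_0[of "a i0"] i0 by simp
      qed
      then have "degree ?Q \<noteq> k" using nz by (metis leading_coeff_0_iff)
      then show False using le deg card k by linarith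
    qed
  qed
  then show ?thesis
    by (cases "x = 0") (simp_all add: hom_0 hom_Q)
qed

lemma total_degree_tdeg_le: "tdeg_le H (total_degree H)"
  unfolding tdeg_le_def total_degree_def
proof (intro allI impI)
  fix i j assume "coeff (coeff H j) i \<noteq> 0"
  then have "i + j \<in> insert 0 {i + j | i j. coeff (coeff H j) i \<noteq> 0}" by blast
  then show "i + j \<le> Max (insert 0 {i + j | i j. coeff (coeff H j) i \<noteq> 0})"
    by (intro Max_ge) (simp_all only: finite_insert Defs.finite_support)
qed

lemma eval2_principal_part: "eval2 (principal_part H) x y = hom_part H (total_degree H) x y"
proof -
  have "eval2 (monom (monom c i) j) x y = c * x ^ i * y ^ j" for c i j
    by (simp add: eval2_def poly_monom) 
  then show ?thesis by (simp add: principal_part_def Let_def eval2_sum hom_part_def)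
qed

lemma proportional_linear_form:
  assumes "a * b' = a' * b"
  shows "proportional (linear_form a b) (linear_form a' b')"
proof -
  consider "a' = 0" "b' = 0" | "a' \<noteq> 0" | "b' \<noteq> 0" by blast
  then show ?thesis
  proof cases
    case 1
    then have "linear_form a' b' = smult [:0:] (linear_form a b)" by (simp add: linear_form_def)
    then show ?thesis unfolding proportional_def by blast
  next
    case 2
    then have "linear_form a b = smult [:a / a':] (linear_form a' b')"
      using assms by (simp add: linear_form_def field_simps)
    then show ?thesis unfolding proportional_def by blast
  next
    case 3
    then have "linear_form a b = smult [:b / b':] (linear_form a' b')"
      using assms by (simp add: linear_form_def field_simps)
    then show ?thesis unfolding proportional_def by blast
  qed
qed

theorem theorem5:
  fixes H :: bipoly and n :: nat
  assumes "total_degree H = n + 1"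
    and "regular_at_infinity H"
    and "\<exists>!c. c \<in> critical_values H"
  shows "\<exists>\<alpha> \<beta> \<gamma> :: complex. \<forall>x y :: complex.
           eval2 H x y = eval2 (principal_part H) (x + \<alpha>) (y + \<beta>) + \<gamma>"
proof -
  have td: "tdeg_le H (Suc n)" using total_degree_tdeg_le[of H] assms(1) by simp
  have pp: "eval2 (principal_part H) x y = hom_part H (Suc n) x y" for x y
    by (simp add: eval2_principal_part assms(1))
  obtain a b where prod: "principal_part H = (\<Prod>i<Suc n. linear_form (a i) (b i))"
    and np: "\<And>i j. i < Suc n \<Longrightarrow> j < Suc n \<Longrightarrow> i \<noteq> j \<Longrightarrow> a i * b j \<noteq> a j * b i"
    using assms(2) proportional_linear_form unfolding regular_at_infinity_def assms(1) Suc_eq_plus1[symmetric] by metis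
  have hom: "hom_part H (Suc n) x y = (\<Prod>j<Suc n. a j * x + b j * y)" for x y
    unfolding pp[symmetric] prod eval2_prod eval2_linear_form ..
  obtain x0 y0 where cp: "critical_point H x0 y0"
    using assms(3) unfolding critical_values_def by blast
  define c where "c = eval2 H x0 y0"
  have crit: "eval2 H x y = c" if "critical_point H x y" for x y
    using assms(3) that cp unfolding critical_values_def c_def by blast
  show ?thesis
  \<comment> \<open>With a single linear form there is no second direction to compare;
    \<open>H\<close> is then its principal part plus a constant.\<close>
  proof (cases "n = 0")
    case True
    have "hom_part H 0 x y = hom_part H 0 0 0" for x y by (simp add: hom_part_def)
    then have "eval2 H x y = eval2 (principal_part H) x y + hom_part H 0 0 0" for x y
      unfolding eval2_hom_parts[OF td] pp True by simp
    then show ?thesis by (intro exI[of _ 0] exI[of _ "hom_part H 0 0 0"]) simp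
  next
    case False
    \<comment> \<open>Both conclusions of \<open>asymptotic_line\<close> are combined: the critical
      point lies on the line, so its constant \<open>\<sigma>\<close> is the value of the form at
      \<open>(x0, y0)\<close>.\<close>
    have line: "eval2 H x y = c" if "i < Suc n" "a i * x + b i * y = a i * x0 + b i * y0" for i x y
      using asymptotic_line[OF td _ hom np crit that(1)] False cp that(2) by auto
    obtain g where td_g: "tdeg_le g (Suc n)" and g: "\<And>u v. eval2 g u v = 1 * (eval2 H (1 * u + 0 * v + x0) (0 * u + 1 * v + y0) - c)"
      by (rule affine_substitution[OF td]) (rule that)
    have top_g: "hom_part g (Suc n) u v = hom_part H (Suc n) u v" for u v
      using hom_part_affine[OF td td_g _ g] by simp
    have zero_g: "hom_part g k (- b i) (a i) = 0" if i: "i < Suc n" for i k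
    proof (cases "k \<le> Suc n")
      case True
      \<comment> \<open>Along \<open>t * (- b i, a i)\<close> the function \<open>g\<close> is the
        polynomial \<open>?q\<close> in \<open>t\<close>, whose coefficients are the values of the
        homogeneous parts. It vanishes for all \<open>t\<close>, so each part vanishes on the line
        separately.\<close>
      let ?q = "\<Sum>k\<le>Suc n. monom (hom_part g k (- b i) (a i)) k"
      have "poly ?q t = 0" for t
      proof -
        have "eval2 g (t * - b i) (t * a i) = 0"
          unfolding g using line[OF i, of "t * - b i + x0" "t * a i + y0"] by (simp add: algebra_simps)
        then show ?thesis
          unfolding eval2_hom_parts[OF td_g] hom_part_scale
          by (simp add: poly_sum poly_monom mult.commute)
      qed
      then have "?q = 0" by (simp add: poly_eq_poly_eq_iff[symmetric] fun_eq_iff)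
      then have "coeff ?q k = 0" by simp
      then show ?thesis using True by (simp add: coeff_sum coeff_monom del: sum.atMost_Suc)
    next
      case False
      then have "coeff (coeff g j) (k - j) = 0" if "j \<le> k" for j
        using td_g that unfolding tdeg_le_def by (metis le_add_diff_inverse2)
      then show ?thesis by (simp add: hom_part_def)
    qed
    have "eval2 g u v = hom_part H (Suc n) u v" for u v
    proof -
      have "eval2 g u v = (\<Sum>k\<le>Suc n. if k = Suc n then hom_part g k u v else 0)"
        unfolding eval2_hom_parts[OF td_g]
        by (intro sum.cong) (auto intro!: hom_part_zero[OF np zero_g])
      then show ?thesis by (simp add: top_g)
    qed
    then have "eval2 H x y = eval2 (principal_part H) (x + - x0) (y + - y0) + c" for x y
      using g[of "x - x0" "y - y0"] unfolding pp by simp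
    then show ?thesis by blast
  qed
qed

end
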